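(* Let $\mathbb{K}$ be a locally compact topological field, $E$ a topological $\mathbb{K}$-vector space, $M$ a $C^\infty_{\mathbb{K}}$-manifold modeled on a topological $\mathbb{K}$-vector space, and $N$ a finite-dimensional $C^\infty_{\mathbb{K}}$-manifold. Then the following holds: (a) A map $g\colon M\to C^\infty(N,E)$ is of class $C^\infty_{\mathbb{K}}$ if and only if $g^\wedge\colon M\times N\to E$, $g^\wedge(x,y):=g(x)(y)$, is of class $C^\infty_{\mathbb{K}}$. (b) The map $\Phi\colon C^\infty(M\times N,E)\to C^\infty(M,C^\infty(N,E))$, $\Phi(f):=f^\vee$, where $f^\vee(x):=f(x,\cdot)$, is an isomorphism of topological $\mathbb{K}$-vector spaces, with inverse given by $\Phi^{-1}(g)=g^\wedge$.
   Context: All topological spaces, fields and topological vector spaces are Hausdorff; topological fields are non-discrete. Differential calculus over a topological field $\mathbb{K}$: For a topological $\mathbb{K}$-vector space $E$ and $U\subseteq E$ open, put $U^{[0]}:=U$, $U^{[1]}:=\{(x,y,t)\in U\times E\times\mathbb{K}: x+ty\in U\}$ and $U^{[j+1]}:=(U^{[j]})^{[1]}$. A map $f\colon U\to F$ into a topological $\mathbb{K}$-vector space is $C^0_{\mathbb{K}}$ if it is continuous ($f^{[0]}:=f$); it is $C^1_{\mathbb{K}}$ if it is continuous and there is a (necessarily unique) continuous map $f^{[1]}\colon U^{[1]}\to F$ with $f^{[1]}(x,y,t)=\frac1t(f(x+ty)-f(x))$ for all $(x,y,t)\in U^{[1]}$ with $t\neq0$; for $k\ge2$ it is $C^k_{\mathbb{K}}$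 if it is $C^{k-1}_{\mathbb{K}}$ and $f^{[k-1]}$ is $C^1_{\mathbb{K}}$, and then $f^{[k]}:=(f^{[k-1]})^{[1]}$; it is $C^\infty_{\mathbb{K}}$ if it is $C^k_{\mathbb{K}}$ for all $k$. Manifolds modeled on topological vector spaces and smooth maps between them are defined as usual via charts. Function spaces: For $V$ open in a topological $\mathbb{K}$-vector space, $C^\infty(V,E)$ is the space of $C^\infty_{\mathbb{K}}$-maps $V\to E$ with the initial topology with respect to the maps $\gamma\mapsto\gamma^{[j]}\in C(V^{[j]},E)$ (compact-open topology), $j\in\mathbb{N}_0$. For a $C^\infty_{\mathbb{K}}$-manifold $N$, $C^\infty(N,E)$ is the space of $C^\infty_{\mathbb{K}}$-maps $N\to E$ with the initial topology with respect to the maps $\gamma\mapsto\gamma|_U\circ\kappa^{-1}\in C^\infty(V,E)$, for $\kappa\colon U\to V$ ranging through the charts of $N$. *)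

theory Defs
  imports "HOL-Analysis.Analysis" "HOL-Library.Function_Algebras"
begin

section \<open>Topological fields and topological vector spaces\<close>

class topological_field =
  field + t2_space + topological_ab_group_add + topological_semigroup_mult +
  assumes tendsto_inverse_nhds: "a \<noteq> 0 \<Longrightarrow> (inverse \<longlongrightarrow> inverse a) (nhds a)"
    and non_discrete: "\<exists>S. \<not> open S"

text \<open>
  A topological vector space over \<^typ>\<open>'k\<close> lives on a linear subspace of an ambient vector
  space \<^typ>\<open>'v\<close>, namely the \<^const>\<open>topspace\<close> of its topology.  The carrier need not be
  the whole type, because spaces of smooth maps have to be topological vector spaces as well.
\<close>

record ('k, 'v) tvs =
  scl :: "'k \<Rightarrow> 'v \<Rightarrow> 'v"
  topo :: "'v topology"

definition is_tvs :: "('k::topological_field, 'v::ab_group_add) tvs \<Rightarrow> bool" where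
  "is_tvs E \<longleftrightarrow>
     vector_space (scl E) \<and>
     module.subspace (scl E) (topspace (topo E)) \<and>
     Hausdorff_space (topo E) \<and>
     continuous_map (prod_topology (topo E) (topo E)) (topo E) (\<lambda>(x, y). x + y) \<and>
     continuous_map (prod_topology euclidean (topo E)) (topo E) (\<lambda>(c, x). scl E c x)"

definition finite_dimensional :: "('k::topological_field, 'v::ab_group_add) tvs \<Rightarrow> bool" where
  "finite_dimensional E \<longleftrightarrow> (\<exists>B. finite B \<and> module.span (scl E) B = topspace (topo E))"

definition prod_tvs ::
  "('k, 'v) tvs \<Rightarrow> ('k, 'w) tvs \<Rightarrow> ('k, 'v \<times> 'w) tvs" where
  "prod_tvs E F = \<lparr> scl = (\<lambda>c (x, y). (scl E c x, scl F c y)),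
                    topo = prod_topology (topo E) (topo F) \<rparr>"

text \<open>\<open>\<Phi>\<close> is an isomorphism of topological vector spaces with inverse \<open>\<Psi>\<close>.\<close>

definition tvs_iso ::
  "('k::topological_field, 'v::ab_group_add) tvs \<Rightarrow> ('k, 'w::ab_group_add) tvs
     \<Rightarrow> ('v \<Rightarrow> 'w) \<Rightarrow> ('w \<Rightarrow> 'v) \<Rightarrow> bool" where
  "tvs_iso E F \<Phi> \<Psi> \<longleftrightarrow>
     is_tvs E \<and> is_tvs F \<and>
     (\<forall>x \<in> topspace (topo E). \<forall>y \<in> topspace (topo E). \<Phi> (x + y) = \<Phi> x + \<Phi> y) \<and>
     (\<forall>c. \<forall>x \<in> topspace (topo E). \<Phi> (scl E c x) = scl F c (\<Phi> x)) \<and>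
     homeomorphic_maps (topo E) (topo F) \<Phi> \<Psi>"


section \<open>Differential calculus\<close>

text \<open>
  The sets \<open>U\<^sup>[\<^sup>j\<^sup>]\<close> lie in the iterated products \<open>E\<^sup>[\<^sup>0\<^sup>] = E\<close>, \<open>E\<^sup>[\<^sup>j\<^sup>+\<^sup>1\<^sup>] = E\<^sup>[\<^sup>j\<^sup>] \<times> E\<^sup>[\<^sup>j\<^sup>] \<times> K\<close>, whose
  types would depend on \<open>j\<close>.  The following datatype contains all of them: \<open>Base\<close> embeds \<open>E\<close>, and
  \<open>Step x y t\<close> is the triple \<open>(x, y, t)\<close>.
\<close>

datatype ('v, 'k) tower =
    Base (base_of: 'v)
  | Step (pt_of: "('v, 'k) tower") (dir_of: "('v, 'k) tower") (par_of: 'k)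

text \<open>\<open>line E x y t\<close> is \<open>x + t y\<close> in the vector space \<open>E\<^sup>[\<^sup>j\<^sup>]\<close>, for \<open>x\<close> and \<open>y\<close> of the same level \<open>j\<close>.\<close>

fun line :: "('k::topological_field, 'v::ab_group_add) tvs
    \<Rightarrow> ('v, 'k) tower \<Rightarrow> ('v, 'k) tower \<Rightarrow> 'k \<Rightarrow> ('v, 'k) tower" where
  "line E (Base x) (Base y) t = Base (x + scl E t y)"
| "line E (Step x y s) (Step x' y' s') t = Step (line E x x' t) (line E y y' t) (s + t * s')"

primrec tower_topology ::
  "('k::topological_field, 'v) tvs \<Rightarrow> nat \<Rightarrow> ('v, 'k) tower topology" where
  "tower_topology E 0 = pullback_topology (range Base) base_of (topo E)"
| "tower_topology E (Suc j) =
     pullback_topology {Step x y t | x y t. True} (\<lambda>w. (pt_of w, dir_of w, par_of w))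
       (prod_topology (tower_topology E j) (prod_topology (tower_topology E j) euclidean))"

primrec bracket_set :: "('k::topological_field, 'v::ab_group_add) tvs
    \<Rightarrow> 'v set \<Rightarrow> nat \<Rightarrow> ('v, 'k) tower set" where
  "bracket_set E U 0 = Base ` U"
| "bracket_set E U (Suc j) =
     {Step x y t | x y t. x \<in> bracket_set E U j \<and> y \<in> topspace (tower_topology E j) \<and>
                          line E x y t \<in> bracket_set E U j}"

definition bracket_topology :: "('k::topological_field, 'v::ab_group_add) tvs
    \<Rightarrow> 'v set \<Rightarrow> nat \<Rightarrow> ('v, 'k) tower topology" where
  "bracket_topology E U j = subtopology (tower_topology E j) (bracket_set E U j)"

text \<open>\<open>h\<close> is a continuous extension to \<open>(U\<^sup>[\<^sup>j\<^sup>])\<^sup>[\<^sup>1\<^sup>]\<close> of the difference quotients of \<open>g\<close> on \<open>U\<^sup>[\<^sup>j\<^sup>]\<close>.\<close>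

definition extends_diff_quot ::
  "('k::topological_field, 'v::ab_group_add) tvs \<Rightarrow> 'v set \<Rightarrow> ('k, 'w::ab_group_add) tvs \<Rightarrow> nat
     \<Rightarrow> (('v, 'k) tower \<Rightarrow> 'w) \<Rightarrow> (('v, 'k) tower \<Rightarrow> 'w) \<Rightarrow> bool" where
  "extends_diff_quot E U F j g h \<longleftrightarrow>
     continuous_map (bracket_topology E U (Suc j)) (topo F) h \<and>
     (\<forall>x y t. Step x y t \<in> bracket_set E U (Suc j) \<and> t \<noteq> 0 \<longrightarrow>
        h (Step x y t) = scl F (inverse t) (g (line E x y t) - g x))"

text \<open>
  \<open>bracket_map E U F f j\<close> is \<open>f\<^sup>[\<^sup>j\<^sup>]\<close>.  It is meaningful only on \<open>U\<^sup>[\<^sup>j\<^sup>]\<close> and only if \<open>f\<close> is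
  \<open>C\<^sup>j\<close>; the choice is then unique on \<open>U\<^sup>[\<^sup>j\<^sup>]\<close>.
\<close>

primrec bracket_map ::
  "('k::topological_field, 'v::ab_group_add) tvs \<Rightarrow> 'v set \<Rightarrow> ('k, 'w::ab_group_add) tvs
     \<Rightarrow> ('v \<Rightarrow> 'w) \<Rightarrow> nat \<Rightarrow> (('v, 'k) tower \<Rightarrow> 'w)" where
  "bracket_map E U F f 0 = f \<circ> base_of"
| "bracket_map E U F f (Suc j) =
     (SOME h. extends_diff_quot E U F j (bracket_map E U F f j) h)"

primrec Ck_on ::
  "nat \<Rightarrow> ('k::topological_field, 'v::ab_group_add) tvs \<Rightarrow> 'v set \<Rightarrow> ('k, 'w::ab_group_add) tvs
     \<Rightarrow> ('v \<Rightarrow> 'w) \<Rightarrow> bool" where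
  "Ck_on 0 E U F f \<longleftrightarrow> continuous_map (subtopology (topo E) U) (topo F) f"
| "Ck_on (Suc k) E U F f \<longleftrightarrow>
     Ck_on k E U F f \<and>
     continuous_map (bracket_topology E U k) (topo F) (bracket_map E U F f k) \<and>
     (\<exists>h. extends_diff_quot E U F k (bracket_map E U F f k) h)"

definition smooth_on ::
  "('k::topological_field, 'v::ab_group_add) tvs \<Rightarrow> 'v set \<Rightarrow> ('k, 'w::ab_group_add) tvs
     \<Rightarrow> ('v \<Rightarrow> 'w) \<Rightarrow> bool" where
  "smooth_on E U F f \<longleftrightarrow> (\<forall>k. Ck_on k E U F f)"


section \<open>Manifolds\<close>

text \<open>
  A manifold is given by its modelling space, its underlying space and an atlas (not necessarily
  maximal).  A chart is a pair \<open>(U, \<kappa>)\<close>; the values of \<open>\<kappa>\<close> outside \<open>U\<close> are irrelevant.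
\<close>

type_synonym ('m, 'v) chart = "'m set \<times> ('m \<Rightarrow> 'v)"

record ('k, 'v, 'm) mfd =
  model :: "('k, 'v) tvs"
  space_of :: "'m topology"
  atlas :: "('m, 'v) chart set"

definition is_chart :: "('k, 'v, 'm) mfd \<Rightarrow> ('m, 'v) chart \<Rightarrow> bool" where
  "is_chart M = (\<lambda>(U, \<kappa>).
     openin (space_of M) U \<and> openin (topo (model M)) (\<kappa> ` U) \<and>
     homeomorphic_map (subtopology (space_of M) U) (subtopology (topo (model M)) (\<kappa> ` U)) \<kappa>)"

definition smooth_transition ::
  "('k::topological_field, 'v::ab_group_add, 'm) mfd \<Rightarrow> ('m, 'v) chart \<Rightarrow> ('m, 'v) chart \<Rightarrow> bool" where
  "smooth_transition M = (\<lambda>(U, \<kappa>) (V, \<mu>).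
     smooth_on (model M) (\<kappa> ` (U \<inter> V)) (model M) (\<mu> \<circ> inv_into U \<kappa>))"

definition is_mfd :: "('k::topological_field, 'v::ab_group_add, 'm) mfd \<Rightarrow> bool" where
  "is_mfd M \<longleftrightarrow>
     is_tvs (model M) \<and>
     Hausdorff_space (space_of M) \<and>
     (\<forall>c \<in> atlas M. is_chart M c) \<and>
     (\<Union>c \<in> atlas M. fst c) = topspace (space_of M) \<and>
     (\<forall>c \<in> atlas M. \<forall>d \<in> atlas M. smooth_transition M c d)"

text \<open>The charts of a manifold are the members of the maximal atlas containing the given one.\<close>

definition charts :: "('k::topological_field, 'v::ab_group_add, 'm) mfd \<Rightarrow> ('m, 'v) chart set" where
  "charts M = {c. is_chart M c \<and>
     (\<forall>d \<in> atlas M. smooth_transition M c d \<and> smooth_transition M d c)}"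

definition prod_mfd ::
  "('k, 'v, 'm) mfd \<Rightarrow> ('k, 'w, 'n) mfd \<Rightarrow> ('k, 'v \<times> 'w, 'm \<times> 'n) mfd" where
  "prod_mfd M N =
     \<lparr> model = prod_tvs (model M) (model N),
       space_of = prod_topology (space_of M) (space_of N),
       atlas = {(U \<times> V, map_prod \<kappa> \<mu>) | U \<kappa> V \<mu>. (U, \<kappa>) \<in> atlas M \<and> (V, \<mu>) \<in> atlas N} \<rparr>"

definition smooth_map ::
  "('k::topological_field, 'v::ab_group_add, 'm) mfd \<Rightarrow> ('k, 'e::ab_group_add) tvs
     \<Rightarrow> ('m \<Rightarrow> 'e) \<Rightarrow> bool" where
  "smooth_map M E f \<longleftrightarrow>
     (\<forall>(U, \<kappa>) \<in> charts M. smooth_on (model M) (\<kappa> ` U) E (f \<circ> inv_into U \<kappa>))"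


section \<open>Function spaces\<close>

text \<open>
  A map defined on a proper subset of a type is represented by its extension by \<open>0\<close>, so that
  the maps on a fixed domain form a linear subspace of the full function space.
\<close>

definition zero_outside :: "'a set \<Rightarrow> ('a \<Rightarrow> 'b::zero) \<Rightarrow> 'a \<Rightarrow> 'b" where
  "zero_outside S f = (\<lambda>x. if x \<in> S then f x else 0)"

text \<open>
  Here continuous maps \<open>X \<rightarrow> Y\<close> are not normalized outside \<open>topspace X\<close>; this does not affect
  the initial topologies formed below.
\<close>

definition compact_open_topology :: "'a topology \<Rightarrow> 'b topology \<Rightarrow> ('a \<Rightarrow> 'b) topology" where
  "compact_open_topology X Y = topology_generated_by
     {{f. continuous_map X Y f \<and> f ` C \<subseteq> W} | C W. compactin X C \<and> openin Y W}"

text \<open>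
  The initial topology on \<open>S\<close> with respect to the maps \<open>\<phi> i : S \<rightarrow> T i\<close>, \<open>i \<in> I\<close>; the set \<open>S\<close> is
  added to the subbasis to cover the case of empty \<open>I\<close>.
\<close>

definition initial_topology ::
  "'a set \<Rightarrow> 'i set \<Rightarrow> ('i \<Rightarrow> 'a \<Rightarrow> 'b) \<Rightarrow> ('i \<Rightarrow> 'b topology) \<Rightarrow> 'a topology" where
  "initial_topology S I \<phi> T = topology_generated_by
     (insert S {S \<inter> \<phi> i -` W | i W. i \<in> I \<and> openin (T i) W})"

definition smooth_topology_on ::
  "('k::topological_field, 'v::ab_group_add) tvs \<Rightarrow> 'v set \<Rightarrow> ('k, 'e::ab_group_add) tvs
     \<Rightarrow> ('v \<Rightarrow> 'e) topology" where
  "smooth_topology_on Z V E = initial_topology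
     {f. smooth_on Z V E f \<and> zero_outside V f = f}
     UNIV
     (\<lambda>j f. bracket_map Z V E f j)
     (\<lambda>j. compact_open_topology (bracket_topology Z V j) (topo E))"

definition smooth_space ::
  "('k::topological_field, 'v::ab_group_add, 'm) mfd \<Rightarrow> ('k, 'e::ab_group_add) tvs
     \<Rightarrow> ('k, 'm \<Rightarrow> 'e) tvs" where
  "smooth_space N E =
     \<lparr> scl = (\<lambda>c f x. scl E c (f x)),
       topo = initial_topology
         {f. smooth_map N E f \<and> zero_outside (topspace (space_of N)) f = f}
         (charts N)
         (\<lambda>(U, \<kappa>) f. zero_outside (\<kappa> ` U) (f \<circ> inv_into U \<kappa>))
         (\<lambda>(U, \<kappa>). smooth_topology_on (model N) (\<kappa> ` U) E) \<rparr>"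

end

theory Submission
  imports Defs
begin

text \<open>
  Smoothness is studied for maps that depend on a parameter \<open>p\<close> in a topological space \<open>P\<close>: every
  difference quotient has to be continuous in \<open>x\<close> for fixed \<open>p\<close>, and jointly continuous in \<open>(p, x)\<close> as long
  as \<open>x\<close> stays in a compact set.  For a one-point \<open>P\<close> this is smoothness; in general it says that
  \<open>p \<mapsto> f p\<close> is a continuous map into the space of smooth maps, because a map into a compact-open topology
  is continuous if and only if it is jointly continuous on compact Hausdorff sets.  A single statement with
  parameters therefore yields both the equivalence (a), for a one-point \<open>P\<close>, and the continuity of \<open>\<Phi>\<close> and its
  inverse, where \<open>P\<close> is one of the two function spaces.

  If \<open>f\<close> is smooth on \<open>U \<times> V\<close>, so are its partial difference quotients \<open>f\<^sup>[\<^sup>j\<^sup>,\<^sup>l\<^sup>]\<close> on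
  \<open>U\<^sup>[\<^sup>j\<^sup>] \<times> V\<^sup>[\<^sup>l\<^sup>]\<close>.  Conversely, if all of these exist and are continuous, then \<open>f\<close> is smooth, since
  \<open>f\<^sup>[\<^sup>1\<^sup>]((x, y), (x', y'), t) = f\<^sup>[\<^sup>1\<^sup>,\<^sup>0\<^sup>]((x, x', t), y + t y') + f\<^sup>[\<^sup>0\<^sup>,\<^sup>1\<^sup>](x, (y, y', t))\<close>
  is built from maps of the same kind.  The maps \<open>f\<^sup>[\<^sup>j\<^sup>,\<^sup>l\<^sup>]\<close> are exactly what describes smoothness of
  \<open>U \<rightarrow> C\<^sup>\<infinity>(V, E)\<close>: passing from them to the function space is always possible, and the way back uses that
  evaluation is continuous on the locally compact spaces \<open>V\<^sup>[\<^sup>l\<^sup>]\<close>.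
\<close>

section \<open>Continuity on compact sets with parameters\<close>

text \<open>Two obstacles shape the development. The spaces on which
  \<open>f\<^sup>[\<^sup>j\<^sup>]\<close> lives change with \<open>j\<close>, and the difference
  quotient of a composite or a product again contains composites and products, on new domains; an
  induction on \<open>k\<close> over fixed domains does not close. Hence one class
  \<open>Usm\<close> of maps between all these spaces, in which it suffices to find a single
  difference quotient for every member. The second obstacle is that \<open>M\<close> carries no
  local compactness, so continuity into a compact-open topology gives joint continuity only over
  compact sets of points, and the class has to live with this weaker notion. Gluing dictates two of
  the rules. If \<open>f\<close> is smooth on every member of a cover, \<open>x\<close> and
  \<open>x + t y\<close> may lie in different members; there \<open>t\<close> is nonzero and the
  quotient is written with \<open>1/t\<close>, which calls for products with scalars and for
  inversion. In finite dimension, a nonzero scalar whose powers tend to zero takes the place of an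
  absolute value.\<close>

text \<open>The singletons \<open>Q\<close> give continuity for a fixed parameter on all of \<open>S\<close>, which is stronger than
  continuity on compact sets when \<open>S\<close> is not compactly generated.\<close>

definition kcont ::
  "'p topology \<Rightarrow> 'a topology \<Rightarrow> 'b topology \<Rightarrow> ('p \<Rightarrow> 'a \<Rightarrow> 'b) \<Rightarrow> bool" where
  "kcont P S T f \<longleftrightarrow>
     (\<forall>Q C. Q \<subseteq> topspace P \<longrightarrow> C \<subseteq> topspace S \<longrightarrow> (\<exists>p. Q = {p}) \<or> compactin S C \<longrightarrow>
        continuous_map (prod_topology (subtopology P Q) (subtopology S C)) T (\<lambda>(p, x). f p x))"

lemma kcontI:
  assumes "\<And>Q C. \<lbrakk>Q \<subseteq> topspace P; C \<subseteq> topspace S; (\<exists>p. Q = {p}) \<or> compactin S C\<rbrakk> \<Longrightarrow>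
     continuous_map (prod_topology (subtopology P Q) (subtopology S C)) T (\<lambda>(p, x). f p x)"
  shows "kcont P S T f"
  using assms unfolding kcont_def by blast

lemma kcontD:
  assumes "kcont P S T f" "Q \<subseteq> topspace P" "C \<subseteq> topspace S" "(\<exists>p. Q = {p}) \<or> compactin S C"
  shows "continuous_map (prod_topology (subtopology P Q) (subtopology S C)) T (\<lambda>(p, x). f p x)"
  using assms unfolding kcont_def by blast

lemma kcont_slice:
  assumes "kcont P S T f" "p \<in> topspace P"
  shows "continuous_map S T (f p)"
proof -
  have "continuous_map (prod_topology (subtopology P {p}) (subtopology S (topspace S))) T (\<lambda>(p, x). f p x)"
    using assms by (intro kcontD) auto
  moreover have "continuous_map S (prod_topology (subtopology P {p}) S) (\<lambda>x. (p, x))"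
    using assms by (auto simp: continuous_map_pairwise o_def continuous_map_in_subtopology)
  ultimately have "continuous_map S T ((\<lambda>(p, x). f p x) \<circ> (\<lambda>x. (p, x)))"
    using continuous_map_compose by (metis subtopology_topspace)
  then show ?thesis by (simp add: o_def)
qed

lemma kcont_compact:
  assumes "kcont P S T f" "compactin S C"
  shows "continuous_map (prod_topology P (subtopology S C)) T (\<lambda>(p, x). f p x)"
  using kcontD[OF assms(1), of "topspace P" C] assms(2) by (simp add: compactin_subset_topspace)

lemma kcont_maps:
  assumes "kcont P S T f" "p \<in> topspace P" "x \<in> topspace S"
  shows "f p x \<in> topspace T"
  using kcont_slice[OF assms(1,2)] assms(3) by (auto simp: continuous_map_def)

lemma continuous_map_kcont:
  assumes "continuous_map (prod_topology P S) T (\<lambda>(p, x). f p x)"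
  shows "kcont P S T f"
  using assms by (auto intro!: kcontI continuous_map_from_subtopology simp flip: subtopology_Times)

lemma kcont_cong:
  assumes "kcont P S T f" "\<And>p x. p \<in> topspace P \<Longrightarrow> x \<in> topspace S \<Longrightarrow> f p x = g p x"
  shows "kcont P S T g"
proof (rule kcontI)
  fix Q C assume QC: "Q \<subseteq> topspace P" "C \<subseteq> topspace S" "(\<exists>p. Q = {p}) \<or> compactin S C"
  show "continuous_map (prod_topology (subtopology P Q) (subtopology S C)) T (\<lambda>(p, x). g p x)"
    by (rule continuous_map_eq[OF kcontD[OF assms(1) QC]]) (auto simp: assms(2))
qed

lemma kcont_precompose:
  assumes f: "kcont P S T f" and \<phi>: "continuous_map S' S \<phi>"
  shows "kcont P S' T (\<lambda>p x. f p (\<phi> x))"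
proof (rule kcontI)
  fix Q C assume QC: "Q \<subseteq> topspace P" "C \<subseteq> topspace S'" "(\<exists>p. Q = {p}) \<or> compactin S' C"
  have im: "\<phi> ` C \<subseteq> topspace S" using \<phi> QC(2) by (auto simp: continuous_map_def)
  have 1: "continuous_map (prod_topology (subtopology P Q) (subtopology S (\<phi> ` C))) T (\<lambda>(p, x). f p x)"
    using QC im image_compactin[OF _ \<phi>] by (intro kcontD[OF f]) auto
  have "continuous_map (subtopology S' C) (subtopology S (\<phi> ` C)) \<phi>"
    using \<phi> by (auto simp: continuous_map_in_subtopology continuous_map_from_subtopology)
  then have "continuous_map (prod_topology (subtopology P Q) (subtopology S' C))
      (prod_topology (subtopology P Q) (subtopology S (\<phi> ` C))) (\<lambda>(p, x). (p, \<phi> x))"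
    by (auto simp: continuous_map_prod_top)
  from continuous_map_compose[OF this 1]
  show "continuous_map (prod_topology (subtopology P Q) (subtopology S' C)) T (\<lambda>(p, x). f p (\<phi> x))"
    by (simp add: o_def case_prod_unfold)
qed

lemma kcont_postcompose:
  assumes f: "kcont P S T f" and L: "continuous_map T T' L"
  shows "kcont P S T' (\<lambda>p x. L (f p x))"
proof (rule kcontI)
  fix Q C assume QC: "Q \<subseteq> topspace P" "C \<subseteq> topspace S" "(\<exists>p. Q = {p}) \<or> compactin S C"
  show "continuous_map (prod_topology (subtopology P Q) (subtopology S C)) T' (\<lambda>(p, x). L (f p x))"
    using continuous_map_compose[OF kcontD[OF f QC] L] by (simp add: o_def case_prod_unfold)
qed

lemma kcont_Pair:
  assumes f: "kcont P S T f" and g: "kcont P S T' g"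
  shows "kcont P S (prod_topology T T') (\<lambda>p x. (f p x, g p x))"
proof (rule kcontI)
  fix Q C assume QC: "Q \<subseteq> topspace P" "C \<subseteq> topspace S" "(\<exists>p. Q = {p}) \<or> compactin S C"
  show "continuous_map (prod_topology (subtopology P Q) (subtopology S C)) (prod_topology T T')
      (\<lambda>(p, x). (f p x, g p x))"
    using kcontD[OF f QC] kcontD[OF g QC]
    by (simp add: continuous_map_pairwise o_def case_prod_unfold)
qed

lemma kcont_binop:
  assumes "kcont P S T f" "kcont P S T' g" "continuous_map (prod_topology T T') T'' (\<lambda>(x, y). m x y)"
  shows "kcont P S T'' (\<lambda>p x. m (f p x) (g p x))"
  using kcont_postcompose[OF kcont_Pair[OF assms(1,2)] assms(3)] by (simp only: prod.case)

lemma kcont_param: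
  assumes "continuous_map P T c"
  shows "kcont P S T (\<lambda>p x. c p)"
  using continuous_map_compose[OF continuous_map_fst assms, of S]
  by (intro continuous_map_kcont) (simp add: o_def case_prod_unfold)

lemma kcont_point:
  assumes "continuous_map S T \<phi>"
  shows "kcont P S T (\<lambda>p. \<phi>)"
  using continuous_map_compose[OF continuous_map_snd assms, of P]
  by (intro continuous_map_kcont) (simp add: o_def case_prod_unfold)

lemma kcont_freeze:
  assumes "kcont P S T f" "p \<in> topspace P"
  shows "kcont P' S T (\<lambda>_. f p)"
  by (intro kcont_point kcont_slice[OF assms])

text \<open>On a test set the continuity can be checked locally, because compact Hausdorff spaces have
  neighbourhood bases of compact sets.\<close>

lemma kcont_local:
  assumes H: "Hausdorff_space S" and cov: "topspace S \<subseteq> \<Union>\<B>" and op: "\<And>B. B \<in> \<B> \<Longrightarrow> openin S B"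
    and f: "\<And>B. B \<in> \<B> \<Longrightarrow> kcont P (subtopology S B) T f"
  shows "kcont P S T f"
proof (rule kcontI)
  fix Q C assume QC: "Q \<subseteq> topspace P" "C \<subseteq> topspace S" "(\<exists>p. Q = {p}) \<or> compactin S C"
  let ?X = "subtopology S C"
  have ex: "\<exists>V. openin ?X V \<and> x \<in> V \<and>
      continuous_map (prod_topology (subtopology P Q) (subtopology ?X V)) T (\<lambda>(p, x). f p x)"
    if x: "x \<in> C" for x
  proof -
    obtain B where B: "B \<in> \<B>" "x \<in> B" using cov QC(2) x by blast
    have BS: "B \<subseteq> topspace S" using op[OF B(1)] openin_subset by blast
    \<comment> \<open>\<open>D\<close> has to be a legitimate test set: for a single parameter any
      subset of \<open>C\<close> will do; otherwise \<open>D\<close> is closed in the compact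
      \<open>C\<close>, hence compact.\<close>
    obtain V D where VD: "openin ?X V" "x \<in> V" "V \<subseteq> D" "D \<subseteq> B" "D \<subseteq> C"
      "(\<exists>p. Q = {p}) \<or> compactin S D"
    proof (cases "\<exists>p. Q = {p}")
      case True
      then show ?thesis using that[of "C \<inter> B" "C \<inter> B"] op[OF B(1)] x B
        by (auto simp: openin_subtopology_Int2)
    next
      case False
      then have C: "compactin S C" using QC(3) by simp
      then have "compact_space ?X" by (simp add: compact_space_subtopology)
      moreover have "Hausdorff_space ?X" using H by (rule Hausdorff_space_subtopology)
      ultimately have "neighbourhood_base_of (closedin ?X) ?X"
        using compact_Hausdorff_imp_regular_space neighbourhood_base_of_closedin by blast
      moreover have "openin ?X (C \<inter> B)" using op[OF B(1)] by (simp add: openin_subtopology_Int2)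
      ultimately obtain V D where "openin ?X V" "closedin ?X D" "x \<in> V" "V \<subseteq> D" "D \<subseteq> C \<inter> B"
        using x B(2) by (force simp: neighbourhood_base_of)
      moreover have "compactin S D"
        using closedin_compact_space[OF \<open>compact_space ?X\<close> \<open>closedin ?X D\<close>]
        by (simp add: compactin_subtopology)
      ultimately show ?thesis using that by auto
    qed
    have "continuous_map (prod_topology (subtopology P Q) (subtopology (subtopology S B) D)) T (\<lambda>(p, x). f p x)"
      using VD BS QC(1) by (intro kcontD[OF f[OF B(1)]]) (auto simp: compactin_subtopology)
    moreover have "subtopology (subtopology S B) D = subtopology S D"
      using VD by (simp add: subtopology_subtopology Int_absorb1)
    ultimately have "continuous_map (prod_topology (subtopology P Q) (subtopology S D)) T (\<lambda>(p, x). f p x)"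
      by simp
    then have "continuous_map (subtopology (prod_topology (subtopology P Q) (subtopology S D)) (UNIV \<times> V)) T (\<lambda>(p, x). f p x)"
      by (rule continuous_map_from_subtopology)
    moreover have "subtopology (subtopology S D) V = subtopology ?X V"
      using VD by (simp add: subtopology_subtopology Int_absorb1 Int_absorb2 subset_trans)
    ultimately show ?thesis using VD by (auto simp: subtopology_Times)
  qed
  then obtain V where V: "\<And>x. x \<in> C \<Longrightarrow> openin ?X (V x) \<and> x \<in> V x \<and>
      continuous_map (prod_topology (subtopology P Q) (subtopology ?X (V x))) T (\<lambda>(p, x). f p x)"
    by metis
  show "continuous_map (prod_topology (subtopology P Q) ?X) T (\<lambda>(p, x). f p x)"
  proof (rule pasting_lemma[where I = C and T = "\<lambda>x. Q \<times> V x" and f = "\<lambda>_. \<lambda>(p, x). f p x"])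
    fix x assume x: "x \<in> C"
    show "openin (prod_topology (subtopology P Q) ?X) (Q \<times> V x)"
      using V[OF x] QC(1) by (auto simp: openin_prod_Times_iff openin_subtopology_self openin_subtopology_Int2 topspace_subtopology)
         (metis Int_absorb2 openin_topspace topspace_subtopology inf_commute)
    show "continuous_map (subtopology (prod_topology (subtopology P Q) ?X) (Q \<times> V x)) T (\<lambda>(p, x). f p x)"
      using V[OF x] by (simp add: subtopology_Times subtopology_subtopology)
  qed (use V in auto)
qed

text \<open>Open sets contained in compact ones cover \<open>S\<close>, joint continuity is known on
  each of them, and the pieces are glued. Local compactness of the field and of the model space of
  \<open>N\<close> enters the exponential law only through this lemma.\<close>

lemma kcont_locally_compact:
  assumes f: "kcont P S T f" and lc: "locally_compact_space S"
  shows "continuous_map (prod_topology P S) T (\<lambda>(p, x). f p x)"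
proof -
  obtain V K where VK: "\<And>x. x \<in> topspace S \<Longrightarrow> openin S (V x) \<and> compactin S (K x) \<and> x \<in> V x \<and> V x \<subseteq> K x"
    using lc unfolding locally_compact_space_def by metis
  show ?thesis
  proof (rule pasting_lemma[where I = "topspace S" and T = "\<lambda>x. topspace P \<times> V x" and f = "\<lambda>_. \<lambda>(p, x). f p x"])
    fix x assume x: "x \<in> topspace S"
    show "openin (prod_topology P S) (topspace P \<times> V x)"
      using VK[OF x] by (simp add: openin_prod_Times_iff)
    have "continuous_map (subtopology (prod_topology P (subtopology S (K x))) (topspace P \<times> V x)) T (\<lambda>(p, x). f p x)"
      using kcont_compact[OF f, of "K x"] VK[OF x] continuous_map_from_subtopology by blast
    then show "continuous_map (subtopology (prod_topology P S) (topspace P \<times> V x)) T (\<lambda>(p, x). f p x)"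
      using VK[OF x] by (simp add: subtopology_Times subtopology_subtopology Int_absorb1)
  qed (use VK in auto)
qed

lemma kcont_reparam:
  assumes f: "kcont P S T f" and c: "continuous_map P' P c"
  shows "kcont P' S T (\<lambda>p. f (c p))"
proof (rule kcontI)
  fix Q C assume QC: "Q \<subseteq> topspace P'" "C \<subseteq> topspace S" "(\<exists>p. Q = {p}) \<or> compactin S C"
  have 1: "continuous_map (prod_topology (subtopology P (c ` Q)) (subtopology S C)) T (\<lambda>(p, x). f p x)"
    using QC c by (intro kcontD[OF f]) (auto simp: continuous_map_def)
  have "continuous_map (subtopology P' Q) (subtopology P (c ` Q)) c"
    using c by (auto simp: continuous_map_in_subtopology continuous_map_from_subtopology)
  then have "continuous_map (prod_topology (subtopology P' Q) (subtopology S C))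
      (prod_topology (subtopology P (c ` Q)) (subtopology S C)) (\<lambda>(p, x). (c p, x))"
    by (auto simp: continuous_map_prod_top)
  from continuous_map_compose[OF this 1]
  show "continuous_map (prod_topology (subtopology P' Q) (subtopology S C)) T (\<lambda>(p, x). f (c p) x)"
    by (simp add: o_def case_prod_unfold)
qed

section \<open>Compact-open and initial topologies\<close>

lemma openin_forall_compact:
  assumes K: "compactin S C" and f: "continuous_map (prod_topology P (subtopology S C)) T (\<lambda>(p, x). f p x)"
    and W: "openin T W"
  shows "openin P {p \<in> topspace P. f p ` C \<subseteq> W}"
proof (subst openin_subopen, intro ballI)
  fix p assume p: "p \<in> {p \<in> topspace P. f p ` C \<subseteq> W}"
  let ?O = "{z \<in> topspace (prod_topology P (subtopology S C)). (\<lambda>(p, x). f p x) z \<in> W}"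
  have CS: "C \<subseteq> topspace S" using K by (simp add: compactin_subset_topspace)
  have 1: "openin (prod_topology P (subtopology S C)) ?O"
    by (rule openin_continuous_map_preimage[OF f W])
  have 2: "compactin P {p}" using p by simp
  have 3: "compactin (subtopology S C) C" using K by (simp add: compactin_subtopology)
  have 4: "{p} \<times> C \<subseteq> ?O" using p CS by auto
  \<comment> \<open>Tube lemma: the open preimage of \<open>W\<close> contains the product of
    \<open>{p}\<close> with the compact set \<open>C\<close>, hence a box around it.\<close>
  obtain U V where "openin P U" "openin (subtopology S C) V" "{p} \<subseteq> U" "C \<subseteq> V" "U \<times> V \<subseteq> ?O"
    by (rule Wallace_theorem_prod_topology[OF 2 3 1 4])
  then show "\<exists>U. openin P U \<and> p \<in> U \<and> U \<subseteq> {p \<in> topspace P. f p ` C \<subseteq> W}"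
    using openin_subset by (intro exI[of _ U]) fastforce
qed

lemma topspace_compact_open_topology [simp]:
  "topspace (compact_open_topology S T) = {f. continuous_map S T f}"
proof -
  have "f \<in> \<Union>{{f. continuous_map S T f \<and> f ` C \<subseteq> W} |C W. compactin S C \<and> openin T W}"
    if "continuous_map S T f" for f
  proof
    \<comment> \<open>For the empty compact set the subbasic set consists of all continuous
      maps.\<close>
    show "f \<in> {f. continuous_map S T f \<and> f ` {} \<subseteq> topspace T}" using that by simp
    show "{f. continuous_map S T f \<and> f ` {} \<subseteq> topspace T} \<in>
        {{f. continuous_map S T f \<and> f ` C \<subseteq> W} |C W. compactin S C \<and> openin T W}"
      using openin_topspace compactin_empty by blast
  qed
  then show ?thesis unfolding compact_open_topology_def topology_generated_by_topspace by blast
qed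

lemma topspace_initial_topology [simp]: "topspace (initial_topology S I \<phi> T) = S"
  unfolding initial_topology_def by auto

text \<open>Evaluation is continuous over a compact Hausdorff set: if \<open>f p x\<close> is in
  \<open>W\<close>, continuity of \<open>f p\<close> gives a compact neighbourhood \<open>D\<close>
  of \<open>x\<close> in \<open>C\<close> that \<open>f p\<close> maps into \<open>W\<close>, and
  the parameters \<open>q\<close> for which \<open>f q\<close> maps \<open>D\<close> into
  \<open>W\<close> form an open set.\<close>

lemma kcont_compact_open:
  assumes H: "Hausdorff_space S" and f: "continuous_map P (compact_open_topology S T) f"
  shows "kcont P S T f"
proof (rule kcontI)
  have top: "topspace (compact_open_topology S T) = {f. continuous_map S T f}"
    by (rule topspace_compact_open_topology)
  have sub: "openin (compact_open_topology S T) {f. continuous_map S T f \<and> f ` C \<subseteq> W}"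
    if "compactin S C" "openin T W" for C W
    unfolding compact_open_topology_def using that by (intro topology_generated_by_Basis) blast
  have cf: "continuous_map S T (f p)" if "p \<in> topspace P" for p
    using f that top by (auto simp: continuous_map_def)
  fix Q C assume QC: "Q \<subseteq> topspace P" "C \<subseteq> topspace S" "(\<exists>p. Q = {p}) \<or> compactin S C"
  let ?X = "subtopology S C"
  show "continuous_map (prod_topology (subtopology P Q) ?X) T (\<lambda>(p, x). f p x)"
  proof (cases "\<exists>p. Q = {p}")
    case True
    then obtain p where p: "Q = {p}" by blast
    have "continuous_map (prod_topology (subtopology P Q) ?X) T (f p \<circ> snd)"
      using cf[of p] p QC(1) by (intro continuous_map_compose[OF continuous_map_snd] continuous_map_from_subtopology) auto
    then show ?thesis by (rule continuous_map_eq) (auto simp: p)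
  next
    case False
    then have C: "compactin S C" using QC(3) by simp
    then have cX: "compact_space ?X" by (simp add: compact_space_subtopology)
    moreover have "Hausdorff_space ?X" using H by (rule Hausdorff_space_subtopology)
    ultimately have nb: "neighbourhood_base_of (closedin ?X) ?X"
      using compact_Hausdorff_imp_regular_space neighbourhood_base_of_closedin by blast
    have "continuous_map (prod_topology P ?X) T (\<lambda>(p, x). f p x)"
      unfolding continuous_map_def
    proof (intro conjI allI impI)
      show "(\<lambda>(p, x). f p x) \<in> topspace (prod_topology P ?X) \<rightarrow> topspace T"
        using cf by (auto simp: continuous_map_def Pi_iff)
      fix W assume W: "openin T W"
      show "openin (prod_topology P ?X) {z \<in> topspace (prod_topology P ?X). (\<lambda>(p, x). f p x) z \<in> W}"
      proof (subst openin_subopen, intro ballI)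
        fix z assume z: "z \<in> {z \<in> topspace (prod_topology P ?X). (\<lambda>(p, x). f p x) z \<in> W}"
        obtain p x where zp: "z = (p, x)" "p \<in> topspace P" "x \<in> C" "x \<in> topspace S" "f p x \<in> W"
          using z by (cases z) auto
        have "openin ?X {y \<in> topspace ?X. f p y \<in> W}"
          using cf[OF zp(2)] W by (intro openin_continuous_map_preimage continuous_map_from_subtopology)
        then obtain V D where VD: "openin ?X V" "closedin ?X D" "x \<in> V" "V \<subseteq> D" "D \<subseteq> {y \<in> topspace ?X. f p y \<in> W}"
          using nb zp by (force simp: neighbourhood_base_of)
        have D: "compactin S D"
          using closedin_compact_space[OF cX VD(2)] by (simp add: compactin_subtopology)
        let ?U = "{q \<in> topspace P. f q \<in> {f. continuous_map S T f \<and> f ` D \<subseteq> W}}"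
        have "openin P ?U" using sub[OF D W] f by (rule openin_continuous_map_preimage[rotated])
        then have "openin (prod_topology P ?X) (?U \<times> V)" using VD(1) by (simp add: openin_prod_Times_iff)
        moreover have "z \<in> ?U \<times> V" using zp VD cf[OF zp(2)] by auto
        moreover have "?U \<times> V \<subseteq> {z \<in> topspace (prod_topology P ?X). (\<lambda>(p, x). f p x) z \<in> W}"
          using VD by auto
        ultimately show "\<exists>O'. openin (prod_topology P ?X) O' \<and> z \<in> O' \<and>
            O' \<subseteq> {z \<in> topspace (prod_topology P ?X). (\<lambda>(p, x). f p x) z \<in> W}" by blast
      qed
    qed
    then show ?thesis
      by (metis continuous_map_from_subtopology prod_topology_subtopology(1))
  qed
qed

text \<open>Converse of \<open>kcont_compact_open\<close>: the preimage of the subbasic set given by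
  \<open>C\<close> and \<open>W\<close> consists of the \<open>p\<close> for which
  \<open>f p\<close> maps \<open>C\<close> into \<open>W\<close>, and is open by the tube
  lemma.\<close>

lemma continuous_map_compact_open:
  assumes "kcont P S T f"
  shows "continuous_map P (compact_open_topology S T) f"
  unfolding compact_open_topology_def
proof (rule continuous_on_generated_topo)
  fix U assume "U \<in> {{f. continuous_map S T f \<and> f ` C \<subseteq> W} |C W. compactin S C \<and> openin T W}"
  then obtain C W where U: "U = {f. continuous_map S T f \<and> f ` C \<subseteq> W}" "compactin S C" "openin T W" by blast
  have "f -` U \<inter> topspace P = {p \<in> topspace P. f p ` C \<subseteq> W}"
    using kcont_slice[OF assms] by (auto simp: U(1))
  then show "openin P (f -` U \<inter> topspace P)"
    using openin_forall_compact[OF U(2) kcont_compact[OF assms U(2)] U(3)] by simp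
next
  show "f ` topspace P \<subseteq> \<Union>{{f. continuous_map S T f \<and> f ` C \<subseteq> W} |C W. compactin S C \<and> openin T W}"
    using topspace_compact_open_topology[of S T] kcont_slice[OF assms]
    unfolding compact_open_topology_def topology_generated_by_topspace by blast
qed

text \<open>Phrased with preimages instead of continuity of \<open>\<phi> i \<circ> f\<close>:
  nothing here says that \<open>\<phi> i\<close> maps \<open>S\<close> into
  \<open>topspace (T i)\<close>, which \<open>continuous_map\<close> would demand.\<close>

lemma continuous_map_initial_topology:
  "continuous_map P (initial_topology S I \<phi> T) f \<longleftrightarrow>
     f \<in> topspace P \<rightarrow> S \<and> (\<forall>i\<in>I. \<forall>W. openin (T i) W \<longrightarrow> openin P {p \<in> topspace P. \<phi> i (f p) \<in> W})"
  (is "?L \<longleftrightarrow> ?R")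
proof
  assume L: ?L
  have fS: "f \<in> topspace P \<rightarrow> S" using L by (auto simp: continuous_map_def)
  have "openin P {p \<in> topspace P. \<phi> i (f p) \<in> W}" if i: "i \<in> I" "openin (T i) W" for i W
  proof -
    have "openin (initial_topology S I \<phi> T) (S \<inter> \<phi> i -` W)"
      unfolding initial_topology_def using i by (intro topology_generated_by_Basis) blast
    then have "openin P {p \<in> topspace P. f p \<in> S \<inter> \<phi> i -` W}"
      using L by (rule openin_continuous_map_preimage[rotated])
    moreover have "{p \<in> topspace P. f p \<in> S \<inter> \<phi> i -` W} = {p \<in> topspace P. \<phi> i (f p) \<in> W}"
      using fS by auto
    ultimately show ?thesis by simp
  qed
  with fS show ?R by blast
next
  assume R: ?R
  show ?L unfolding initial_topology_def
  proof (rule continuous_on_generated_topo)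
    fix U assume "U \<in> insert S {S \<inter> \<phi> i -` W |i W. i \<in> I \<and> openin (T i) W}"
    then consider "U = S" | i W where "U = S \<inter> \<phi> i -` W" "i \<in> I" "openin (T i) W" by blast
    then show "openin P (f -` U \<inter> topspace P)"
    proof cases
      case 1
      then have "f -` U \<inter> topspace P = topspace P" using R by auto
      then show ?thesis by simp
    next
      case 2
      then have "f -` U \<inter> topspace P = {p \<in> topspace P. \<phi> i (f p) \<in> W}" using R by auto
      then show ?thesis using R 2 by simp
    qed
  qed (use R in auto)
qed

section \<open>A vector space closed under pairing\<close>

text \<open>All the spaces \<open>E\<^sup>[\<^sup>j\<^sup>]\<close> and their products are realised as subspaces of a single vector space, so
  that one inductive predicate can range over maps between different spaces: an element is a binary tree
  with entries in \<^typ>\<open>'b \<times> 'k\<close>, given as a function of the address of the node.\<close>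

type_synonym ('b, 'k) un = "bool list \<Rightarrow> 'b \<times> 'k"

definition ubase :: "'b \<Rightarrow> ('b::zero, 'k::zero) un" where
  "ubase x = (\<lambda>a. if a = [] then (x, 0) else 0)"

definition uscal :: "'k \<Rightarrow> ('b::zero, 'k::zero) un" where
  "uscal t = (\<lambda>a. if a = [] then (0, t) else 0)"

text \<open>The first entry of an address selects the component. With trees as functions, the vector
  operations are the pointwise ones, and \<open>ufst\<close> and \<open>usnd\<close> are linear on
  all trees without any condition on their shape.\<close>

definition upair :: "('b::zero, 'k::zero) un \<Rightarrow> ('b, 'k) un \<Rightarrow> ('b, 'k) un" where
  "upair u v = (\<lambda>a. case a of [] \<Rightarrow> 0 | c # a' \<Rightarrow> if c then u a' else v a')"

definition ubase_of :: "('b, 'k) un \<Rightarrow> 'b" where "ubase_of u = fst (u [])"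
definition uscal_of :: "('b, 'k) un \<Rightarrow> 'k" where "uscal_of u = snd (u [])"
definition ufst :: "('b, 'k) un \<Rightarrow> ('b, 'k) un" where "ufst u = (\<lambda>a. u (True # a))"
definition usnd :: "('b, 'k) un \<Rightarrow> ('b, 'k) un" where "usnd u = (\<lambda>a. u (False # a))"

lemma un_inverse [simp]:
  "ubase_of (ubase x) = x" "uscal_of (uscal t) = t" "ufst (upair u v) = u" "usnd (upair u v) = v"
  by (simp_all add: ubase_def uscal_def upair_def ubase_of_def uscal_of_def ufst_def usnd_def)

lemma un_add [simp]:
  fixes u v :: "('b::ab_group_add, 'k::ab_group_add) un"
  shows "ubase_of (u + v) = ubase_of u + ubase_of v" "uscal_of (u + v) = uscal_of u + uscal_of v"
    "ufst (u + v) = ufst u + ufst v" "usnd (u + v) = usnd u + usnd v"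
    "ubase_of (u - v) = ubase_of u - ubase_of v" "uscal_of (u - v) = uscal_of u - uscal_of v"
    "ufst (u - v) = ufst u - ufst v" "usnd (u - v) = usnd u - usnd v"
    "ubase_of (- u) = - ubase_of u" "uscal_of (- u) = - uscal_of u"
    "ufst (- u) = - ufst u" "usnd (- u) = - usnd u"
    "ubase_of (0 :: ('b, 'k) un) = 0" "uscal_of (0 :: ('b, 'k) un) = 0"
    "ufst (0 :: ('b, 'k) un) = 0" "usnd (0 :: ('b, 'k) un) = 0"
  by (simp_all add: ubase_of_def uscal_of_def ufst_def usnd_def fun_eq_iff zero_fun_def)

lemma upair_add:
  fixes u v :: "('b::ab_group_add, 'k::ab_group_add) un"
  shows "upair u v + upair u' v' = upair (u + u') (v + v')"
    "upair u v - upair u' v' = upair (u - u') (v - v')"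
  by (auto simp: upair_def fun_eq_iff split: list.split)

lemma ubase_add:
  "(ubase (x + y) :: ('b::ab_group_add, 'k::ab_group_add) un) = ubase x + ubase y"
  "(ubase (x - y) :: ('b::ab_group_add, 'k::ab_group_add) un) = ubase x - ubase y"
  by (auto simp: ubase_def fun_eq_iff zero_prod_def)

lemma uscal_add:
  "(uscal (s + t) :: ('b::ab_group_add, 'k::ab_group_add) un) = uscal s + uscal t"
  "(uscal (s - t) :: ('b::ab_group_add, 'k::ab_group_add) un) = uscal s - uscal t"
  by (auto simp: uscal_def fun_eq_iff zero_prod_def)

section \<open>Topological vector spaces\<close>

text \<open>By translation an open \<open>{0}\<close> would make all points open. This is the source
  of the uniqueness of difference quotients.\<close>

lemma not_open_zero: "\<not> open {0 :: 'k::topological_field}"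
proof
  assume o: "open {0 :: 'k}"
  obtain S :: "'k set" where S: "\<not> open S" using non_discrete by blast
  have "open {x}" for x :: 'k
  proof -
    have "continuous_on UNIV (\<lambda>y. y - x)" by (intro continuous_intros)
    then have "open ((\<lambda>y. y - x) -` {0})" using o by (simp add: continuous_on_open_vimage)
    moreover have "(\<lambda>y. y - x) -` {0} = {x}" by auto
    ultimately show ?thesis by simp
  qed
  then have "open (\<Union>x\<in>S. {x})" by blast
  then show False using S by simp
qed

definition scalar_tvs :: "('k::topological_field, 'k) tvs" where
  "scalar_tvs = \<lparr>scl = (*), topo = euclidean\<rparr>"

lemma is_tvsD:
  assumes "is_tvs E"
  shows "vector_space (scl E)" "Hausdorff_space (topo E)" "0 \<in> topspace (topo E)"
    "\<And>x y. \<lbrakk>x \<in> topspace (topo E); y \<in> topspace (topo E)\<rbrakk> \<Longrightarrow> x + y \<in> topspace (topo E)"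
    "\<And>c x. x \<in> topspace (topo E) \<Longrightarrow> scl E c x \<in> topspace (topo E)"
    "continuous_map (prod_topology (topo E) (topo E)) (topo E) (\<lambda>(x, y). x + y)"
    "continuous_map (prod_topology euclidean (topo E)) (topo E) (\<lambda>(c, x). scl E c x)"
proof -
  interpret vector_space "scl E" using assms by (simp add: is_tvs_def)
  have sub: "subspace (topspace (topo E))" using assms by (simp add: is_tvs_def)
  show "vector_space (scl E)" "Hausdorff_space (topo E)" "0 \<in> topspace (topo E)"
    "\<And>x y. \<lbrakk>x \<in> topspace (topo E); y \<in> topspace (topo E)\<rbrakk> \<Longrightarrow> x + y \<in> topspace (topo E)"
    "\<And>c x. x \<in> topspace (topo E) \<Longrightarrow> scl E c x \<in> topspace (topo E)"
    "continuous_map (prod_topology (topo E) (topo E)) (topo E) (\<lambda>(x, y). x + y)"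
    "continuous_map (prod_topology euclidean (topo E)) (topo E) (\<lambda>(c, x). scl E c x)"
    using assms sub by (auto simp: is_tvs_def subspace_add subspace_scale subspace_0)
qed

text \<open>Closure of the carrier under the operations is part of their continuity, because
  \<open>continuous_map\<close> maps into the \<open>topspace\<close>.\<close>

lemma is_tvsI:
  assumes "vector_space (scl E)" "Hausdorff_space (topo E)" "0 \<in> topspace (topo E)"
    "continuous_map (prod_topology (topo E) (topo E)) (topo E) (\<lambda>(x, y). x + y)"
    "continuous_map (prod_topology euclidean (topo E)) (topo E) (\<lambda>(c, x). scl E c x)"
  shows "is_tvs E"
proof -
  interpret vector_space "scl E" by fact
  have "subspace (topspace (topo E))"
    using assms(3) continuous_map_funspace[OF assms(4)] continuous_map_funspace[OF assms(5)]
    unfolding subspace_def by (auto simp: Pi_iff)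
  then show ?thesis using assms by (simp add: is_tvs_def)
qed

lemma continuous_map_tvs_add:
  assumes "is_tvs E" "continuous_map X (topo E) f" "continuous_map X (topo E) g"
  shows "continuous_map X (topo E) (\<lambda>x. f x + g x)"
proof -
  have "continuous_map X (prod_topology (topo E) (topo E)) (\<lambda>x. (f x, g x))"
    using assms by (simp add: continuous_map_pairwise o_def)
  from continuous_map_compose[OF this is_tvsD(6)[OF assms(1)]] show ?thesis by (simp add: o_def)
qed

lemma continuous_map_tvs_scl:
  assumes "is_tvs E" "continuous_map X euclidean c" "continuous_map X (topo E) g"
  shows "continuous_map X (topo E) (\<lambda>x. scl E (c x) (g x))"
proof -
  have "continuous_map X (prod_topology euclidean (topo E)) (\<lambda>x. (c x, g x))"
    using assms by (simp add: continuous_map_pairwise o_def)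
  from continuous_map_compose[OF this is_tvsD(7)[OF assms(1)]] show ?thesis by (simp add: o_def)
qed

lemma tvs_diff:
  assumes "is_tvs E" "x \<in> topspace (topo E)" "y \<in> topspace (topo E)"
  shows "x - y \<in> topspace (topo E)"
proof -
  interpret vector_space "scl E" using is_tvsD(1)[OF assms(1)] .
  have "x - y = x + scl E (-1) y" by simp
  then show ?thesis using is_tvsD(4,5)[OF assms(1)] assms(2,3) by metis
qed

lemma continuous_map_tvs_diff:
  assumes "is_tvs E" "continuous_map X (topo E) f" "continuous_map X (topo E) g"
  shows "continuous_map X (topo E) (\<lambda>x. f x - g x)"
proof -
  interpret vector_space "scl E" using is_tvsD(1)[OF assms(1)] .
  have "continuous_map X (topo E) (\<lambda>x. f x + scl E (-1) (g x))"
    by (intro continuous_map_tvs_add continuous_map_tvs_scl assms) simp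
  then show ?thesis by simp
qed

lemma Hausdorff_space_euclidean_t2: "Hausdorff_space (euclidean :: 'a::t2_space topology)"
  unfolding Hausdorff_space_def disjnt_def using hausdorff by auto

lemma is_tvs_scalar: "is_tvs (scalar_tvs :: ('k::topological_field, 'k) tvs)"
proof (rule is_tvsI)
  show "vector_space (scl (scalar_tvs :: ('k, 'k) tvs))"
    unfolding scalar_tvs_def by unfold_locales (auto simp: algebra_simps)
  have "continuous_on UNIV (\<lambda>x::'k \<times> 'k. fst x + snd x)" "continuous_on UNIV (\<lambda>x::'k \<times> 'k. fst x * snd x)"
    unfolding continuous_on_def
    by (intro ballI tendsto_add tendsto_mult tendsto_fst tendsto_snd tendsto_ident_at)+
  then show "continuous_map (prod_topology (topo scalar_tvs) (topo scalar_tvs)) (topo (scalar_tvs :: ('k, 'k) tvs)) (\<lambda>(x, y). x + y)"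
    "continuous_map (prod_topology euclidean (topo scalar_tvs)) (topo (scalar_tvs :: ('k, 'k) tvs)) (\<lambda>(c, x). scl scalar_tvs c x)"
    by (simp_all add: scalar_tvs_def case_prod_unfold)
qed (simp_all add: scalar_tvs_def Hausdorff_space_euclidean_t2)

lemma is_tvs_prod:
  assumes E: "is_tvs E" and F: "is_tvs F"
  shows "is_tvs (prod_tvs E F)"
proof (rule is_tvsI)
  interpret E: vector_space "scl E" using is_tvsD(1)[OF E] .
  interpret F: vector_space "scl F" using is_tvsD(1)[OF F] .
  show "vector_space (scl (prod_tvs E F))"
    unfolding prod_tvs_def
    by unfold_locales
      (auto simp: E.scale_right_distrib F.scale_right_distrib E.scale_left_distrib F.scale_left_distrib)
  show "Hausdorff_space (topo (prod_tvs E F))" "0 \<in> topspace (topo (prod_tvs E F))"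
    using is_tvsD(2,3)[OF E] is_tvsD(2,3)[OF F]
    by (simp_all add: prod_tvs_def Hausdorff_space_prod_topology zero_prod_def)
  let ?P = "prod_topology (topo E) (topo F)"
  have a: "continuous_map (prod_topology ?P ?P) (topo E) (\<lambda>z. fst (fst z))"
      "continuous_map (prod_topology ?P ?P) (topo E) (\<lambda>z. fst (snd z))"
      "continuous_map (prod_topology ?P ?P) (topo F) (\<lambda>z. snd (fst z))"
      "continuous_map (prod_topology ?P ?P) (topo F) (\<lambda>z. snd (snd z))"
    by (auto intro!: continuous_map_compose[unfolded o_def, OF continuous_map_fst]
        continuous_map_compose[unfolded o_def, OF continuous_map_snd] continuous_map_fst continuous_map_snd)
  have "continuous_map (prod_topology ?P ?P) ?P (\<lambda>z. (fst (fst z) + fst (snd z), snd (fst z) + snd (snd z)))"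
    unfolding continuous_map_pairwise o_def fst_conv snd_conv
    by (intro conjI continuous_map_tvs_add E F a)
  then show "continuous_map (prod_topology (topo (prod_tvs E F)) (topo (prod_tvs E F))) (topo (prod_tvs E F)) (\<lambda>(x, y). x + y)"
    by (simp add: prod_tvs_def case_prod_unfold plus_prod_def)
  have b: "continuous_map (prod_topology euclidean ?P) euclidean (fst :: 'a \<times> _ \<Rightarrow> _)"
      "continuous_map (prod_topology euclidean ?P) (topo E) (\<lambda>z. fst (snd z))"
      "continuous_map (prod_topology euclidean ?P) (topo F) (\<lambda>z. snd (snd z))"
    by (auto intro!: continuous_map_compose[unfolded o_def, OF continuous_map_snd] continuous_map_fst continuous_map_snd)
  have "continuous_map (prod_topology euclidean ?P) ?P (\<lambda>z. (scl E (fst z) (fst (snd z)), scl F (fst z) (snd (snd z))))"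
    unfolding continuous_map_pairwise o_def fst_conv snd_conv
    by (intro conjI continuous_map_tvs_scl E F b)
  then show "continuous_map (prod_topology euclidean (topo (prod_tvs E F))) (topo (prod_tvs E F)) (\<lambda>(c, x). scl (prod_tvs E F) c x)"
    by (simp add: prod_tvs_def case_prod_unfold)
qed

text \<open>The image of \<open>T\<close> under an embedding \<open>e\<close> with left inverse
  \<open>r\<close>: pulling back along \<open>r\<close>, restricted to the range of
  \<open>e\<close>, makes \<open>e\<close> a homeomorphism onto its image.\<close>

definition pushforward :: "('a \<Rightarrow> 'b) \<Rightarrow> ('b \<Rightarrow> 'a) \<Rightarrow> 'a topology \<Rightarrow> 'b topology" where
  "pushforward e r T = pullback_topology (range e) r T"

lemma pushforward:
  assumes "\<And>x. r (e x) = x"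
  shows "topspace (pushforward e r T) = e ` topspace T"
    and "continuous_map T (pushforward e r T) e"
    and "continuous_map (pushforward e r T) T r"
    and "homeomorphic_maps T (pushforward e r T) e r"
proof -
  show top: "topspace (pushforward e r T) = e ` topspace T"
    by (auto simp: pushforward_def topspace_pullback_topology assms)
  have "continuous_map T T (r \<circ> e)" using assms by (simp add: o_def)
  then show e: "continuous_map T (pushforward e r T) e"
    unfolding pushforward_def by (rule continuous_map_pullback') auto
  have "continuous_map (pushforward e r T) T (id \<circ> r)"
    unfolding pushforward_def by (rule continuous_map_pullback) auto
  then show r: "continuous_map (pushforward e r T) T r" by simp
  show "homeomorphic_maps T (pushforward e r T) e r"
    unfolding homeomorphic_maps_def using e r top assms by auto
qed

lemma is_tvs_pushforward:
  assumes E: "is_tvs E" and inv: "\<And>x. r (e x) = x" and s: "vector_space s"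
    and add: "\<And>x y. e (x + y) = e x + e y" and scl: "\<And>c x. e (scl E c x) = s c (e x)"
  shows "is_tvs \<lparr>scl = s, topo = pushforward e r (topo E)\<rparr>"
proof (rule is_tvsI, simp_all)
  let ?T = "pushforward e r (topo E)"
  note p = pushforward[of r e "topo E", OF inv]
  show "vector_space s" by fact
  show "Hausdorff_space ?T"
    using is_tvsD(2)[OF E] p(4) homeomorphic_Hausdorff_space homeomorphic_space_def by blast
  have "e 0 + e 0 = e 0" using add[of 0 0] by simp
  then have "e 0 = 0" by simp
  then show "0 \<in> topspace ?T" using p(1) is_tvsD(3)[OF E] by (metis image_eqI)
  have a: "continuous_map (prod_topology ?T ?T) (topo E) (\<lambda>z. r (fst z))"
    "continuous_map (prod_topology ?T ?T) (topo E) (\<lambda>z. r (snd z))"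
    by (auto intro!: continuous_map_compose[unfolded o_def, OF _ p(3)] continuous_map_fst continuous_map_snd)
  have "continuous_map (prod_topology ?T ?T) ?T (\<lambda>z. e (r (fst z) + r (snd z)))"
    by (intro continuous_map_compose[unfolded o_def, OF _ p(2)] continuous_map_tvs_add E a)
  then show "continuous_map (prod_topology ?T ?T) ?T (\<lambda>(x, y). x + y)"
    by (rule continuous_map_eq) (auto simp: p(1) inv add)
  have b: "continuous_map (prod_topology euclidean ?T) (topo E) (\<lambda>z. r (snd z))"
    by (auto intro!: continuous_map_compose[unfolded o_def, OF _ p(3)] continuous_map_snd)
  have "continuous_map (prod_topology euclidean ?T) ?T (\<lambda>z. e (scl E (fst z) (r (snd z))))"
    by (intro continuous_map_compose[unfolded o_def, OF _ p(2)] continuous_map_tvs_scl E b continuous_map_fst)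
  then show "continuous_map (prod_topology euclidean ?T) ?T (\<lambda>(c, x). s c x)"
    by (rule continuous_map_eq) (auto simp: p(1) inv scl)
qed

section \<open>Smooth maps between subspaces of the universal space\<close>

abbreviation "ustep x y t \<equiv> upair x (upair y (uscal t))"
abbreviation "upnt \<equiv> ufst"
abbreviation "udir u \<equiv> ufst (usnd u)"
abbreviation "upar u \<equiv> uscal_of (usnd (usnd u))"

definition uprod :: "('b, 'k) un topology \<Rightarrow> ('b, 'k) un topology \<Rightarrow> ('b::ab_group_add, 'k::topological_field) un topology" where
  "uprod \<sigma> \<tau> = pushforward (\<lambda>(a, b). upair a b) (\<lambda>u. (ufst u, usnd u)) (prod_topology \<sigma> \<tau>)"

definition uscalars :: "('b::ab_group_add, 'k::topological_field) un topology" where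
  "uscalars = pushforward uscal uscal_of euclidean"

text \<open>If \<open>\<sigma>\<close> is the topology of \<open>E\<close>, this is the topology of
  the space \<open>E \<times> E \<times> K\<close> that contains
  \<open>U\<^sup>[\<^sup>1\<^sup>]\<close>.\<close>

abbreviation "ubr \<sigma> \<equiv> uprod \<sigma> (uprod \<sigma> uscalars)"

lemma topspace_uprod: "topspace (uprod \<sigma> \<tau>) = (\<lambda>(a, b). upair a b) ` (topspace \<sigma> \<times> topspace \<tau>)"
  unfolding uprod_def by (subst pushforward(1)) auto

lemma topspace_uscalars: "topspace uscalars = range uscal"
  unfolding uscalars_def by (subst pushforward(1)) auto

lemma continuous_map_ufst: "continuous_map (uprod \<sigma> \<tau>) \<sigma> ufst"
  and continuous_map_usnd: "continuous_map (uprod \<sigma> \<tau>) \<tau> usnd"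
proof -
  have "continuous_map (uprod \<sigma> \<tau>) (prod_topology \<sigma> \<tau>) (\<lambda>u. (ufst u, usnd u))"
    unfolding uprod_def by (rule pushforward(3)) auto
  then show "continuous_map (uprod \<sigma> \<tau>) \<sigma> ufst" "continuous_map (uprod \<sigma> \<tau>) \<tau> usnd"
    by (simp_all add: continuous_map_pairwise o_def)
qed

lemma continuous_map_upair':
  "continuous_map (prod_topology \<sigma> \<tau>) (uprod \<sigma> \<tau>) (\<lambda>(a, b). upair a b)"
  unfolding uprod_def by (rule pushforward(2)) auto

lemma continuous_map_upair:
  assumes "continuous_map X \<sigma> f" "continuous_map X \<tau> g"
  shows "continuous_map X (uprod \<sigma> \<tau>) (\<lambda>x. upair (f x) (g x))"
proof -
  have "continuous_map X (prod_topology \<sigma> \<tau>) (\<lambda>x. (f x, g x))"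
    using assms by (simp add: continuous_map_pairwise o_def)
  from continuous_map_compose[OF this continuous_map_upair'] show ?thesis by (simp add: o_def)
qed

lemma continuous_map_uscal: "continuous_map euclidean uscalars uscal"
  unfolding uscalars_def by (rule pushforward(2)) auto

lemma continuous_map_uscal_of: "continuous_map uscalars euclidean uscal_of"
  unfolding uscalars_def by (rule pushforward(3)) auto

lemmas continuous_map_compose' = continuous_map_compose[unfolded o_def]

lemma continuous_map_ubr:
  "continuous_map (ubr \<sigma>) \<sigma> upnt" "continuous_map (ubr \<sigma>) \<sigma> (\<lambda>u. udir u)"
  "continuous_map (ubr \<sigma>) euclidean (\<lambda>u. upar u)"
  using continuous_map_ufst continuous_map_compose'[OF continuous_map_usnd continuous_map_ufst]
    continuous_map_compose'[OF continuous_map_compose'[OF continuous_map_usnd continuous_map_usnd] continuous_map_uscal_of]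
  by blast+

lemma continuous_map_ustep:
  assumes "continuous_map X \<sigma> f" "continuous_map X \<sigma> g" "continuous_map X euclidean c"
  shows "continuous_map X (ubr \<sigma>) (\<lambda>x. ustep (f x) (g x) (c x))"
  by (intro continuous_map_upair assms continuous_map_compose'[OF assms(3) continuous_map_uscal])

primrec ubrs :: "nat \<Rightarrow> ('b, 'k) un topology \<Rightarrow> ('b::ab_group_add, 'k::topological_field) un topology" where
  "ubrs 0 \<sigma> = \<sigma>"
| "ubrs (Suc j) \<sigma> = ubr (ubrs j \<sigma>)"

text \<open>Exchanges the innermost and the outermost bracket. Together with
  \<open>ubsets_shift\<close> it lets the quotients of order \<open>j\<close> of
  \<open>f\<^sup>[\<^sup>1\<^sup>]\<close> be read as the quotients of order \<open>j + 1\<close> of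
  \<open>f\<close>.\<close>

lemma ubrs_shift: "ubrs j (ubr \<sigma>) = ubr (ubrs j \<sigma>)"
  by (induction j) simp_all

locale universe = vector_space sc
  for sc :: "'k::topological_field \<Rightarrow> 'b::ab_group_add \<Rightarrow> 'b"
begin

definition us :: "'k \<Rightarrow> ('b, 'k) un \<Rightarrow> ('b, 'k) un" where
  "us c u = (\<lambda>a. (sc c (fst (u a)), c * snd (u a)))"

sublocale us: vector_space us
  by unfold_locales
    (simp_all add: us_def fun_eq_iff scale_right_distrib scale_left_distrib algebra_simps)

lemma us_simps [simp]:
  "ubase_of (us c u) = sc c (ubase_of u)" "uscal_of (us c u) = c * uscal_of u"
  "ufst (us c u) = us c (ufst u)" "usnd (us c u) = us c (usnd u)"
  by (simp_all add: us_def ubase_of_def uscal_of_def ufst_def usnd_def)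

lemma us_constr:
  "us c (upair u v) = upair (us c u) (us c v)" "us c (uscal t) = uscal (c * t)" "us c (ubase x) = ubase (sc c x)"
  by (auto simp: us_def upair_def uscal_def ubase_def fun_eq_iff zero_prod_def split: list.split)

text \<open>Scalar multiplication is the same for all subspaces, so a subspace with its vector
  topology is determined by the topology alone.\<close>

definition usp :: "('b, 'k) un topology \<Rightarrow> bool" where
  "usp \<tau> \<longleftrightarrow> is_tvs \<lparr>scl = us, topo = \<tau>\<rparr>"

lemma uspD:
  assumes "usp \<tau>"
  shows "Hausdorff_space \<tau>" "0 \<in> topspace \<tau>"
    "\<And>x y. \<lbrakk>x \<in> topspace \<tau>; y \<in> topspace \<tau>\<rbrakk> \<Longrightarrow> x + y \<in> topspace \<tau>"
    "\<And>x y. \<lbrakk>x \<in> topspace \<tau>; y \<in> topspace \<tau>\<rbrakk> \<Longrightarrow> x - y \<in> topspace \<tau>"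
    "\<And>c x. x \<in> topspace \<tau> \<Longrightarrow> us c x \<in> topspace \<tau>"
    "continuous_map (prod_topology \<tau> \<tau>) \<tau> (\<lambda>(x, y). x + y)"
    "continuous_map (prod_topology euclidean \<tau>) \<tau> (\<lambda>(c, x). us c x)"
  using is_tvsD[OF assms[unfolded usp_def]] tvs_diff[OF assms[unfolded usp_def]] by simp_all

lemma continuous_map_usp:
  assumes "usp \<tau>" "continuous_map X \<tau> g"
  shows "continuous_map X euclidean c \<Longrightarrow> continuous_map X \<tau> (\<lambda>x. us (c x) (g x))"
    and "continuous_map X \<tau> f \<Longrightarrow> continuous_map X \<tau> (\<lambda>x. f x + g x)"
    and "continuous_map X \<tau> f \<Longrightarrow> continuous_map X \<tau> (\<lambda>x. f x - g x)"
  using continuous_map_tvs_scl[OF assms(1)[unfolded usp_def], of X c g]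
    continuous_map_tvs_add[OF assms(1)[unfolded usp_def], of X f g]
    continuous_map_tvs_diff[OF assms(1)[unfolded usp_def], of X f g] assms(2) by simp_all

lemma usp_pushforward:
  assumes "is_tvs E" "\<And>x. r (e x) = x" "\<And>x y. e (x + y) = e x + e y" "\<And>c x. e (scl E c x) = us c (e x)"
  shows "usp (pushforward e r (topo E))"
  unfolding usp_def using is_tvs_pushforward[OF assms(1,2) us.vector_space_axioms assms(3,4)] .

lemma usp_uprod:
  assumes "usp \<sigma>" "usp \<tau>"
  shows "usp (uprod \<sigma> \<tau>)"
  using usp_pushforward[OF is_tvs_prod[OF assms[unfolded usp_def]], of "\<lambda>u. (ufst u, usnd u)" "\<lambda>(a, b). upair a b"]
  by (auto simp: uprod_def prod_tvs_def upair_add us_constr)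

lemma usp_uscalars: "usp uscalars"
  using usp_pushforward[OF is_tvs_scalar, of uscal_of uscal]
  by (auto simp: uscalars_def scalar_tvs_def uscal_add us_constr)

lemma usp_ubr: "usp \<sigma> \<Longrightarrow> usp (ubr \<sigma>)"
  by (intro usp_uprod usp_uscalars)

lemma usp_ubrs: "usp \<sigma> \<Longrightarrow> usp (ubrs j \<sigma>)"
  by (induction j) (simp_all add: usp_ubr)

abbreviation uline :: "('b, 'k) un \<Rightarrow> ('b, 'k) un" where
  "uline u \<equiv> upnt u + us (upar u) (udir u)"

lemma continuous_map_uline: "usp \<sigma> \<Longrightarrow> continuous_map (ubr \<sigma>) \<sigma> uline"
  by (intro continuous_map_usp continuous_map_ubr)

definition ubset :: "('b, 'k) un topology \<Rightarrow> ('b, 'k) un set \<Rightarrow> ('b, 'k) un set" where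
  "ubset \<sigma> A = {u \<in> topspace (ubr \<sigma>). upnt u \<in> A \<and> uline u \<in> A}"

primrec ubsets :: "('b, 'k) un topology \<Rightarrow> ('b, 'k) un set \<Rightarrow> nat \<Rightarrow> ('b, 'k) un set" where
  "ubsets \<sigma> A 0 = A"
| "ubsets \<sigma> A (Suc j) = ubset (ubrs j \<sigma>) (ubsets \<sigma> A j)"

lemma ubsets_shift: "ubsets (ubr \<sigma>) (ubset \<sigma> A) j = ubset (ubrs j \<sigma>) (ubsets \<sigma> A j)"
  by (induction j) (simp_all add: ubrs_shift)

lemma openin_ubset:
  assumes "usp \<sigma>" "openin \<sigma> A"
  shows "openin (ubr \<sigma>) (ubset \<sigma> A)"
proof -
  have "openin (ubr \<sigma>) {u \<in> topspace (ubr \<sigma>). upnt u \<in> A}" "openin (ubr \<sigma>) {u \<in> topspace (ubr \<sigma>). uline u \<in> A}"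
    using assms by (auto intro!: openin_continuous_map_preimage continuous_map_ubr continuous_map_uline)
  then have "openin (ubr \<sigma>) ({u \<in> topspace (ubr \<sigma>). upnt u \<in> A} \<inter> {u \<in> topspace (ubr \<sigma>). uline u \<in> A})"
    by (rule openin_Int)
  also have "{u \<in> topspace (ubr \<sigma>). upnt u \<in> A} \<inter> {u \<in> topspace (ubr \<sigma>). uline u \<in> A} = ubset \<sigma> A"
    by (auto simp: ubset_def)
  finally show ?thesis .
qed

lemma openin_ubsets: "usp \<sigma> \<Longrightarrow> openin \<sigma> A \<Longrightarrow> openin (ubrs j \<sigma>) (ubsets \<sigma> A j)"
  by (induction j) (simp_all add: openin_ubset usp_ubrs)

lemma topspace_ubr: "topspace (ubr \<sigma>) = {ustep x y t | x y t. x \<in> topspace \<sigma> \<and> y \<in> topspace \<sigma>}"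
  by (auto simp: topspace_uprod topspace_uscalars image_iff)

lemma ustep_eta: "u \<in> topspace (ubr \<sigma>) \<Longrightarrow> ustep (upnt u) (udir u) (upar u) = u"
  by (auto simp: topspace_ubr)

lemma ubset_dest:
  assumes "u \<in> ubset \<sigma> A"
  shows "upnt u \<in> A" "uline u \<in> A" "upnt u \<in> topspace \<sigma>" "udir u \<in> topspace \<sigma>" "u \<in> topspace (ubr \<sigma>)"
  using assms by (auto simp: ubset_def topspace_ubr)

lemma ustep_in_ubset:
  "ustep x y t \<in> ubset \<sigma> A \<longleftrightarrow> x \<in> topspace \<sigma> \<and> y \<in> topspace \<sigma> \<and> x \<in> A \<and> x + us t y \<in> A"
  by (auto simp: ubset_def topspace_ubr) (metis un_inverse(2,3,4))+

text \<open>The quotient is written multiplicatively; at parameter \<open>0\<close> the equation holds trivially.\<close>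

definition dquot :: "'p topology \<Rightarrow> ('b, 'k) un topology \<Rightarrow> ('b, 'k) un set \<Rightarrow>
    ('p \<Rightarrow> ('b, 'k) un \<Rightarrow> ('b, 'k) un) \<Rightarrow> ('p \<Rightarrow> ('b, 'k) un \<Rightarrow> ('b, 'k) un) \<Rightarrow> bool" where
  "dquot P \<sigma> A f h \<longleftrightarrow> (\<forall>p\<in>topspace P. \<forall>u\<in>ubset \<sigma> A. us (upar u) (h p u) = f p (uline u) - f p (upnt u))"

text \<open>Fix the point and the direction and let only the parameter \<open>t\<close> vary. The
  admissible \<open>t\<close> form an open set, and two continuous maps into a Hausdorff space agree
  on a closed part of it. They can differ only at \<open>0\<close>; if they did, \<open>{0}\<close>
  would be open in the field.\<close>

lemma dquot_unique:
  assumes \<sigma>: "usp \<sigma>" and \<tau>: "usp \<tau>" and A: "openin \<sigma> A"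
    and h: "continuous_map (subtopology (ubr \<sigma>) (ubset \<sigma> A)) \<tau> h"
    and h': "continuous_map (subtopology (ubr \<sigma>) (ubset \<sigma> A)) \<tau> h'"
    and eq: "\<And>u. \<lbrakk>u \<in> ubset \<sigma> A; upar u \<noteq> 0\<rbrakk> \<Longrightarrow> h u = h' u"
    and u: "u \<in> ubset \<sigma> A"
  shows "h u = h' u"
proof (cases "upar u = 0")
  case False then show ?thesis using eq u by simp
next
  case True
  define \<gamma> where "\<gamma> t = ustep (upnt u) (udir u) t" for t
  have \<gamma>: "continuous_map euclidean (ubr \<sigma>) \<gamma>"
    unfolding \<gamma>_def using ubset_dest[OF u] by (intro continuous_map_ustep) auto
  have "u \<in> topspace (ubr \<sigma>)" using u by (simp add: ubset_def)
  then have \<gamma>0: "\<gamma> 0 = u" using ustep_eta[of u \<sigma>] True by (simp add: \<gamma>_def)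
  define O' where "O' = {t. \<gamma> t \<in> ubset \<sigma> A}"
  have O': "openin euclidean O'"
    using openin_continuous_map_preimage[OF \<gamma> openin_ubset[OF \<sigma> A]] by (simp add: O'_def)
  have \<gamma>': "continuous_map (subtopology euclidean O') (subtopology (ubr \<sigma>) (ubset \<sigma> A)) \<gamma>"
    using \<gamma> by (auto simp: continuous_map_in_subtopology O'_def intro: continuous_map_from_subtopology)
  have "closedin (subtopology euclidean O') {t \<in> topspace (subtopology euclidean O'). h (\<gamma> t) = h' (\<gamma> t)}"
    by (intro closedin_continuous_maps_eq[OF uspD(1)[OF \<tau>]] continuous_map_compose'[OF \<gamma>' h] continuous_map_compose'[OF \<gamma>' h'])
  then have op: "openin (subtopology euclidean O') (O' - {t \<in> O'. h (\<gamma> t) = h' (\<gamma> t)})"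
    by (simp add: closedin_def)
  show ?thesis
  proof (rule ccontr)
    assume "h u \<noteq> h' u"
    then have "O' - {t \<in> O'. h (\<gamma> t) = h' (\<gamma> t)} = {0}"
      using eq u by (auto simp: O'_def \<gamma>0) (metis \<gamma>_def un_inverse(2,4))
    with op have "openin (subtopology euclidean O') {0 :: 'k}" by simp
    with O' have "openin euclidean {0 :: 'k}" by (metis openin_trans_full)
    then show False using not_open_zero[where 'k='k] by simp
  qed
qed

text \<open>\<open>h j p\<close> stands for \<open>f\<^sup>[\<^sup>j\<^sup>]\<close> with
  \<open>f = h 0 p\<close>.\<close>

definition Useq :: "'p topology \<Rightarrow> ('b, 'k) un topology \<Rightarrow> ('b, 'k) un set \<Rightarrow> ('b, 'k) un topology \<Rightarrow>
    (nat \<Rightarrow> 'p \<Rightarrow> ('b, 'k) un \<Rightarrow> ('b, 'k) un) \<Rightarrow> bool" where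
  "Useq P \<sigma> A \<tau> h \<longleftrightarrow> (\<forall>j. kcont P (subtopology (ubrs j \<sigma>) (ubsets \<sigma> A j)) \<tau> (h j) \<and>
     dquot P (ubrs j \<sigma>) (ubsets \<sigma> A j) (h j) (h (Suc j)))"

text \<open>A family as in the hypothesis \<open>C\<^sup>\<infinity>\<^sup>,\<^sup>\<infinity>\<close> of the exponential law: \<open>H j l\<close> is the partial difference
  quotient of orders \<open>j\<close> and \<open>l\<close> of \<open>H 0 0\<close>.\<close>

definition Ufam :: "'p topology \<Rightarrow> ('b, 'k) un topology \<Rightarrow> ('b, 'k) un set \<Rightarrow> ('b, 'k) un topology \<Rightarrow> ('b, 'k) un set \<Rightarrow>
    ('b, 'k) un topology \<Rightarrow> (nat \<Rightarrow> nat \<Rightarrow> 'p \<Rightarrow> ('b, 'k) un \<Rightarrow> ('b, 'k) un \<Rightarrow> ('b, 'k) un) \<Rightarrow> bool" where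
  "Ufam P \<sigma> A \<sigma>' A' \<tau> H \<longleftrightarrow>
     (\<forall>j l. kcont P (prod_topology (subtopology (ubrs j \<sigma>) (ubsets \<sigma> A j)) (subtopology (ubrs l \<sigma>') (ubsets \<sigma>' A' l))) \<tau>
        (\<lambda>p (a, b). H j l p a b)) \<and>
     (\<forall>j l. \<forall>b\<in>ubsets \<sigma>' A' l. dquot P (ubrs j \<sigma>) (ubsets \<sigma> A j) (\<lambda>p a. H j l p a b) (\<lambda>p a. H (Suc j) l p a b)) \<and>
     (\<forall>j l. \<forall>a\<in>ubsets \<sigma> A j. dquot P (ubrs l \<sigma>') (ubsets \<sigma>' A' l) (\<lambda>p. H j l p a) (\<lambda>p. H j (Suc l) p a))"

text \<open>Closure under all the constructions of the calculus at once: every member has a difference quotient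
  that is again a member, so that iterating produces all \<open>f\<^sup>[\<^sup>j\<^sup>]\<close>.  In \<open>comp\<close> the inner map
  does not depend on the parameter, because the images of a compact set under a parametrised family need not
  lie in a common compact set.\<close>

inductive Usm :: "'p topology \<Rightarrow> ('b, 'k) un topology \<Rightarrow> ('b, 'k) un set \<Rightarrow> ('b, 'k) un topology \<Rightarrow>
    ('p \<Rightarrow> ('b, 'k) un \<Rightarrow> ('b, 'k) un) \<Rightarrow> bool" for P where
  seq: "\<lbrakk>usp \<sigma>; usp \<tau>; openin \<sigma> A; Useq P \<sigma> A \<tau> h\<rbrakk> \<Longrightarrow> Usm P \<sigma> A \<tau> (h 0)"
| fam: "\<lbrakk>usp \<sigma>; usp \<sigma>'; usp \<tau>; openin \<sigma> A; openin \<sigma>' A'; Ufam P \<sigma> A \<sigma>' A' \<tau> H\<rbrakk> \<Longrightarrow>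
     Usm P (uprod \<sigma> \<sigma>') {u \<in> topspace (uprod \<sigma> \<sigma>'). ufst u \<in> A \<and> usnd u \<in> A'} \<tau> (\<lambda>p u. H 0 0 p (ufst u) (usnd u))"
| comp: "\<lbrakk>Usm P \<sigma> A \<tau> f; Usm P \<rho> B \<sigma> (\<lambda>_. \<phi>); \<phi> ` B \<subseteq> A\<rbrakk> \<Longrightarrow> Usm P \<rho> B \<tau> (\<lambda>p x. f p (\<phi> x))"
| freeze: "\<lbrakk>Usm P \<sigma> A \<tau> f; p0 \<in> topspace P\<rbrakk> \<Longrightarrow> Usm P \<sigma> A \<tau> (\<lambda>_. f p0)"
| congr: "\<lbrakk>Usm P \<sigma> A \<tau> f; \<forall>p\<in>topspace P. \<forall>x\<in>A. f p x = g p x\<rbrakk> \<Longrightarrow> Usm P \<sigma> A \<tau> g"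
| pair: "\<lbrakk>Usm P \<sigma> A \<tau> f; Usm P \<sigma> A \<tau>' g\<rbrakk> \<Longrightarrow> Usm P \<sigma> A (uprod \<tau> \<tau>') (\<lambda>p x. upair (f p x) (g p x))"
| lin: "\<lbrakk>Usm P \<sigma> A \<tau> f; usp \<tau>'; continuous_map \<tau> \<tau>' L;
     \<forall>x\<in>topspace \<tau>. \<forall>y\<in>topspace \<tau>. L (x - y) = L x - L y; \<forall>c. \<forall>x\<in>topspace \<tau>. L (us c x) = us c (L x)\<rbrakk> \<Longrightarrow>
     Usm P \<sigma> A \<tau>' (\<lambda>p x. L (f p x))"
| ident: "\<lbrakk>usp \<sigma>; openin \<sigma> A\<rbrakk> \<Longrightarrow> Usm P \<sigma> A \<sigma> (\<lambda>p x. x)"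
| param: "\<lbrakk>usp \<sigma>; usp \<tau>; openin \<sigma> A; continuous_map P \<tau> c\<rbrakk> \<Longrightarrow> Usm P \<sigma> A \<tau> (\<lambda>p x. c p)"
| smul: "\<lbrakk>Usm P \<sigma> A uscalars c; Usm P \<sigma> A \<tau> f\<rbrakk> \<Longrightarrow> Usm P \<sigma> A \<tau> (\<lambda>p x. us (uscal_of (c p x)) (f p x))"
| inv: "\<lbrakk>Usm P \<sigma> A uscalars c; \<forall>p\<in>topspace P. \<forall>x\<in>A. uscal_of (c p x) \<noteq> 0\<rbrakk> \<Longrightarrow>
     Usm P \<sigma> A uscalars (\<lambda>p x. uscal (inverse (uscal_of (c p x))))"
| cover: "\<lbrakk>usp \<sigma>; usp \<tau>; \<forall>B\<in>\<B>. openin \<sigma> B \<and> Usm P \<sigma> B \<tau> f\<rbrakk> \<Longrightarrow> Usm P \<sigma> (\<Union>\<B>) \<tau> f"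

end

text \<open>The facts on \<open>Usm\<close> that choose a parameter assume that there is one; this
  lemma settles the empty parameter space.\<close>

lemma kcont_empty: "topspace P = {} \<Longrightarrow> kcont P S T f"
proof (rule kcontI)
  fix Q C assume "topspace P = {}" "Q \<subseteq> topspace P"
  then have "topspace (prod_topology (subtopology P Q) (subtopology S C)) = {}" by simp
  then show "continuous_map (prod_topology (subtopology P Q) (subtopology S C)) T (\<lambda>(p, x). f p x)"
    unfolding continuous_map_def by (simp only: empty_iff simp_thms Collect_empty_eq openin_empty Pi_iff ball_simps) auto
qed

lemma kcont_in_subtopology:
  assumes f: "kcont P S T f" and im: "\<And>p x. \<lbrakk>p \<in> topspace P; x \<in> topspace S\<rbrakk> \<Longrightarrow> f p x \<in> U"
  shows "kcont P S (subtopology T U) f"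
proof (rule kcontI)
  fix Q C assume QC: "Q \<subseteq> topspace P" "C \<subseteq> topspace S" "(\<exists>p. Q = {p}) \<or> compactin S C"
  have "(\<lambda>(p, x). f p x) \<in> topspace (prod_topology (subtopology P Q) (subtopology S C)) \<rightarrow> U"
    using im by auto
  then show "continuous_map (prod_topology (subtopology P Q) (subtopology S C)) (subtopology T U) (\<lambda>(p, x). f p x)"
    unfolding continuous_map_in_subtopology using kcontD[OF f QC] by blast
qed

section \<open>Continuity of the members of \<open>Usm\<close> and derived rules\<close>

context universe
begin

lemma continuous_map_uinverse:
  "continuous_map (subtopology uscalars {u :: ('b, 'k) un. uscal_of u \<noteq> 0}) uscalars (\<lambda>u. uscal (inverse (uscal_of u)) :: ('b, 'k) un)"
proof -
  have "continuous_on (- {0}) (inverse :: 'k \<Rightarrow> 'k)"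
    unfolding continuous_on_def at_within_def
    by (intro ballI tendsto_mono[OF inf_le1] tendsto_inverse_nhds) simp
  then have 1: "continuous_map (subtopology euclidean (- {0})) euclidean (inverse :: 'k \<Rightarrow> 'k)" by simp
  have 2: "continuous_map (subtopology uscalars {u :: ('b, 'k) un. uscal_of u \<noteq> 0}) (subtopology euclidean (- {0})) uscal_of"
    by (intro continuous_map_into_subtopology continuous_map_from_subtopology continuous_map_uscal_of) auto
  show ?thesis
    by (rule continuous_map_compose'[OF continuous_map_compose'[OF 2 1] continuous_map_uscal])
qed

text \<open>A parameter has to exist: in \<open>comp\<close> the inner map \<open>\<phi>\<close> is
  known to be continuous only through the constant family \<open>\<lambda>_. \<phi>\<close>, about
  which an empty parameter space says nothing.\<close>

lemma Usm_basics:
  assumes "Usm P \<sigma> A \<tau> f" "topspace P \<noteq> {}"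
  shows "usp \<sigma> \<and> usp \<tau> \<and> openin \<sigma> A \<and> kcont P (subtopology \<sigma> A) \<tau> f"
  using assms
proof (induction rule: Usm.induct)
  case (seq \<sigma> \<tau> A h)
  then have "kcont P (subtopology (ubrs 0 \<sigma>) (ubsets \<sigma> A 0)) \<tau> (h 0)" unfolding Useq_def by blast
  with seq show ?case by simp
next
  case (fam \<sigma> \<sigma>' \<tau> A A' H)
  let ?A = "{u \<in> topspace (uprod \<sigma> \<sigma>'). ufst u \<in> A \<and> usnd u \<in> A'}"
  have "kcont P (prod_topology (subtopology (ubrs 0 \<sigma>) (ubsets \<sigma> A 0)) (subtopology (ubrs 0 \<sigma>') (ubsets \<sigma>' A' 0))) \<tau>
      (\<lambda>p (a, b). H 0 0 p a b)"
    using fam unfolding Ufam_def by blast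
  then have k: "kcont P (prod_topology (subtopology \<sigma> A) (subtopology \<sigma>' A')) \<tau> (\<lambda>p (a, b). H 0 0 p a b)"
    by simp
  have "continuous_map (subtopology (uprod \<sigma> \<sigma>') ?A) (prod_topology (subtopology \<sigma> A) (subtopology \<sigma>' A')) (\<lambda>u. (ufst u, usnd u))"
    unfolding continuous_map_pairwise o_def fst_conv snd_conv
    by (intro conjI continuous_map_into_subtopology continuous_map_from_subtopology continuous_map_ufst continuous_map_usnd) auto
  from kcont_precompose[OF k this] have "kcont P (subtopology (uprod \<sigma> \<sigma>') ?A) \<tau> (\<lambda>p u. H 0 0 p (ufst u) (usnd u))"
    by simp
  moreover have "openin (uprod \<sigma> \<sigma>') ?A"
  proof -
    have "openin (uprod \<sigma> \<sigma>') ({u \<in> topspace (uprod \<sigma> \<sigma>'). ufst u \<in> A} \<inter> {u \<in> topspace (uprod \<sigma> \<sigma>'). usnd u \<in> A'})"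
      by (intro openin_Int openin_continuous_map_preimage[OF continuous_map_ufst fam(4)]
          openin_continuous_map_preimage[OF continuous_map_usnd fam(5)])
    also have "\<dots> = ?A" by auto
    finally show ?thesis .
  qed
  ultimately show ?case using fam usp_uprod by blast
next
  case (comp \<sigma> A \<tau> f \<rho> B \<phi>)
  obtain p0 where p0: "p0 \<in> topspace P" using comp.prems by blast
  have \<phi>: "kcont P (subtopology \<rho> B) \<sigma> (\<lambda>_. \<phi>)" and B: "openin \<rho> B" using comp by auto
  have "continuous_map (subtopology \<rho> B) (subtopology \<sigma> A) \<phi>"
    using kcont_slice[OF \<phi> p0] comp(3) by (intro continuous_map_into_subtopology) auto
  then show ?case using comp kcont_precompose by blast
next
  case (freeze \<sigma> A \<tau> f p0)
  then have "kcont P (subtopology \<sigma> A) \<tau> f" by blast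
  from kcont_freeze[OF this freeze(2), of P] show ?case using freeze by blast
next
  case (congr \<sigma> A \<tau> f g)
  then have k: "kcont P (subtopology \<sigma> A) \<tau> f" by blast
  have "kcont P (subtopology \<sigma> A) \<tau> g" using congr(2) by (intro kcont_cong[OF k]) simp
  then show ?case using congr by blast
next
  case (pair \<sigma> A \<tau> f \<tau>' g)
  then show ?case using kcont_binop[OF _ _ continuous_map_upair'] usp_uprod by blast
next
  case (lin \<sigma> A \<tau> f \<tau>' L)
  then show ?case using kcont_postcompose by blast
next
  case (ident \<sigma> A)
  then show ?case
    using kcont_point[of "subtopology \<sigma> A" \<sigma> "\<lambda>x. x" P] by (simp add: continuous_map_from_subtopology)
next
  case (param \<sigma> \<tau> A c)
  then show ?case using kcont_param by blast
next
  case (smul \<sigma> A c \<tau> f)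
  then have u: "usp \<sigma>" "usp \<tau>" "openin \<sigma> A" and c: "kcont P (subtopology \<sigma> A) uscalars c"
    and f: "kcont P (subtopology \<sigma> A) \<tau> f" by auto
  show ?case
    using u kcont_binop[OF kcont_postcompose[OF c continuous_map_uscal_of] f uspD(7)[OF u(2)]] by simp
next
  case (inv \<sigma> A c)
  then have u: "usp \<sigma>" "openin \<sigma> A" and c: "kcont P (subtopology \<sigma> A) uscalars c" by auto
  have "kcont P (subtopology \<sigma> A) (subtopology uscalars {u. uscal_of u \<noteq> 0}) c"
    using c inv by (intro kcont_in_subtopology) auto
  from kcont_postcompose[OF this continuous_map_uinverse] show ?case using u usp_uscalars by simp
next
  case (cover \<sigma> \<tau> \<B> f)
  have "kcont P (subtopology \<sigma> (\<Union>\<B>)) \<tau> f"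
  proof (rule kcont_local)
    show "Hausdorff_space (subtopology \<sigma> (\<Union>\<B>))" using cover uspD(1) Hausdorff_space_subtopology by blast
    show "topspace (subtopology \<sigma> (\<Union>\<B>)) \<subseteq> \<Union>\<B>" by auto
    fix B assume B: "B \<in> \<B>"
    then show "openin (subtopology \<sigma> (\<Union>\<B>)) B" using cover by (metis Union_upper openin_subset_topspace_eq openin_open_subtopology openin_Union)
    have "subtopology (subtopology \<sigma> (\<Union>\<B>)) B = subtopology \<sigma> B"
      using B by (simp add: subtopology_subtopology Int_absorb1 Union_upper)
    then show "kcont P (subtopology (subtopology \<sigma> (\<Union>\<B>)) B) \<tau> f" using cover B by auto
  qed
  moreover have "openin \<sigma> (\<Union>\<B>)" using cover by blast
  ultimately show ?case using cover by blast
qed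

lemma Usm_lin_map:
  assumes "usp \<sigma>" "openin \<sigma> A" "usp \<tau>" "continuous_map \<sigma> \<tau> L"
    "\<And>x y. \<lbrakk>x \<in> topspace \<sigma>; y \<in> topspace \<sigma>\<rbrakk> \<Longrightarrow> L (x - y) = L x - L y"
    "\<And>c x. x \<in> topspace \<sigma> \<Longrightarrow> L (us c x) = us c (L x)"
  shows "Usm P \<sigma> A \<tau> (\<lambda>_. L)"
  using Usm.lin[OF Usm.ident[OF assms(1,2)] assms(3,4), of P] assms(5,6) by simp

text \<open>Addition is a continuous linear map on pairs, so \<open>pair\<close> and
  \<open>lin\<close> suffice.\<close>

lemma Usm_add:
  assumes f: "Usm P \<sigma> A \<tau> f" and g: "Usm P \<sigma> A \<tau> g" and \<tau>: "usp \<tau>"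
  shows "Usm P \<sigma> A \<tau> (\<lambda>p x. f p x + g p x)"
proof -
  have "Usm P \<sigma> A \<tau> (\<lambda>p x. (\<lambda>u. ufst u + usnd u) (upair (f p x) (g p x)))"
    by (rule Usm.lin[OF Usm.pair[OF f g] \<tau>, of "\<lambda>u. ufst u + usnd u"];
      (intro continuous_map_usp[OF \<tau>] continuous_map_ufst continuous_map_usnd)?)
      (simp_all add: us.scale_right_distrib)
  then show ?thesis by simp
qed

lemma Usm_diff:
  assumes f: "Usm P \<sigma> A \<tau> f" and g: "Usm P \<sigma> A \<tau> g" and \<tau>: "usp \<tau>"
  shows "Usm P \<sigma> A \<tau> (\<lambda>p x. f p x - g p x)"
proof -
  have "Usm P \<sigma> A \<tau> (\<lambda>p x. (\<lambda>u. ufst u - usnd u) (upair (f p x) (g p x)))"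
    by (rule Usm.lin[OF Usm.pair[OF f g] \<tau>, of "\<lambda>u. ufst u - usnd u"];
      (intro continuous_map_usp[OF \<tau>] continuous_map_ufst continuous_map_usnd)?)
      (simp_all add: us.scale_right_diff_distrib)
  then show ?thesis by simp
qed

lemma Usm_proj:
  assumes "usp \<sigma>" "usp \<tau>" "openin (uprod \<sigma> \<tau>) B"
  shows "Usm P (uprod \<sigma> \<tau>) B \<sigma> (\<lambda>_. ufst)" "Usm P (uprod \<sigma> \<tau>) B \<tau> (\<lambda>_. usnd)"
  using assms by (auto intro!: Usm_lin_map usp_uprod continuous_map_ufst continuous_map_usnd)

text \<open>The projections are linear. The point \<open>x + t y\<close> is not, because of the
  product \<open>t y\<close>, and takes the rule \<open>smul\<close>.\<close>

lemma Usm_ubr: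
  assumes \<sigma>: "usp \<sigma>" and B: "openin (ubr \<sigma>) B"
  shows "Usm P (ubr \<sigma>) B \<sigma> (\<lambda>_. upnt)" "Usm P (ubr \<sigma>) B \<sigma> (\<lambda>_ u. udir u)"
    "Usm P (ubr \<sigma>) B uscalars (\<lambda>_ u. usnd (usnd u))" "Usm P (ubr \<sigma>) B \<sigma> (\<lambda>_. uline)"
proof -
  have c: "continuous_map (ubr \<sigma>) uscalars (\<lambda>u. usnd (usnd u))"
    using continuous_map_compose'[OF continuous_map_usnd continuous_map_usnd] .
  show 1: "Usm P (ubr \<sigma>) B \<sigma> (\<lambda>_. upnt)" and 2: "Usm P (ubr \<sigma>) B \<sigma> (\<lambda>_ u. udir u)"
    and 3: "Usm P (ubr \<sigma>) B uscalars (\<lambda>_ u. usnd (usnd u))"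
    using \<sigma> B by (auto intro!: Usm_lin_map usp_ubr usp_uscalars continuous_map_ubr c)
  show "Usm P (ubr \<sigma>) B \<sigma> (\<lambda>_. uline)"
    using Usm_add[OF 1 Usm.smul[OF 3 2] \<sigma>] by simp
qed

lemma Usm_ustep:
  assumes "Usm P \<sigma> A \<tau> f" "Usm P \<sigma> A \<tau> g" "Usm P \<sigma> A uscalars c"
  shows "Usm P \<sigma> A (ubr \<tau>) (\<lambda>p x. upair (f p x) (upair (g p x) (c p x)))"
  by (intro Usm.pair assms)

section \<open>Differentiation rules\<close>

lemma Useq_Suc:
  assumes "Useq P \<sigma> A \<tau> h"
  shows "Useq P (ubr \<sigma>) (ubset \<sigma> A) \<tau> (\<lambda>j. h (Suc j))" "dquot P \<sigma> A (h 0) (h (Suc 0))"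
proof -
  show "Useq P (ubr \<sigma>) (ubset \<sigma> A) \<tau> (\<lambda>j. h (Suc j))"
    unfolding Useq_def
  proof
    fix j
    have "kcont P (subtopology (ubrs (Suc j) \<sigma>) (ubsets \<sigma> A (Suc j))) \<tau> (h (Suc j)) \<and>
      dquot P (ubrs (Suc j) \<sigma>) (ubsets \<sigma> A (Suc j)) (h (Suc j)) (h (Suc (Suc j)))"
      using assms unfolding Useq_def by blast
    then show "kcont P (subtopology (ubrs j (ubr \<sigma>)) (ubsets (ubr \<sigma>) (ubset \<sigma> A) j)) \<tau> (h (Suc j)) \<and>
         dquot P (ubrs j (ubr \<sigma>)) (ubsets (ubr \<sigma>) (ubset \<sigma> A) j) (h (Suc j)) (h (Suc (Suc j)))"
      by (simp add: ubrs_shift ubsets_shift)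
  qed
  have "dquot P (ubrs 0 \<sigma>) (ubsets \<sigma> A 0) (h 0) (h (Suc 0))" using assms unfolding Useq_def by blast
  then show "dquot P \<sigma> A (h 0) (h (Suc 0))" by simp
qed

text \<open>With one of the two orders shifted, rule \<open>fam\<close> applies again, which keeps
  both summands in \<open>lift_fam\<close> inside \<open>Usm\<close>.\<close>

lemma Ufam_Suc:
  assumes "Ufam P \<sigma> A \<sigma>' A' \<tau> H"
  shows "Ufam P (ubr \<sigma>) (ubset \<sigma> A) \<sigma>' A' \<tau> (\<lambda>j. H (Suc j))"
    and "Ufam P \<sigma> A (ubr \<sigma>') (ubset \<sigma>' A') \<tau> (\<lambda>j l. H j (Suc l))"
proof -
  have "kcont P (prod_topology (subtopology (ubrs (Suc j) \<sigma>) (ubsets \<sigma> A (Suc j))) (subtopology (ubrs l \<sigma>') (ubsets \<sigma>' A' l))) \<tau>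
        (\<lambda>p (a, b). H (Suc j) l p a b)"
     "\<forall>b\<in>ubsets \<sigma>' A' l. dquot P (ubrs (Suc j) \<sigma>) (ubsets \<sigma> A (Suc j)) (\<lambda>p a. H (Suc j) l p a b) (\<lambda>p a. H (Suc (Suc j)) l p a b)"
     "\<forall>a\<in>ubsets \<sigma> A (Suc j). dquot P (ubrs l \<sigma>') (ubsets \<sigma>' A' l) (\<lambda>p. H (Suc j) l p a) (\<lambda>p. H (Suc j) (Suc l) p a)"
     "kcont P (prod_topology (subtopology (ubrs j \<sigma>) (ubsets \<sigma> A j)) (subtopology (ubrs (Suc l) \<sigma>') (ubsets \<sigma>' A' (Suc l)))) \<tau>
        (\<lambda>p (a, b). H j (Suc l) p a b)"
     "\<forall>b\<in>ubsets \<sigma>' A' (Suc l). dquot P (ubrs j \<sigma>) (ubsets \<sigma> A j) (\<lambda>p a. H j (Suc l) p a b) (\<lambda>p a. H (Suc j) (Suc l) p a b)"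
     "\<forall>a\<in>ubsets \<sigma> A j. dquot P (ubrs (Suc l) \<sigma>') (ubsets \<sigma>' A' (Suc l)) (\<lambda>p. H j (Suc l) p a) (\<lambda>p. H j (Suc (Suc l)) p a)"
     for j l
    using assms unfolding Ufam_def by blast+
  then show "Ufam P (ubr \<sigma>) (ubset \<sigma> A) \<sigma>' A' \<tau> (\<lambda>j. H (Suc j))"
    "Ufam P \<sigma> A (ubr \<sigma>') (ubset \<sigma>' A') \<tau> (\<lambda>j l. H j (Suc l))"
    unfolding Ufam_def by (simp_all add: ubrs_shift ubsets_shift)
qed

text \<open>The increment from \<open>(x, y)\<close> to \<open>(x + t x', y + t y')\<close> is split
  at \<open>(x, y + t y')\<close>, so that only one variable moves at a time. Each part is
  \<open>t\<close> times a partial difference quotient taken along a map that does not depend on the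
  parameter in \<open>P\<close>.\<close>

lemma lift_fam:
  assumes sp: "usp \<sigma>" "usp \<sigma>'" "usp \<tau>" and A: "openin \<sigma> A" "openin \<sigma>' A'" and H: "Ufam P \<sigma> A \<sigma>' A' \<tau> H"
    and Pne: "topspace P \<noteq> {}"
  defines "S \<equiv> {u \<in> topspace (uprod \<sigma> \<sigma>'). ufst u \<in> A \<and> usnd u \<in> A'}"
  shows "\<exists>h. Usm P (ubr (uprod \<sigma> \<sigma>')) (ubset (uprod \<sigma> \<sigma>') S) \<tau> h \<and>
     dquot P (uprod \<sigma> \<sigma>') S (\<lambda>p u. H 0 0 p (ufst u) (usnd u)) h"
proof -
  let ?\<rho> = "uprod \<sigma> \<sigma>'"
  have \<rho>: "usp ?\<rho>" using sp usp_uprod by blast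
  have "Usm P ?\<rho> S \<tau> (\<lambda>p u. H 0 0 p (ufst u) (usnd u))"
    unfolding S_def by (rule Usm.fam[OF sp A H])
  then have S: "openin ?\<rho> S" using Usm_basics Pne by blast
  let ?B = "ubset ?\<rho> S"
  have B: "openin (ubr ?\<rho>) ?B" by (rule openin_ubset[OF \<rho> S])
  note br = Usm_ubr[OF \<rho> B, of P]
  have proj: "Usm P (ubr ?\<rho>) ?B \<sigma> (\<lambda>p u. ufst (f u))" "Usm P (ubr ?\<rho>) ?B \<sigma>' (\<lambda>p u. usnd (f u))"
    if "Usm P (ubr ?\<rho>) ?B ?\<rho> (\<lambda>_. f)" for f
    using Usm.lin[OF that sp(1) continuous_map_ufst] Usm.lin[OF that sp(2) continuous_map_usnd] by simp_all
  \<comment> \<open>For \<open>z = ((x, y), (x', y'), t)\<close> these are the arguments of the two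
    partial quotients: \<open>((x, x', t), y + t y')\<close> for \<open>H (Suc 0) 0\<close> and
    \<open>(x, (y, y', t))\<close> for \<open>H 0 (Suc 0)\<close>.\<close>
  define \<phi> where "\<phi> z = upair (ustep (ufst (upnt z)) (ufst (udir z)) (upar z)) (usnd (uline z))" for z :: "('b, 'k) un"
  define \<psi> where "\<psi> z = upair (ufst (upnt z)) (ustep (usnd (upnt z)) (usnd (udir z)) (upar z))" for z :: "('b, 'k) un"
  \<comment> \<open>\<open>Usm_ustep\<close> yields the scalar entry as the subtree
    \<open>usnd (usnd z)\<close>; at a point of the bracket set this subtree is
    \<open>uscal (upar z)\<close>.\<close>
  have sc: "upair a (upair b (usnd (usnd z))) = ustep a b (upar z)" if "z \<in> ?B" for z a b
    using that by (auto simp: ubset_def topspace_ubr)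
  have "Usm P (ubr ?\<rho>) ?B (uprod (ubr \<sigma>) \<sigma>')
      (\<lambda>_ z. upair (upair (ufst (upnt z)) (upair (ufst (udir z)) (usnd (usnd z)))) (usnd (uline z)))"
    by (intro Usm.pair Usm_ustep br proj)
  then have \<phi>: "Usm P (ubr ?\<rho>) ?B (uprod (ubr \<sigma>) \<sigma>') (\<lambda>_. \<phi>)"
    by (rule Usm.congr) (simp add: \<phi>_def sc)
  have "Usm P (ubr ?\<rho>) ?B (uprod \<sigma> (ubr \<sigma>'))
      (\<lambda>_ z. upair (ufst (upnt z)) (upair (usnd (upnt z)) (upair (usnd (udir z)) (usnd (usnd z)))))"
    by (intro Usm.pair Usm_ustep br proj)
  then have \<psi>: "Usm P (ubr ?\<rho>) ?B (uprod \<sigma> (ubr \<sigma>')) (\<lambda>_. \<psi>)"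
    by (rule Usm.congr) (simp add: \<psi>_def sc)
  have f1: "Usm P (uprod (ubr \<sigma>) \<sigma>') {u \<in> topspace (uprod (ubr \<sigma>) \<sigma>'). ufst u \<in> ubset \<sigma> A \<and> usnd u \<in> A'} \<tau>
      (\<lambda>p u. H (Suc 0) 0 p (ufst u) (usnd u))"
    using Usm.fam[OF usp_ubr[OF sp(1)] sp(2,3) openin_ubset[OF sp(1) A(1)] A(2) Ufam_Suc(1)[OF H]] .
  have f2: "Usm P (uprod \<sigma> (ubr \<sigma>')) {u \<in> topspace (uprod \<sigma> (ubr \<sigma>')). ufst u \<in> A \<and> usnd u \<in> ubset \<sigma>' A'} \<tau>
      (\<lambda>p u. H 0 (Suc 0) p (ufst u) (usnd u))"
    using Usm.fam[OF sp(1) usp_ubr[OF sp(2)] sp(3) A(1) openin_ubset[OF sp(2) A(2)] Ufam_Suc(2)[OF H]] .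
  have dest: "ustep (ufst (upnt z)) (ufst (udir z)) (upar z) \<in> ubset \<sigma> A"
     "ustep (usnd (upnt z)) (usnd (udir z)) (upar z) \<in> ubset \<sigma>' A'" "usnd (uline z) \<in> A'" "ufst (upnt z) \<in> A"
     if "z \<in> ?B" for z
    using ubset_dest[OF that] by (auto simp: ustep_in_ubset S_def topspace_uprod)
  have sub: "A \<subseteq> topspace \<sigma>" "A' \<subseteq> topspace \<sigma>'" "ubset \<sigma> A \<subseteq> topspace (ubr \<sigma>)" "ubset \<sigma>' A' \<subseteq> topspace (ubr \<sigma>')"
    using A openin_subset by (auto simp: ubset_def)
  have im1: "\<phi> ` ?B \<subseteq> {u \<in> topspace (uprod (ubr \<sigma>) \<sigma>'). ufst u \<in> ubset \<sigma> A \<and> usnd u \<in> A'}"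
  proof (rule image_subsetI)
    fix z assume "z \<in> ?B"
    from dest[OF this] sub show "\<phi> z \<in> {u \<in> topspace (uprod (ubr \<sigma>) \<sigma>'). ufst u \<in> ubset \<sigma> A \<and> usnd u \<in> A'}"
      unfolding \<phi>_def topspace_uprod[of _ \<sigma>'] by (simp add: image_iff) blast
  qed
  have im2: "\<psi> ` ?B \<subseteq> {u \<in> topspace (uprod \<sigma> (ubr \<sigma>')). ufst u \<in> A \<and> usnd u \<in> ubset \<sigma>' A'}"
  proof (rule image_subsetI)
    fix z assume "z \<in> ?B"
    from dest[OF this] sub show "\<psi> z \<in> {u \<in> topspace (uprod \<sigma> (ubr \<sigma>')). ufst u \<in> A \<and> usnd u \<in> ubset \<sigma>' A'}"
      unfolding \<psi>_def topspace_uprod[of \<sigma>] by (simp add: image_iff) blast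
  qed
  define h where "h p z = H (Suc 0) 0 p (ustep (ufst (upnt z)) (ufst (udir z)) (upar z)) (usnd (uline z)) +
     H 0 (Suc 0) p (ufst (upnt z)) (ustep (usnd (upnt z)) (usnd (udir z)) (upar z))" for p z
  have "Usm P (ubr ?\<rho>) ?B \<tau> (\<lambda>p z. (\<lambda>u. H (Suc 0) 0 p (ufst u) (usnd u)) (\<phi> z) + (\<lambda>u. H 0 (Suc 0) p (ufst u) (usnd u)) (\<psi> z))"
    by (rule Usm_add[OF Usm.comp[OF f1 \<phi> im1] Usm.comp[OF f2 \<psi> im2] sp(3)])
  then have 1: "Usm P (ubr ?\<rho>) ?B \<tau> h" unfolding h_def by (simp add: \<phi>_def \<psi>_def)
  have d1: "dquot P \<sigma> A (\<lambda>p a. H 0 0 p a b) (\<lambda>p a. H (Suc 0) 0 p a b)" if "b \<in> A'" for b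
    using H[unfolded Ufam_def, THEN conjunct2, THEN conjunct1, rule_format, of b 0 0] that by simp
  have d2: "dquot P \<sigma>' A' (\<lambda>p. H 0 0 p a) (\<lambda>p. H 0 (Suc 0) p a)" if "a \<in> A" for a
    using H[unfolded Ufam_def, THEN conjunct2, THEN conjunct2, rule_format, of a 0 0] that by simp
  have "dquot P ?\<rho> S (\<lambda>p u. H 0 0 p (ufst u) (usnd u)) h"
    unfolding dquot_def
  proof (intro ballI)
    fix p z assume p: "p \<in> topspace P" and z: "z \<in> ?B"
    note d = dest[OF z]
    have "us (upar z) (H (Suc 0) 0 p (ustep (ufst (upnt z)) (ufst (udir z)) (upar z)) (usnd (uline z))) =
      H 0 0 p (ufst (uline z)) (usnd (uline z)) - H 0 0 p (ufst (upnt z)) (usnd (uline z))"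
      using d1[OF d(3), unfolded dquot_def, rule_format, OF p d(1)] by simp
    moreover have "us (upar z) (H 0 (Suc 0) p (ufst (upnt z)) (ustep (usnd (upnt z)) (usnd (udir z)) (upar z))) =
      H 0 0 p (ufst (upnt z)) (usnd (uline z)) - H 0 0 p (ufst (upnt z)) (usnd (upnt z))"
      using d2[OF d(4), unfolded dquot_def, rule_format, OF p d(2)] by simp
    ultimately show "us (upar z) (h p z) = H 0 0 p (ufst (uline z)) (usnd (uline z)) - H 0 0 p (ufst (upnt z)) (usnd (upnt z))"
      unfolding h_def by (simp add: us.scale_right_distrib)
  qed
  with 1 show ?thesis by blast
qed

text \<open>Chain rule: the quotient of the composite at \<open>(x, y, t)\<close> is the quotient of
  \<open>f\<close> at \<open>(\<phi> x, h, t)\<close>, where \<open>h\<close> is the quotient of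
  \<open>\<phi>\<close>. This point is admissible because
  \<open>\<phi> x + t h = \<phi> (x + t y)\<close>.\<close>

lemma lift_comp:
  assumes f: "Usm P \<sigma> A \<tau> f" and \<phi>: "Usm P \<rho> B \<sigma> (\<lambda>_. \<phi>)" and im: "\<phi> ` B \<subseteq> A" and Pne: "topspace P \<noteq> {}"
    and hf: "Usm P (ubr \<sigma>) (ubset \<sigma> A) \<tau> hf" "dquot P \<sigma> A f hf"
    and h\<phi>: "Usm P (ubr \<rho>) (ubset \<rho> B) \<sigma> h\<phi>" "dquot P \<rho> B (\<lambda>_. \<phi>) h\<phi>"
  shows "\<exists>h. Usm P (ubr \<rho>) (ubset \<rho> B) \<tau> h \<and> dquot P \<rho> B (\<lambda>p x. f p (\<phi> x)) h"
proof -
  obtain p0 where p0: "p0 \<in> topspace P" using Pne by blast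
  note bf = Usm_basics[OF f Pne] and b\<phi> = Usm_basics[OF \<phi> Pne]
  have \<rho>: "usp \<rho>" and B: "openin \<rho> B" and \<sigma>: "usp \<sigma>" using b\<phi> by auto
  let ?B = "ubset \<rho> B"
  have oB: "openin (ubr \<rho>) ?B" by (rule openin_ubset[OF \<rho> B])
  have kh: "kcont P (subtopology (ubr \<rho>) ?B) \<sigma> h\<phi>" using Usm_basics[OF h\<phi>(1) Pne] by blast
  have top: "topspace (subtopology (ubr \<rho>) ?B) = ?B" by (auto simp: ubset_def)
  define \<psi> where "\<psi> z = ustep (\<phi> (upnt z)) (h\<phi> p0 z) (upar z)" for z
  have sc: "upair a (upair b (usnd (usnd z))) = ustep a b (upar z)" if "z \<in> ?B" for z a b
    using that by (auto simp: ubset_def topspace_ubr)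
  have "Usm P (ubr \<rho>) ?B \<sigma> (\<lambda>_ z. \<phi> (upnt z))"
    by (rule Usm.comp[OF \<phi> Usm_ubr(1)[OF \<rho> oB]]) (auto simp: ubset_def)
  \<comment> \<open>The quotient \<open>h\<phi>\<close> may depend on the parameter although
    \<open>\<phi>\<close> does not; freezing it at \<open>p0\<close> makes it admissible in an inner
    map. This is the purpose of the rule \<open>freeze\<close>.\<close>
  from Usm_ustep[OF this Usm.freeze[OF h\<phi>(1) p0] Usm_ubr(3)[OF \<rho> oB]]
  have \<psi>: "Usm P (ubr \<rho>) ?B (ubr \<sigma>) (\<lambda>_. \<psi>)"
    by (rule Usm.congr) (simp add: \<psi>_def sc)
  have line: "us (upar z) (h\<phi> p0 z) = \<phi> (uline z) - \<phi> (upnt z)" if "z \<in> ?B" for z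
    using h\<phi>(2) p0 that unfolding dquot_def by blast
  then have line': "\<phi> (upnt z) + us (upar z) (h\<phi> p0 z) = \<phi> (uline z)" if "z \<in> ?B" for z
    using that by simp
  have im2: "\<psi> ` ?B \<subseteq> ubset \<sigma> A"
  proof (rule image_subsetI)
    fix z assume z: "z \<in> ?B"
    have "h\<phi> p0 z \<in> topspace \<sigma>" using kcont_maps[OF kh p0] top z by blast
    moreover have "\<phi> (upnt z) \<in> A" "\<phi> (uline z) \<in> A" using im ubset_dest[OF z] by auto
    moreover have "A \<subseteq> topspace \<sigma>" using bf openin_subset by blast
    ultimately show "\<psi> z \<in> ubset \<sigma> A"
      unfolding \<psi>_def ustep_in_ubset using line'[OF z] by auto
  qed
  have "Usm P (ubr \<rho>) ?B \<tau> (\<lambda>p z. hf p (\<psi> z))" by (rule Usm.comp[OF hf(1) \<psi> im2])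
  moreover have "dquot P \<rho> B (\<lambda>p x. f p (\<phi> x)) (\<lambda>p z. hf p (\<psi> z))"
    unfolding dquot_def
  proof (intro ballI)
    fix p z assume p: "p \<in> topspace P" and z: "z \<in> ?B"
    have "\<psi> z \<in> ubset \<sigma> A" using im2 z by blast
    then have "us (upar (\<psi> z)) (hf p (\<psi> z)) = f p (uline (\<psi> z)) - f p (upnt (\<psi> z))"
      using hf(2) p unfolding dquot_def by blast
    then show "us (upar z) (hf p (\<psi> z)) = f p (\<phi> (uline z)) - f p (\<phi> (upnt z))"
      using line'[OF z] by (simp add: \<psi>_def)
  qed
  ultimately show ?thesis by blast
qed

lemma Usm_uline_comp:
  assumes "Usm P \<sigma> A \<tau> f" "usp \<sigma>" "openin \<sigma> A" "openin (ubr \<sigma>) B"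
  shows "(\<And>u. u \<in> B \<Longrightarrow> upnt u \<in> A) \<Longrightarrow> Usm P (ubr \<sigma>) B \<tau> (\<lambda>p u. f p (upnt u))"
    and "(\<And>u. u \<in> B \<Longrightarrow> uline u \<in> A) \<Longrightarrow> Usm P (ubr \<sigma>) B \<tau> (\<lambda>p u. f p (uline u))"
  by (rule Usm.comp[OF assms(1) Usm_ubr(1)[OF assms(2,4)]]; auto)
     (rule Usm.comp[OF assms(1) Usm_ubr(4)[OF assms(2,4)]]; auto)

text \<open>Product rule: the increment of \<open>c f\<close> is the increment of \<open>c\<close>
  times the value of \<open>f\<close> at the end point, plus the value of \<open>c\<close> at the
  starting point times the increment of \<open>f\<close>.\<close>

lemma lift_smul:
  assumes c: "Usm P \<sigma> A uscalars c" and f: "Usm P \<sigma> A \<tau> f" and Pne: "topspace P \<noteq> {}"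
    and hc: "Usm P (ubr \<sigma>) (ubset \<sigma> A) uscalars hc" "dquot P \<sigma> A c hc"
    and hf: "Usm P (ubr \<sigma>) (ubset \<sigma> A) \<tau> hf" "dquot P \<sigma> A f hf"
  shows "\<exists>h. Usm P (ubr \<sigma>) (ubset \<sigma> A) \<tau> h \<and> dquot P \<sigma> A (\<lambda>p x. us (uscal_of (c p x)) (f p x)) h"
proof -
  have \<sigma>: "usp \<sigma>" and A: "openin \<sigma> A" and \<tau>: "usp \<tau>" using Usm_basics[OF f Pne] by auto
  have B: "openin (ubr \<sigma>) (ubset \<sigma> A)" by (rule openin_ubset[OF \<sigma> A])
  let ?h = "\<lambda>p z. us (uscal_of (hc p z)) (f p (uline z)) + us (uscal_of (c p (upnt z))) (hf p z)"
  have "Usm P (ubr \<sigma>) (ubset \<sigma> A) \<tau> ?h"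
    by (intro Usm_add[OF _ _ \<tau>] Usm.smul hc hf Usm_uline_comp[OF f \<sigma> A B] Usm_uline_comp[OF c \<sigma> A B])
      (auto simp: ubset_def)
  moreover have "dquot P \<sigma> A (\<lambda>p x. us (uscal_of (c p x)) (f p x)) ?h"
    unfolding dquot_def
  proof (intro ballI)
    fix p z assume pz: "p \<in> topspace P" "z \<in> ubset \<sigma> A"
    have 1: "us (upar z) (hc p z) = c p (uline z) - c p (upnt z)" and 2: "us (upar z) (hf p z) = f p (uline z) - f p (upnt z)"
      using hc(2) hf(2) pz unfolding dquot_def by blast+
    have "uscal_of (us (upar z) (hc p z)) = uscal_of (c p (uline z) - c p (upnt z))" using 1 by (rule arg_cong)
    then have 3: "upar z * uscal_of (hc p z) = uscal_of (c p (uline z)) - uscal_of (c p (upnt z))" by simp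
    have "us (upar z) (?h p z) = us (upar z * uscal_of (hc p z)) (f p (uline z)) + us (uscal_of (c p (upnt z))) (us (upar z) (hf p z))"
      by (simp add: us.scale_right_distrib mult.commute)
    also have "\<dots> = us (uscal_of (c p (uline z))) (f p (uline z)) - us (uscal_of (c p (upnt z))) (f p (upnt z))"
      unfolding 2 3 by (simp add: us.scale_left_diff_distrib us.scale_right_diff_distrib)
    finally show "us (upar z) (?h p z) = us (uscal_of (c p (uline z))) (f p (uline z)) - us (uscal_of (c p (upnt z))) (f p (upnt z))" .
  qed
  ultimately show ?thesis by blast
qed

text \<open>From \<open>1/s - 1/r = - (s - r) / (s r)\<close>, with \<open>s\<close> and
  \<open>r\<close> the values of \<open>c\<close> at the end point and at the starting point. Both
  factors \<open>1/s\<close> and \<open>1/r\<close> are again obtained by the rule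
  \<open>inv\<close>, so the quotient stays in \<open>Usm\<close>.\<close>

lemma lift_inv:
  assumes c: "Usm P \<sigma> A uscalars c" and Pne: "topspace P \<noteq> {}"
    and nz: "\<forall>p\<in>topspace P. \<forall>x\<in>A. uscal_of (c p x) \<noteq> 0"
    and hc: "Usm P (ubr \<sigma>) (ubset \<sigma> A) uscalars hc" "dquot P \<sigma> A c hc"
  shows "\<exists>h. Usm P (ubr \<sigma>) (ubset \<sigma> A) uscalars h \<and> dquot P \<sigma> A (\<lambda>p x. uscal (inverse (uscal_of (c p x)))) h"
proof -
  have \<sigma>: "usp \<sigma>" and A: "openin \<sigma> A" using Usm_basics[OF c Pne] by auto
  have B: "openin (ubr \<sigma>) (ubset \<sigma> A)" by (rule openin_ubset[OF \<sigma> A])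
  note ci = Usm.inv[OF c nz]
  let ?i = "\<lambda>p x. uscal (inverse (uscal_of (c p x))) :: ('b, 'k) un"
  let ?h = "\<lambda>p z. us (uscal_of (?i p (uline z))) (us (uscal_of (?i p (upnt z))) (0 - hc p z))"
  have 0: "Usm P (ubr \<sigma>) (ubset \<sigma> A) uscalars (\<lambda>p z. 0)"
    by (intro Usm.param usp_ubr \<sigma> B usp_uscalars) (simp add: uspD(2)[OF usp_uscalars])
  have "Usm P (ubr \<sigma>) (ubset \<sigma> A) uscalars ?h"
    by (intro Usm.smul Usm_uline_comp[OF ci \<sigma> A B] Usm_diff[OF 0] hc usp_uscalars) (auto simp: ubset_def)
  moreover have "dquot P \<sigma> A ?i ?h"
    unfolding dquot_def
  proof (intro ballI)
    fix p z assume pz: "p \<in> topspace P" "z \<in> ubset \<sigma> A"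
    have 1: "us (upar z) (hc p z) = c p (uline z) - c p (upnt z)"
      using hc(2) pz unfolding dquot_def by blast
    have "hc p z \<in> range uscal" "c p (uline z) \<in> range uscal" "c p (upnt z) \<in> range uscal"
      using kcont_maps[of P "subtopology (ubr \<sigma>) (ubset \<sigma> A)" uscalars hc]
        kcont_maps[of P "subtopology \<sigma> A" uscalars c] Usm_basics[OF hc(1) Pne] Usm_basics[OF c Pne] pz
        ubset_dest[OF pz(2)] openin_subset[OF A]
      by (auto simp: topspace_uscalars ubset_def)
    then obtain r s t where rst: "hc p z = uscal r" "c p (uline z) = uscal s" "c p (upnt z) = uscal t" by blast
    have "uscal (upar z * r) = (uscal (s - t) :: ('b, 'k) un)" using 1 rst by (simp add: us_constr uscal_add)
    then have 2: "upar z * r = s - t" by (metis un_inverse(2))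
    have nz': "s \<noteq> 0" "t \<noteq> 0" using nz pz ubset_dest[OF pz(2)] rst by (metis un_inverse(2))+
    have 0: "(0 :: ('b, 'k) un) = uscal 0" by (simp add: uscal_def fun_eq_iff zero_prod_def)
    have 3: "upar z * (inverse s * (inverse t * (0 - r))) = inverse s - inverse t"
    proof -
      have "upar z * (inverse s * (inverse t * (0 - r))) = - (inverse s * inverse t * (upar z * r))"
        by (simp add: algebra_simps)
      also have "\<dots> = inverse s - inverse t" unfolding 2 using nz' by (simp add: field_simps)
      finally show ?thesis .
    qed
    have 4: "us (upar z) (us (inverse s) (us (inverse t) (0 - uscal r))) = uscal (upar z * (inverse s * (inverse t * (0 - r))))"
      by (simp only: us_constr 0 flip: uscal_add)
    show "us (upar z) (?h p z) = ?i p (uline z) - ?i p (upnt z)"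
      by (simp only: 4 3 rst un_inverse uscal_add)
  qed
  ultimately show ?thesis by blast
qed

text \<open>The sets \<open>ubset \<sigma> B\<close> do not cover the bracket set of the union,
  because the ends \<open>x\<close> and \<open>x + t y\<close> may lie in different members. Where
  this happens \<open>t\<close> is nonzero, and on the open set \<open>N B B'\<close> the quotient
  is given by the explicit formula with \<open>inverse t\<close>, which is in \<open>Usm\<close> by
  \<open>inv\<close> and \<open>smul\<close>. On the overlaps all these quotients agree by
  uniqueness.\<close>

lemma lift_cover:
  assumes \<sigma>: "usp \<sigma>" and \<tau>: "usp \<tau>" and \<B>: "\<And>B. B \<in> \<B> \<Longrightarrow> openin \<sigma> B" and f: "\<And>B. B \<in> \<B> \<Longrightarrow> Usm P \<sigma> B \<tau> f"
    and h: "\<And>B. B \<in> \<B> \<Longrightarrow> Usm P (ubr \<sigma>) (ubset \<sigma> B) \<tau> (hB B) \<and> dquot P \<sigma> B f (hB B)"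
    and Pne: "topspace P \<noteq> {}"
  shows "\<exists>h. Usm P (ubr \<sigma>) (ubset \<sigma> (\<Union>\<B>)) \<tau> h \<and> dquot P \<sigma> (\<Union>\<B>) f h"
proof -
  \<comment> \<open>The choice matters only at parameter \<open>0\<close>; \<open>eqB\<close> shows
    that the value there is the same for every admissible member.\<close>
  define ch where "ch u = (SOME B. B \<in> \<B> \<and> upnt u \<in> B)" for u
  define q where "q p u = us (inverse (upar u)) (f p (uline u) - f p (upnt u))" for p u
  define h where "h p u = (if upar u = 0 then hB (ch u) p u else q p u)" for p u
  define N where "N B B' = {u \<in> topspace (ubr \<sigma>). upnt u \<in> B \<and> uline u \<in> B' \<and> upar u \<noteq> 0}" for B B'
  define \<C> where "\<C> = (ubset \<sigma> ` \<B>) \<union> {N B B' | B B'. B \<in> \<B> \<and> B' \<in> \<B>}"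
  have oN: "openin (ubr \<sigma>) (N B B')" if "B \<in> \<B>" "B' \<in> \<B>" for B B'
  proof -
    have "openin (ubr \<sigma>) ({u \<in> topspace (ubr \<sigma>). upnt u \<in> B} \<inter> {u \<in> topspace (ubr \<sigma>). uline u \<in> B'} \<inter>
        {u \<in> topspace (ubr \<sigma>). upar u \<in> - {0}})"
      by (intro openin_Int openin_continuous_map_preimage[OF continuous_map_ubr(1) \<B>[OF that(1)]]
          openin_continuous_map_preimage[OF continuous_map_uline[OF \<sigma>] \<B>[OF that(2)]]
          openin_continuous_map_preimage[OF continuous_map_ubr(3)]) auto
    also have "\<dots> = N B B'" by (auto simp: N_def)
    finally show ?thesis .
  qed
  have oB: "openin (ubr \<sigma>) (ubset \<sigma> B)" if "B \<in> \<B>" for B using openin_ubset[OF \<sigma> \<B>[OF that]] .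
  have chB: "ch u \<in> \<B> \<and> upnt u \<in> ch u" if "u \<in> ubset \<sigma> B" "B \<in> \<B>" for u B
    unfolding ch_def by (rule someI[of _ B]) (use that in \<open>auto simp: ubset_def\<close>)
  have dq: "us (upar u) (hB B p u) = f p (uline u) - f p (upnt u)"
    if "B \<in> \<B>" "p \<in> topspace P" "u \<in> ubset \<sigma> B" for B p u
    using h[OF that(1)] that unfolding dquot_def by blast
  have dq': "hB B p u = q p u" if "B \<in> \<B>" "p \<in> topspace P" "u \<in> ubset \<sigma> B" "upar u \<noteq> 0" for B p u
    unfolding q_def using that by (simp flip: dq[OF that(1-3)])
  have eqB: "hB B p u = h p u" if B: "B \<in> \<B>" and p: "p \<in> topspace P" and u: "u \<in> ubset \<sigma> B" for B p u
  proof (cases "upar u = 0")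
    case False
    then show ?thesis using dq'[OF B p u] by (simp add: h_def)
  next
    case True
    let ?B' = "ch u"
    have B': "?B' \<in> \<B>" "upnt u \<in> ?B'" using chB[OF u B] by auto
    have cont: "continuous_map (subtopology (ubr \<sigma>) (ubset \<sigma> (B \<inter> ?B'))) \<tau> (hB B2 p)"
      if B2: "B2 \<in> \<B>" "B \<inter> ?B' \<subseteq> B2" for B2
    proof -
      have "kcont P (subtopology (ubr \<sigma>) (ubset \<sigma> B2)) \<tau> (hB B2)" using h[OF B2(1)] Usm_basics Pne by blast
      from kcont_slice[OF this p] show ?thesis
        by (rule continuous_map_from_subtopology_mono) (use B2 in \<open>auto simp: ubset_def\<close>)
    qed
    \<comment> \<open>Over the intersection of the two members both quotients are continuous and
      equal the explicit one for nonzero parameters; uniqueness extends the equality to parameter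
      \<open>0\<close>.\<close>
    have "hB B p u = hB ?B' p u"
    proof (rule dquot_unique[OF \<sigma> \<tau> openin_Int[OF \<B>[OF B] \<B>[OF B'(1)]] cont[OF B] cont[OF B'(1)]])
      show "u \<in> ubset \<sigma> (B \<inter> ?B')" using u B'(2) True by (auto simp: ubset_def)
      fix v assume "v \<in> ubset \<sigma> (B \<inter> ?B')" "upar v \<noteq> 0"
      then show "hB B p v = hB ?B' p v"
        using dq'[OF B p, of v] dq'[OF B'(1) p, of v] by (auto simp: ubset_def)
    qed auto
    then show ?thesis using True by (simp add: h_def)
  qed
  have SB: "Usm P (ubr \<sigma>) (ubset \<sigma> B) \<tau> h" if "B \<in> \<B>" for B
    using h[OF that] eqB[OF that] by (blast intro: Usm.congr)
  have SN: "Usm P (ubr \<sigma>) (N B B') \<tau> h" if B: "B \<in> \<B>" "B' \<in> \<B>" for B B'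
  proof -
    note o = oN[OF B]
    have i: "Usm P (ubr \<sigma>) (N B B') uscalars (\<lambda>p u. uscal (inverse (upar u)))"
      by (rule Usm.inv[OF Usm_ubr(3)[OF \<sigma> o]]) (auto simp: N_def)
    have 1: "Usm P (ubr \<sigma>) (N B B') \<tau> (\<lambda>p u. f p (upnt u))"
      by (rule Usm_uline_comp(1)[OF f[OF B(1)] \<sigma> \<B>[OF B(1)] o]) (simp add: N_def)
    have 2: "Usm P (ubr \<sigma>) (N B B') \<tau> (\<lambda>p u. f p (uline u))"
      by (rule Usm_uline_comp(2)[OF f[OF B(2)] \<sigma> \<B>[OF B(2)] o]) (simp add: N_def)
    from Usm.smul[OF i Usm_diff[OF 2 1 \<tau>]] show ?thesis
      by (rule Usm.congr) (auto simp: N_def h_def q_def)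
  qed
  have "\<Union>\<C> = ubset \<sigma> (\<Union>\<B>)"
  proof (intro equalityI subsetI)
    fix u assume u: "u \<in> ubset \<sigma> (\<Union>\<B>)"
    then obtain B B' where "B \<in> \<B>" "B' \<in> \<B>" "upnt u \<in> B" "uline u \<in> B'" by (auto simp: ubset_def)
    moreover have "u \<in> topspace (ubr \<sigma>)" using u by (auto simp: ubset_def)
    \<comment> \<open>If the parameter vanishes, \<open>uline u\<close> equals
      \<open>upnt u\<close>, and both ends lie in \<open>B\<close>.\<close>
    ultimately have "u \<in> N B B' \<or> u \<in> ubset \<sigma> B" by (auto simp: N_def ubset_def)
    then show "u \<in> \<Union>\<C>" using \<open>B \<in> \<B>\<close> \<open>B' \<in> \<B>\<close> by (auto simp: \<C>_def)
  qed (auto simp: \<C>_def ubset_def N_def)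
  moreover have "Usm P (ubr \<sigma>) (\<Union>\<C>) \<tau> h"
    by (rule Usm.cover[OF usp_ubr[OF \<sigma>] \<tau>]) (use SB SN oB oN in \<open>auto simp: \<C>_def\<close>)
  moreover have "dquot P \<sigma> (\<Union>\<B>) f h"
    unfolding dquot_def
  proof (intro ballI)
    fix p u assume p: "p \<in> topspace P" and u: "u \<in> ubset \<sigma> (\<Union>\<B>)"
    show "us (upar u) (h p u) = f p (uline u) - f p (upnt u)"
      by (cases "upar u = 0") (simp_all add: h_def q_def)
  qed
  ultimately show ?thesis by metis
qed

text \<open>The property for which \<open>Usm\<close> is designed. Freezing, pairing and linear maps
  commute with difference quotients, the identity has the direction as its quotient, and constants
  have \<open>0\<close>; the other rules have their own lemmas above.\<close>

lemma Usm_lift: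
  assumes "Usm P \<sigma> A \<tau> f" "topspace P \<noteq> {}"
  shows "\<exists>h. Usm P (ubr \<sigma>) (ubset \<sigma> A) \<tau> h \<and> dquot P \<sigma> A f h"
  using assms
proof (induction rule: Usm.induct)
  case (seq \<sigma> \<tau> A h)
  then show ?case
    using Usm.seq[OF usp_ubr[OF seq(1)] seq(2) openin_ubset[OF seq(1,3)] Useq_Suc(1)[OF seq(4)]] Useq_Suc(2)[OF seq(4)] by blast
next
  case (fam \<sigma> \<sigma>' \<tau> A A' H)
  then show ?case using lift_fam by blast
next
  case (comp \<sigma> A \<tau> f \<rho> B \<phi>)
  obtain hf h\<phi> where "Usm P (ubr \<sigma>) (ubset \<sigma> A) \<tau> hf" "dquot P \<sigma> A f hf"
    "Usm P (ubr \<rho>) (ubset \<rho> B) \<sigma> h\<phi>" "dquot P \<rho> B (\<lambda>_. \<phi>) h\<phi>"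
    using comp.IH comp.prems by blast
  then show ?case by (rule lift_comp[OF comp.hyps(1,2) comp.hyps(3) comp.prems])
next
  case (freeze \<sigma> A \<tau> f p0)
  then obtain h where h: "Usm P (ubr \<sigma>) (ubset \<sigma> A) \<tau> h" "dquot P \<sigma> A f h" by blast
  have "dquot P \<sigma> A (\<lambda>_. f p0) (\<lambda>_. h p0)" using h(2) freeze(2) unfolding dquot_def by blast
  then show ?case using Usm.freeze[OF h(1) freeze(2)] by blast
next
  case (congr \<sigma> A \<tau> f g)
  then obtain h where h: "Usm P (ubr \<sigma>) (ubset \<sigma> A) \<tau> h" "dquot P \<sigma> A f h" by blast
  have "dquot P \<sigma> A g h" using h(2) congr(2) unfolding dquot_def by (auto simp: ubset_def)
  then show ?case using h by blast
next
  case (pair \<sigma> A \<tau> f \<tau>' g)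
  then obtain h h' where h: "Usm P (ubr \<sigma>) (ubset \<sigma> A) \<tau> h" "dquot P \<sigma> A f h"
    "Usm P (ubr \<sigma>) (ubset \<sigma> A) \<tau>' h'" "dquot P \<sigma> A g h'" by blast
  have "dquot P \<sigma> A (\<lambda>p x. upair (f p x) (g p x)) (\<lambda>p x. upair (h p x) (h' p x))"
    using h(2,4) unfolding dquot_def by (simp add: us_constr upair_add)
  then show ?case using Usm.pair[OF h(1,3)] by blast
next
  case (lin \<sigma> A \<tau> f \<tau>' L)
  then obtain h where h: "Usm P (ubr \<sigma>) (ubset \<sigma> A) \<tau> h" "dquot P \<sigma> A f h" by blast
  have kf: "kcont P (subtopology \<sigma> A) \<tau> f" "A \<subseteq> topspace \<sigma>" using Usm_basics[OF lin(1) lin.prems] openin_subset by auto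
  have kh: "kcont P (subtopology (ubr \<sigma>) (ubset \<sigma> A)) \<tau> h" using Usm_basics[OF h(1) lin.prems] by auto
  have "dquot P \<sigma> A (\<lambda>p x. L (f p x)) (\<lambda>p x. L (h p x))"
    unfolding dquot_def
  proof (intro ballI)
    fix p u assume pu: "p \<in> topspace P" "u \<in> ubset \<sigma> A"
    have t: "h p u \<in> topspace \<tau>" "f p (uline u) \<in> topspace \<tau>" "f p (upnt u) \<in> topspace \<tau>"
      using kcont_maps[OF kf(1) pu(1)] kcont_maps[OF kh pu(1)] ubset_dest[OF pu(2)] kf(2) pu(2) by auto
    have "us (upar u) (h p u) = f p (uline u) - f p (upnt u)" using h(2) pu unfolding dquot_def by blast
    then have "L (us (upar u) (h p u)) = L (f p (uline u) - f p (upnt u))" by simp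
    then show "us (upar u) (L (h p u)) = L (f p (uline u)) - L (f p (upnt u))" using lin(4,5) t by simp
  qed
  then show ?case using Usm.lin[OF h(1) lin(2-5)] by blast
next
  case (ident \<sigma> A)
  have "dquot P \<sigma> A (\<lambda>p x. x) (\<lambda>p u. udir u)" unfolding dquot_def by simp
  then show ?case using Usm_ubr(2)[OF ident(1) openin_ubset[OF ident(1,2)]] by blast
next
  case (param \<sigma> \<tau> A c)
  have "Usm P (ubr \<sigma>) (ubset \<sigma> A) \<tau> (\<lambda>p x. 0)"
    by (rule Usm.param[OF usp_ubr[OF param(1)] param(2) openin_ubset[OF param(1,3)]]) (simp add: uspD(2)[OF param(2)])
  moreover have "dquot P \<sigma> A (\<lambda>p x. c p) (\<lambda>p x. 0)" unfolding dquot_def by simp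
  ultimately show ?case by blast
next
  case (smul \<sigma> A c \<tau> f)
  then show ?case using lift_smul by blast
next
  case (inv \<sigma> A c)
  then show ?case using lift_inv by blast
next
  case (cover \<sigma> \<tau> \<B> f)
  then have "\<forall>B\<in>\<B>. \<exists>h. Usm P (ubr \<sigma>) (ubset \<sigma> B) \<tau> h \<and> dquot P \<sigma> B f h" by blast
  then obtain hB where "\<And>B. B \<in> \<B> \<Longrightarrow> Usm P (ubr \<sigma>) (ubset \<sigma> B) \<tau> (hB B) \<and> dquot P \<sigma> B f (hB B)" by metis
  with cover show ?case by (intro lift_cover) auto
qed

text \<open>\<open>Usm_lift\<close> is iterated by dependent choice. The quotients never leave
  \<open>Usm\<close>, and its members are continuous by \<open>Usm_basics\<close>.\<close>

theorem Usm_imp_Useq: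
  assumes "Usm P \<sigma> A \<tau> f"
  shows "\<exists>h. Useq P \<sigma> A \<tau> h \<and> h 0 = f"
proof (cases "topspace P = {}")
  case True
  then have "Useq P \<sigma> A \<tau> (\<lambda>_. f)" unfolding Useq_def dquot_def by (auto intro: kcont_empty)
  then show ?thesis by blast
next
  case False
  have "\<exists>h. h 0 = f \<and> (\<forall>n. Usm P (ubrs n \<sigma>) (ubsets \<sigma> A n) \<tau> (h n) \<and>
      dquot P (ubrs n \<sigma>) (ubsets \<sigma> A n) (h n) (h (Suc n)))"
  proof -
    \<comment> \<open>The clause for \<open>n = 0\<close> ties the start of the chosen sequence to
      \<open>f\<close>.\<close>
    have "\<exists>h. \<forall>n. (Usm P (ubrs n \<sigma>) (ubsets \<sigma> A n) \<tau> (h n) \<and> (n = 0 \<longrightarrow> h n = f)) \<and>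
        dquot P (ubrs n \<sigma>) (ubsets \<sigma> A n) (h n) (h (Suc n))"
    proof (rule dependent_nat_choice)
      show "\<exists>h. Usm P (ubrs 0 \<sigma>) (ubsets \<sigma> A 0) \<tau> h \<and> (0 = (0::nat) \<longrightarrow> h = f)" using assms by auto
      fix h :: "'a \<Rightarrow> ('b, 'k) un \<Rightarrow> ('b, 'k) un" and n :: nat
      assume "Usm P (ubrs n \<sigma>) (ubsets \<sigma> A n) \<tau> h \<and> (n = 0 \<longrightarrow> h = f)"
      from Usm_lift[OF conjunct1[OF this] False]
      show "\<exists>h'. (Usm P (ubrs (Suc n) \<sigma>) (ubsets \<sigma> A (Suc n)) \<tau> h' \<and> (Suc n = 0 \<longrightarrow> h' = f)) \<and>
          dquot P (ubrs n \<sigma>) (ubsets \<sigma> A n) h h'" by simp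
    qed
    then show ?thesis by blast
  qed
  then obtain h where h: "h 0 = f" "\<And>n. Usm P (ubrs n \<sigma>) (ubsets \<sigma> A n) \<tau> (h n) \<and>
      dquot P (ubrs n \<sigma>) (ubsets \<sigma> A n) (h n) (h (Suc n))" by blast
  then show ?thesis unfolding Useq_def using Usm_basics[OF _ False] by blast
qed

end

section \<open>Towers inside the universal space\<close>

text \<open>Multiplying by \<open>t\<close> avoids the exception at \<open>t = 0\<close>, where both
  sides vanish; it also makes the relation compatible with linear maps and with passing to values of
  functions.\<close>

definition tower_dquot ::
  "('k::topological_field, 'v::ab_group_add) tvs \<Rightarrow> 'v set \<Rightarrow> ('k, 'w::ab_group_add) tvs \<Rightarrow> nat \<Rightarrow>
     (('v, 'k) tower \<Rightarrow> 'w) \<Rightarrow> (('v, 'k) tower \<Rightarrow> 'w) \<Rightarrow> bool" where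
  "tower_dquot X U F j g h \<longleftrightarrow> (\<forall>x y t. Step x y t \<in> bracket_set X U (Suc j) \<longrightarrow>
     scl F t (h (Step x y t)) = g (line X x y t) - g x)"

definition diff_quots ::
  "'p topology \<Rightarrow> ('k::topological_field, 'v::ab_group_add) tvs \<Rightarrow> 'v set \<Rightarrow> ('k, 'w::ab_group_add) tvs \<Rightarrow>
     (nat \<Rightarrow> 'p \<Rightarrow> ('v, 'k) tower \<Rightarrow> 'w) \<Rightarrow> bool" where
  "diff_quots P X U F h \<longleftrightarrow> (\<forall>j. kcont P (bracket_topology X U j) (topo F) (h j) \<and>
     (\<forall>p\<in>topspace P. tower_dquot X U F j (h j p) (h (Suc j) p)))"

text \<open>Any sequence of quotients will do, so constructions are free of the particular choice
  made in \<open>bracket_map\<close>; \<open>psmooth_iff_bracket_map\<close> compares the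
  two.\<close>

definition psmooth ::
  "'p topology \<Rightarrow> ('k::topological_field, 'v::ab_group_add) tvs \<Rightarrow> 'v set \<Rightarrow> ('k, 'w::ab_group_add) tvs \<Rightarrow>
     ('p \<Rightarrow> 'v \<Rightarrow> 'w) \<Rightarrow> bool" where
  "psmooth P X U F f \<longleftrightarrow>
     (\<exists>h. diff_quots P X U F h \<and> (\<forall>p\<in>topspace P. \<forall>x\<in>U. h 0 p (Base x) = f p x))"

definition partial_diff_quots ::
  "'p topology \<Rightarrow> ('k::topological_field, 'v::ab_group_add) tvs \<Rightarrow> 'v set \<Rightarrow> ('k, 'w::ab_group_add) tvs \<Rightarrow> 'w set \<Rightarrow>
     ('k, 'e::ab_group_add) tvs \<Rightarrow> (nat \<Rightarrow> nat \<Rightarrow> 'p \<Rightarrow> ('v, 'k) tower \<Rightarrow> ('w, 'k) tower \<Rightarrow> 'e) \<Rightarrow> bool" where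
  "partial_diff_quots P X U Y V E H \<longleftrightarrow>
     (\<forall>j l. kcont P (prod_topology (bracket_topology X U j) (bracket_topology Y V l)) (topo E) (\<lambda>p (a, b). H j l p a b)) \<and>
     (\<forall>j l. \<forall>p\<in>topspace P. \<forall>b\<in>bracket_set Y V l. tower_dquot X U E j (\<lambda>a. H j l p a b) (\<lambda>a. H (Suc j) l p a b)) \<and>
     (\<forall>j l. \<forall>p\<in>topspace P. \<forall>a\<in>bracket_set X U j. tower_dquot Y V E l (H j l p a) (H j (Suc l) p a))"

lemma continuous_map_base_of: "continuous_map (tower_topology E 0) (topo E) base_of"
  using continuous_map_pullback[of "topo E" "topo E" id "range Base" base_of] by simp

lemma continuous_map_Base:
  assumes "continuous_map X (topo E) f"
  shows "continuous_map X (tower_topology E 0) (\<lambda>x. Base (f x))"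
  using assms by (auto intro!: continuous_map_pullback' simp: o_def)

lemma topspace_tower_0: "topspace (tower_topology E 0) = Base ` topspace (topo E)"
  by (auto simp: topspace_pullback_topology)

lemma topspace_tower_Suc:
  "topspace (tower_topology E (Suc j)) =
     {Step x y t | x y t. x \<in> topspace (tower_topology E j) \<and> y \<in> topspace (tower_topology E j)}"
  by (auto simp: topspace_pullback_topology)

lemma continuous_map_tower_proj:
  "continuous_map (tower_topology E (Suc j)) (tower_topology E j) pt_of"
  "continuous_map (tower_topology E (Suc j)) (tower_topology E j) dir_of"
  "continuous_map (tower_topology E (Suc j)) euclidean par_of"
proof -
  let ?T = "prod_topology (tower_topology E j) (prod_topology (tower_topology E j) euclidean)"
  have "continuous_map (tower_topology E (Suc j)) ?T (id \<circ> (\<lambda>w. (pt_of w, dir_of w, par_of w)))"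
    unfolding tower_topology.simps by (rule continuous_map_pullback) simp
  then show "continuous_map (tower_topology E (Suc j)) (tower_topology E j) pt_of"
    "continuous_map (tower_topology E (Suc j)) (tower_topology E j) dir_of"
    "continuous_map (tower_topology E (Suc j)) euclidean par_of"
    by (simp_all add: continuous_map_pairwise o_def del: tower_topology.simps)
qed

lemma continuous_map_Step:
  assumes "continuous_map X (tower_topology E j) f" "continuous_map X (tower_topology E j) g" "continuous_map X euclidean c"
  shows "continuous_map X (tower_topology E (Suc j)) (\<lambda>x. Step (f x) (g x) (c x))"
  unfolding tower_topology.simps
  by (rule continuous_map_pullback') (use assms in \<open>auto simp: o_def continuous_map_pairwise\<close>)

lemma bracket_set_subset: "U \<subseteq> topspace (topo E) \<Longrightarrow> bracket_set E U j \<subseteq> topspace (tower_topology E j)"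
  by (induction j) (auto simp: topspace_tower_0 topspace_tower_Suc simp del: tower_topology.simps)

lemma topspace_bracket:
  "U \<subseteq> topspace (topo E) \<Longrightarrow> topspace (bracket_topology E U j) = bracket_set E U j"
  using bracket_set_subset[of U E j] by (auto simp: bracket_topology_def)

lemma line_in_tower:
  assumes "is_tvs E"
  shows "\<lbrakk>x \<in> topspace (tower_topology E j); y \<in> topspace (tower_topology E j)\<rbrakk> \<Longrightarrow>
     line E x y t \<in> topspace (tower_topology E j)"
proof (induction j arbitrary: x y)
  case 0
  then show ?case using is_tvsD(4,5)[OF assms] by (auto simp: topspace_tower_0 simp del: tower_topology.simps)
next
  case (Suc j)
  then show ?case by (auto simp: topspace_tower_Suc simp del: tower_topology.simps)
qed

primrec tower_enc :: "('z \<Rightarrow> ('b, 'k) un) \<Rightarrow> ('z, 'k) tower \<Rightarrow> ('b::zero, 'k::zero) un" where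
  "tower_enc e (Base x) = e x"
| "tower_enc e (Step a b t) = ustep (tower_enc e a) (tower_enc e b) t"

text \<open>A tree does not record the height of the tower it encodes, hence the level as an
  argument.\<close>

primrec tower_dec :: "(('b, 'k) un \<Rightarrow> 'z) \<Rightarrow> nat \<Rightarrow> ('b, 'k) un \<Rightarrow> ('z, 'k) tower" where
  "tower_dec r 0 u = Base (r u)"
| "tower_dec r (Suc j) u = Step (tower_dec r j (upnt u)) (tower_dec r j (udir u)) (upar u)"

section \<open>Transport between towers and trees\<close>

context universe
begin

definition uembed :: "('k, 'z::ab_group_add) tvs \<Rightarrow> ('z \<Rightarrow> ('b, 'k) un) \<Rightarrow> (('b, 'k) un \<Rightarrow> 'z) \<Rightarrow> bool" where
  "uembed Z e r \<longleftrightarrow> is_tvs Z \<and> (\<forall>x. r (e x) = x) \<and> (\<forall>x y. e (x + y) = e x + e y) \<and> (\<forall>c x. e (scl Z c x) = us c (e x))"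

abbreviation utop :: "('k, 'z::ab_group_add) tvs \<Rightarrow> ('z \<Rightarrow> ('b, 'k) un) \<Rightarrow> (('b, 'k) un \<Rightarrow> 'z) \<Rightarrow> ('b, 'k) un topology" where
  "utop Z e r \<equiv> pushforward e r (topo Z)"

lemma usp_utop: "uembed Z e r \<Longrightarrow> usp (utop Z e r)"
  unfolding uembed_def using usp_pushforward by blast

lemma uembed_diff:
  assumes "uembed Z e r"
  shows "e (x - y) = e x - e y"
proof -
  have "e (x - y) + e y = e (x - y + y)" using assms unfolding uembed_def by metis
  then show ?thesis by (simp only: diff_add_cancel eq_diff_eq)
qed

lemma topspace_utop: "uembed Z e r \<Longrightarrow> topspace (utop Z e r) = e ` topspace (topo Z)"
  unfolding uembed_def by (simp add: pushforward(1))

lemma continuous_map_embed: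
  assumes "uembed Z e r"
  shows "continuous_map (topo Z) (utop Z e r) e" "continuous_map (utop Z e r) (topo Z) r"
  using assms pushforward(2,3)[of r e "topo Z"] unfolding uembed_def by auto

lemma openin_embed:
  assumes "uembed Z e r" "openin (topo Z) U"
  shows "openin (utop Z e r) (e ` U)"
proof -
  have "homeomorphic_maps (topo Z) (utop Z e r) e r" using assms pushforward(4)[of r e] unfolding uembed_def by blast
  then have "homeomorphic_map (topo Z) (utop Z e r) e" using homeomorphic_map_maps by blast
  then show ?thesis using assms(2) homeomorphic_map_openness openin_subset by metis
qed

context
  fixes Z :: "('k, 'z::ab_group_add) tvs" and e r
  assumes emb: "uembed Z e r"
begin

lemma tvs_Z: "is_tvs Z" and re [simp]: "r (e x) = x"
  using emb by (auto simp: uembed_def)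

lemma dec_enc: "w \<in> topspace (tower_topology Z j) \<Longrightarrow> tower_dec r j (tower_enc e w) = w"
proof (induction j arbitrary: w)
  case 0
  then show ?case by (auto simp: topspace_tower_0 simp del: tower_topology.simps)
next
  case (Suc j)
  then show ?case by (auto simp: topspace_tower_Suc simp del: tower_topology.simps)
qed

lemma enc_dec: "u \<in> topspace (ubrs j (utop Z e r)) \<Longrightarrow> tower_enc e (tower_dec r j u) = u"
proof (induction j arbitrary: u)
  case 0
  then show ?case by (auto simp: topspace_utop[OF emb])
next
  case (Suc j)
  then show ?case by (auto simp: topspace_ubr)
qed

lemma continuous_map_enc: "continuous_map (tower_topology Z j) (ubrs j (utop Z e r)) (tower_enc e)"
proof (induction j)
  case 0
  have "continuous_map (tower_topology Z 0) (utop Z e r) (\<lambda>w. e (base_of w))"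
    by (rule continuous_map_compose'[OF continuous_map_base_of continuous_map_embed(1)[OF emb]])
  then have "continuous_map (tower_topology Z 0) (utop Z e r) (tower_enc e)"
    by (rule continuous_map_eq) (auto simp: topspace_tower_0 simp del: tower_topology.simps)
  then show ?case by simp
next
  case (Suc j)
  have "continuous_map (tower_topology Z (Suc j)) (ubr (ubrs j (utop Z e r)))
      (\<lambda>w. ustep (tower_enc e (pt_of w)) (tower_enc e (dir_of w)) (par_of w))"
    by (intro continuous_map_ustep continuous_map_compose'[OF continuous_map_tower_proj(1) Suc]
        continuous_map_compose'[OF continuous_map_tower_proj(2) Suc] continuous_map_tower_proj(3))
  then have "continuous_map (tower_topology Z (Suc j)) (ubr (ubrs j (utop Z e r))) (tower_enc e)"
    by (rule continuous_map_eq) (auto simp: topspace_tower_Suc simp del: tower_topology.simps)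
  then show ?case by simp
qed

lemma continuous_map_dec: "continuous_map (ubrs j (utop Z e r)) (tower_topology Z j) (tower_dec r j)"
proof (induction j)
  case 0
  have "continuous_map (utop Z e r) (tower_topology Z 0) (\<lambda>u. Base (r u))"
    by (rule continuous_map_Base[OF continuous_map_embed(2)[OF emb]])
  then show ?case by (simp del: tower_topology.simps)
next
  case (Suc j)
  have "continuous_map (ubr (ubrs j (utop Z e r))) (tower_topology Z (Suc j))
      (\<lambda>u. Step (tower_dec r j (upnt u)) (tower_dec r j (udir u)) (upar u))"
    by (intro continuous_map_Step continuous_map_compose'[OF continuous_map_ubr(1) Suc]
        continuous_map_compose'[OF continuous_map_ubr(2) Suc] continuous_map_ubr(3))
  then show ?case by (simp del: tower_topology.simps)
qed

lemma enc_line: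
  "\<lbrakk>x \<in> topspace (tower_topology Z j); y \<in> topspace (tower_topology Z j)\<rbrakk> \<Longrightarrow>
     tower_enc e (line Z x y t) = tower_enc e x + us t (tower_enc e y)"
proof (induction j arbitrary: x y)
  case 0
  then obtain a b where "x = Base a" "y = Base b" by (auto simp: topspace_tower_0 simp del: tower_topology.simps)
  then show ?case using emb by (simp add: uembed_def)
next
  case (Suc j)
  then obtain a b s a' b' s' where *: "x = Step a b s" "y = Step a' b' s'" "a \<in> topspace (tower_topology Z j)"
    "b \<in> topspace (tower_topology Z j)" "a' \<in> topspace (tower_topology Z j)" "b' \<in> topspace (tower_topology Z j)"
    by (auto simp: topspace_tower_Suc simp del: tower_topology.simps)
  show ?case unfolding *(1,2) line.simps tower_enc.simps
    by (simp only: Suc.IH[OF *(3,5)] Suc.IH[OF *(4,6)] us_constr upair_add uscal_add)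
qed

lemma enc_in_topspace: "w \<in> topspace (tower_topology Z j) \<Longrightarrow> tower_enc e w \<in> topspace (ubrs j (utop Z e r))"
  using continuous_map_enc[of j] continuous_map_funspace by blast

lemma dec_in_topspace: "u \<in> topspace (ubrs j (utop Z e r)) \<Longrightarrow> tower_dec r j u \<in> topspace (tower_topology Z j)"
  using continuous_map_dec[of j] continuous_map_funspace by blast

lemma enc_bracket:
  "\<lbrakk>U \<subseteq> topspace (topo Z); w \<in> topspace (tower_topology Z j)\<rbrakk> \<Longrightarrow>
     tower_enc e w \<in> ubsets (utop Z e r) (e ` U) j \<longleftrightarrow> w \<in> bracket_set Z U j"
proof (induction j arbitrary: w)
  case 0
  have "inj e" using re by (metis injI)
  then have "e x \<in> e ` U \<longleftrightarrow> x \<in> U" for x by (rule inj_image_mem_iff)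
  moreover obtain x where "w = Base x" using 0(2) by (auto simp: topspace_tower_0 simp del: tower_topology.simps)
  ultimately show ?case by auto
next
  case (Suc j)
  then obtain x y t where w: "w = Step x y t" "x \<in> topspace (tower_topology Z j)" "y \<in> topspace (tower_topology Z j)"
    by (auto simp: topspace_tower_Suc simp del: tower_topology.simps)
  have "tower_enc e w \<in> ubsets (utop Z e r) (e ` U) (Suc j) \<longleftrightarrow>
      tower_enc e x \<in> ubsets (utop Z e r) (e ` U) j \<and> tower_enc e (line Z x y t) \<in> ubsets (utop Z e r) (e ` U) j"
    using enc_in_topspace[OF w(2)] enc_in_topspace[OF w(3)] enc_line[OF w(2,3)] by (simp add: w(1) ustep_in_ubset)
  also have "\<dots> \<longleftrightarrow> x \<in> bracket_set Z U j \<and> line Z x y t \<in> bracket_set Z U j"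
    using Suc.IH[OF Suc.prems(1)] w line_in_tower[OF tvs_Z w(2,3)] by blast
  also have "\<dots> \<longleftrightarrow> w \<in> bracket_set Z U (Suc j)" using w by auto
  finally show ?case .
qed

lemma ubsets_subset: "U \<subseteq> topspace (topo Z) \<Longrightarrow> ubsets (utop Z e r) (e ` U) j \<subseteq> topspace (ubrs j (utop Z e r))"
  unfolding ubset_def by (cases j) (simp_all add: topspace_utop[OF emb] image_mono ubset_def)

lemma dec_bracket:
  assumes "U \<subseteq> topspace (topo Z)" "u \<in> ubsets (utop Z e r) (e ` U) j"
  shows "tower_dec r j u \<in> bracket_set Z U j"
proof -
  have u: "u \<in> topspace (ubrs j (utop Z e r))" using ubsets_subset[OF assms(1)] assms(2) by blast
  show ?thesis using enc_bracket[OF assms(1) dec_in_topspace[OF u]] assms(2) by (simp add: enc_dec[OF u])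
qed

lemma continuous_map_enc_bracket:
  assumes "U \<subseteq> topspace (topo Z)"
  shows "continuous_map (bracket_topology Z U j) (subtopology (ubrs j (utop Z e r)) (ubsets (utop Z e r) (e ` U) j)) (tower_enc e)"
  unfolding bracket_topology_def
  by (intro continuous_map_into_subtopology continuous_map_from_subtopology continuous_map_enc)
    (use enc_bracket[OF assms] in auto)

lemma continuous_map_dec_bracket:
  assumes "U \<subseteq> topspace (topo Z)"
  shows "continuous_map (subtopology (ubrs j (utop Z e r)) (ubsets (utop Z e r) (e ` U) j)) (bracket_topology Z U j) (tower_dec r j)"
  unfolding bracket_topology_def
  by (intro continuous_map_into_subtopology continuous_map_from_subtopology continuous_map_dec)
    (use dec_bracket[OF assms] in auto)

text \<open>Encoding respects \<open>x + t y\<close> and is inverse to decoding on the topological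
  spaces of each level, so decoding carries \<open>uline u\<close> to the corresponding
  \<open>line\<close>.\<close>

lemma dquot_of_tower:
  assumes U: "U \<subseteq> topspace (topo Z)" and F: "uembed F eF rF"
    and d: "\<And>p. p \<in> topspace P \<Longrightarrow> tower_dquot Z U F j (g p) (h p)"
  shows "dquot P (ubrs j (utop Z e r)) (ubsets (utop Z e r) (e ` U) j)
     (\<lambda>p u. eF (g p (tower_dec r j u))) (\<lambda>p u. eF (h p (tower_dec r (Suc j) u)))"
  unfolding dquot_def
proof (intro ballI)
  fix p u assume p: "p \<in> topspace P" and u: "u \<in> ubset (ubrs j (utop Z e r)) (ubsets (utop Z e r) (e ` U) j)"
  then have u': "u \<in> ubsets (utop Z e r) (e ` U) (Suc j)" by simp
  define x y t where "x = tower_dec r j (upnt u)" "y = tower_dec r j (udir u)" "t = upar u"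
  have w: "tower_dec r (Suc j) u = Step x y t" by (simp add: x_y_t_def)
  have "Step x y t \<in> bracket_set Z U (Suc j)" using dec_bracket[OF U u'] w by simp
  then have eq: "scl F t (h p (Step x y t)) = g p (line Z x y t) - g p x"
    using d[OF p] unfolding tower_dquot_def by blast
  note ud = ubset_dest[OF u]
  have xy: "x \<in> topspace (tower_topology Z j)" "y \<in> topspace (tower_topology Z j)"
    using dec_in_topspace ud by (auto simp: x_y_t_def)
  have "tower_enc e (line Z x y t) = uline u"
    using enc_line[OF xy] enc_dec ud by (simp add: x_y_t_def)
  then have l: "tower_dec r j (uline u) = line Z x y t" using dec_enc[OF line_in_tower[OF tvs_Z xy]] by metis
  have "us (upar u) (eF (h p (tower_dec r (Suc j) u))) = eF (scl F t (h p (Step x y t)))"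
    unfolding w using F by (simp add: uembed_def x_y_t_def)
  also have "\<dots> = eF (g p (tower_dec r j (uline u))) - eF (g p (tower_dec r j (upnt u)))"
    unfolding eq l uembed_diff[OF F] by (simp add: x_y_t_def)
  finally show "us (upar u) (eF (h p (tower_dec r (Suc j) u))) =
      eF (g p (tower_dec r j (uline u))) - eF (g p (tower_dec r j (upnt u)))" .
qed

text \<open>The range conditions place the values of \<open>g\<close> and \<open>h\<close> in the
  image of \<open>eF\<close>; there the equation can be pulled back, since \<open>eF\<close> is
  linear and has the left inverse \<open>rF\<close>.\<close>

lemma tower_of_dquot:
  assumes U: "U \<subseteq> topspace (topo Z)" and F: "uembed F eF rF"
    and d: "dquot P (ubrs j (utop Z e r)) (ubsets (utop Z e r) (e ` U) j) g h" and p: "p \<in> topspace P"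
    and g: "\<And>u. u \<in> ubsets (utop Z e r) (e ` U) j \<Longrightarrow> g p u \<in> topspace (utop F eF rF)"
    and h: "\<And>u. u \<in> ubsets (utop Z e r) (e ` U) (Suc j) \<Longrightarrow> h p u \<in> topspace (utop F eF rF)"
  shows "tower_dquot Z U F j (\<lambda>w. rF (g p (tower_enc e w))) (\<lambda>w. rF (h p (tower_enc e w)))"
  unfolding tower_dquot_def
proof (intro allI impI)
  fix x y t assume w: "Step x y t \<in> bracket_set Z U (Suc j)"
  then have xy: "x \<in> topspace (tower_topology Z j)" "y \<in> topspace (tower_topology Z j)"
      "x \<in> bracket_set Z U j" "line Z x y t \<in> bracket_set Z U j"
    using bracket_set_subset[OF U] by auto
  let ?u = "tower_enc e (Step x y t)"
  have u: "?u \<in> ubsets (utop Z e r) (e ` U) (Suc j)"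
    using enc_bracket[OF U, of "Step x y t" "Suc j"] w bracket_set_subset[OF U] by blast
  have m: "tower_enc e x \<in> ubsets (utop Z e r) (e ` U) j" "tower_enc e (line Z x y t) \<in> ubsets (utop Z e r) (e ` U) j"
    using enc_bracket[OF U] xy line_in_tower[OF tvs_Z xy(1,2)] by auto
  obtain a b c where abc: "g p (tower_enc e x) = eF a" "g p (tower_enc e (line Z x y t)) = eF b" "h p ?u = eF c"
    using g[OF m(1)] g[OF m(2)] h[OF u] by (auto simp: topspace_utop[OF F])
  have "?u \<in> ubset (ubrs j (utop Z e r)) (ubsets (utop Z e r) (e ` U) j)" using u by (simp only: ubsets.simps)
  from d[unfolded dquot_def, rule_format, OF p this]
  have "us (upar ?u) (h p ?u) = g p (uline ?u) - g p (upnt ?u)" .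
  then have "eF (scl F t c) = eF (b - a)"
    using abc enc_line[OF xy(1,2), of t] F by (simp add: uembed_diff[OF F] uembed_def)
  then have "rF (eF (scl F t c)) = rF (eF (b - a))" by simp
  moreover have "rF (eF z) = z" for z using F by (simp add: uembed_def)
  ultimately have "scl F t c = b - a" by (simp only:)
  then show "scl F t (rF (h p ?u)) = rF (g p (tower_enc e (line Z x y t))) - rF (g p (tower_enc e x))"
    using abc F by (simp add: uembed_def)
qed

lemma Useq_of_diff_quots:
  assumes U: "U \<subseteq> topspace (topo Z)" and F: "uembed F eF rF" and h: "diff_quots P Z U F h"
  shows "Useq P (utop Z e r) (e ` U) (utop F eF rF) (\<lambda>j p u. eF (h j p (tower_dec r j u)))"
  unfolding Useq_def
proof (intro allI conjI)
  fix j
  have k: "kcont P (bracket_topology Z U j) (topo F) (h j)" using h by (simp add: diff_quots_def)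
  show "kcont P (subtopology (ubrs j (utop Z e r)) (ubsets (utop Z e r) (e ` U) j)) (utop F eF rF) (\<lambda>p u. eF (h j p (tower_dec r j u)))"
    by (rule kcont_postcompose[OF kcont_precompose[OF k continuous_map_dec_bracket[OF U]] continuous_map_embed(1)[OF F]])
  show "dquot P (ubrs j (utop Z e r)) (ubsets (utop Z e r) (e ` U) j) (\<lambda>p u. eF (h j p (tower_dec r j u)))
      (\<lambda>p u. eF (h (Suc j) p (tower_dec r (Suc j) u)))"
    using h by (intro dquot_of_tower[OF U F]) (simp add: diff_quots_def)
qed

lemma diff_quots_of_Useq:
  assumes U: "U \<subseteq> topspace (topo Z)" and F: "uembed F eF rF"
    and h: "Useq P (utop Z e r) (e ` U) (utop F eF rF) h"
  shows "diff_quots P Z U F (\<lambda>j p w. rF (h j p (tower_enc e w)))"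
  unfolding diff_quots_def
proof (intro allI conjI ballI)
  have k: "kcont P (subtopology (ubrs j (utop Z e r)) (ubsets (utop Z e r) (e ` U) j)) (utop F eF rF) (h j)" for j
    using h by (simp add: Useq_def)
  fix j
  show "kcont P (bracket_topology Z U j) (topo F) (\<lambda>p w. rF (h j p (tower_enc e w)))"
    by (rule kcont_postcompose[OF kcont_precompose[OF k continuous_map_enc_bracket[OF U]] continuous_map_embed(2)[OF F]])
  fix p assume p: "p \<in> topspace P"
  have "h j p u \<in> topspace (utop F eF rF)" if "u \<in> ubsets (utop Z e r) (e ` U) j" for j u
    using kcont_maps[OF k p] that ubsets_subset[OF U, of j] by auto
  then show "tower_dquot Z U F j (\<lambda>w. rF (h j p (tower_enc e w))) (\<lambda>w. rF (h (Suc j) p (tower_enc e w)))"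
    using h p by (intro tower_of_dquot[OF U F]) (auto simp: Useq_def)
qed

text \<open>One direction is the rule \<open>seq\<close>, the other is \<open>Usm_imp_Useq\<close>.
  Every rule of \<open>Usm\<close> thereby becomes a closure property of smooth families.\<close>

lemma psmooth_iff_Usm:
  assumes U: "openin (topo Z) U" and F: "uembed F eF rF"
  shows "psmooth P Z U F f \<longleftrightarrow> Usm P (utop Z e r) (e ` U) (utop F eF rF) (\<lambda>p u. eF (f p (r u)))"
proof
  have US: "U \<subseteq> topspace (topo Z)" by (rule openin_subset[OF U])
  note sp = usp_utop[OF emb] usp_utop[OF F] openin_embed[OF emb U]
  {
    assume "psmooth P Z U F f"
    then obtain h where h: "diff_quots P Z U F h" "\<forall>p\<in>topspace P. \<forall>x\<in>U. h 0 p (Base x) = f p x"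
      by (auto simp: psmooth_def)
    from Usm.seq[OF sp Useq_of_diff_quots[OF US F h(1)]]
    show "Usm P (utop Z e r) (e ` U) (utop F eF rF) (\<lambda>p u. eF (f p (r u)))"
      by (rule Usm.congr) (use h(2) in auto)
  next
    assume "Usm P (utop Z e r) (e ` U) (utop F eF rF) (\<lambda>p u. eF (f p (r u)))"
    from Usm_imp_Useq[OF this] obtain h where h: "Useq P (utop Z e r) (e ` U) (utop F eF rF) h" "h 0 = (\<lambda>p u. eF (f p (r u)))"
      by blast
    have "rF (h 0 p (tower_enc e (Base x))) = f p x" for p x
      using F by (simp add: h(2) uembed_def)
    with diff_quots_of_Useq[OF US F h(1)] show "psmooth P Z U F f" unfolding psmooth_def by blast
  }
qed

end

end

section \<open>Smooth maps on products\<close>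

context universe
begin

abbreviation ubox where
  "ubox \<sigma> A \<sigma>' A' \<equiv> {u \<in> topspace (uprod \<sigma> \<sigma>'). ufst u \<in> A \<and> usnd u \<in> A'}"

lemma upair_in_uprod [simp]:
  "upair a b \<in> topspace (uprod \<sigma> \<sigma>') \<longleftrightarrow> a \<in> topspace \<sigma> \<and> b \<in> topspace \<sigma>'"
proof
  assume "upair a b \<in> topspace (uprod \<sigma> \<sigma>')"
  then obtain a' b' where "upair a b = upair a' b'" "a' \<in> topspace \<sigma>" "b' \<in> topspace \<sigma>'"
    by (auto simp: topspace_uprod)
  moreover from this(1) have "a = a'" "b = b'" by (metis un_inverse(3,4))+
  ultimately show "a \<in> topspace \<sigma> \<and> b \<in> topspace \<sigma>'" by simp
qed (auto simp: topspace_uprod)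

lemma upair_in_ubox:
  "upair a b \<in> ubox \<sigma> A \<sigma>' A' \<longleftrightarrow> a \<in> topspace \<sigma> \<and> b \<in> topspace \<sigma>' \<and> a \<in> A \<and> b \<in> A'"
  by simp

lemma ubox_cases:
  assumes "z \<in> ubox \<sigma> A \<sigma>' A'"
  obtains a b where "z = upair a b" "a \<in> topspace \<sigma>" "b \<in> topspace \<sigma>'" "a \<in> A" "b \<in> A'"
  using assms by (auto simp: topspace_uprod)

lemma openin_ubox:
  assumes "openin \<sigma> A" "openin \<sigma>' A'"
  shows "openin (uprod \<sigma> \<sigma>') (ubox \<sigma> A \<sigma>' A')"
proof -
  have "openin (uprod \<sigma> \<sigma>') ({u \<in> topspace (uprod \<sigma> \<sigma>'). ufst u \<in> A} \<inter> {u \<in> topspace (uprod \<sigma> \<sigma>'). usnd u \<in> A'})"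
    by (intro openin_Int openin_continuous_map_preimage[OF continuous_map_ufst assms(1)]
        openin_continuous_map_preimage[OF continuous_map_usnd assms(2)])
  also have "\<dots> = ubox \<sigma> A \<sigma>' A'" by blast
  finally show ?thesis .
qed

text \<open>The partial quotient is the full one with direction \<open>0\<close> in the second
  variable: it is taken at \<open>((x, b), (x', 0), t)\<close>, whose end point is
  \<open>(x + t x', b)\<close>.\<close>

lemma Usm_partial_fst:
  assumes sp: "usp \<sigma>" "usp \<sigma>'" and A: "openin \<sigma> A" "openin \<sigma>' A'"
    and f: "Usm P (uprod \<sigma> \<sigma>') (ubox \<sigma> A \<sigma>' A') \<tau> f" and Pne: "topspace P \<noteq> {}"
  shows "\<exists>h. Usm P (uprod (ubr \<sigma>) \<sigma>') (ubox (ubr \<sigma>) (ubset \<sigma> A) \<sigma>' A') \<tau> h \<and>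
    (\<forall>p\<in>topspace P. \<forall>u\<in>ubset \<sigma> A. \<forall>b\<in>A'. us (upar u) (h p (upair u b)) = f p (upair (uline u) b) - f p (upair (upnt u) b))"
proof -
  obtain hf where hf: "Usm P (ubr (uprod \<sigma> \<sigma>')) (ubset (uprod \<sigma> \<sigma>') (ubox \<sigma> A \<sigma>' A')) \<tau> hf"
      "dquot P (uprod \<sigma> \<sigma>') (ubox \<sigma> A \<sigma>' A') f hf" using Usm_lift[OF f Pne] by blast
  let ?\<rho> = "uprod (ubr \<sigma>) \<sigma>'" and ?B = "ubox (ubr \<sigma>) (ubset \<sigma> A) \<sigma>' A'"
  have \<rho>: "usp ?\<rho>" and B: "openin ?\<rho> ?B"
    using sp A by (auto intro!: usp_uprod usp_uscalars openin_ubox openin_ubset)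
  have sub: "A \<subseteq> topspace \<sigma>" "A' \<subseteq> topspace \<sigma>'" using A openin_subset by auto
  note 1 = Usm_proj(1)[OF usp_ubr[OF sp(1)] sp(2) B, of P] and 2 = Usm_proj(2)[OF usp_ubr[OF sp(1)] sp(2) B, of P]
  have 3: "Usm P ?\<rho> ?B \<sigma> (\<lambda>_ z. upnt (ufst z))" "Usm P ?\<rho> ?B \<sigma> (\<lambda>_ z. udir (ufst z))"
    "Usm P ?\<rho> ?B uscalars (\<lambda>_ z. usnd (usnd (ufst z)))"
    using Usm.lin[OF 1 sp(1) continuous_map_ubr(1)] Usm.lin[OF 1 sp(1) continuous_map_ubr(2)]
      Usm.lin[OF 1 usp_uscalars continuous_map_compose'[OF continuous_map_usnd continuous_map_usnd]] by simp_all
  have 4: "Usm P ?\<rho> ?B \<sigma>' (\<lambda>_ z. 0)"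
    by (rule Usm.param[OF \<rho> sp(2) B]) (simp add: uspD(2)[OF sp(2)])
  define \<phi> where "\<phi> z = ustep (upair (upnt (ufst z)) (usnd z)) (upair (udir (ufst z)) 0) (upar (ufst z))" for z :: "('b, 'k) un"
  have "Usm P ?\<rho> ?B (ubr (uprod \<sigma> \<sigma>'))
      (\<lambda>_ z. upair (upair (upnt (ufst z)) (usnd z)) (upair (upair (udir (ufst z)) 0) (usnd (usnd (ufst z)))))"
    by (intro Usm_ustep Usm.pair 2 3 4)
  then have \<phi>: "Usm P ?\<rho> ?B (ubr (uprod \<sigma> \<sigma>')) (\<lambda>_. \<phi>)"
  proof (rule Usm.congr, intro ballI)
    fix z assume "z \<in> ?B"
    then obtain u b where z: "z = upair u b" "u \<in> topspace (ubr \<sigma>)" by (rule ubox_cases)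
    from z(2) obtain t where "usnd (usnd u) = uscal t" unfolding topspace_ubr by auto
    then show "upair (upair (upnt (ufst z)) (usnd z)) (upair (upair (udir (ufst z)) 0) (usnd (usnd (ufst z)))) = \<phi> z"
      by (simp add: \<phi>_def z(1))
  qed
  have line: "upair a b + us t (upair a' 0) = upair (a + us t a') b" for a b a' t
    by (simp add: us_constr upair_add)
  have im: "\<phi> (upair u b) \<in> ubset (uprod \<sigma> \<sigma>') (ubox \<sigma> A \<sigma>' A')" if "u \<in> ubset \<sigma> A" "b \<in> A'" for u b
    unfolding \<phi>_def ustep_in_ubset line upair_in_ubox
    using that ubset_dest[OF that(1)] sub uspD(2)[OF sp(2)] by auto
  have im': "\<phi> ` ?B \<subseteq> ubset (uprod \<sigma> \<sigma>') (ubox \<sigma> A \<sigma>' A')"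
    using im by (auto elim!: ubox_cases)
  have "us (upar u) (hf p (\<phi> (upair u b))) = f p (upair (uline u) b) - f p (upair (upnt u) b)"
    if "p \<in> topspace P" "u \<in> ubset \<sigma> A" "b \<in> A'" for p u b
    using hf(2)[unfolded dquot_def, rule_format, OF that(1) im[OF that(2,3)]]
    unfolding \<phi>_def un_inverse line .
  then show ?thesis using Usm.comp[OF hf(1) \<phi> im'] by blast
qed

text \<open>Follows from \<open>Usm_partial_fst\<close> by composing with the exchange of the two
  factors, once for \<open>f\<close> and once for the quotient.\<close>

lemma Usm_partial_snd:
  assumes sp: "usp \<sigma>" "usp \<sigma>'" and A: "openin \<sigma> A" "openin \<sigma>' A'"
    and f: "Usm P (uprod \<sigma> \<sigma>') (ubox \<sigma> A \<sigma>' A') \<tau> f" and Pne: "topspace P \<noteq> {}"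
  shows "\<exists>h. Usm P (uprod \<sigma> (ubr \<sigma>')) (ubox \<sigma> A (ubr \<sigma>') (ubset \<sigma>' A')) \<tau> h \<and>
    (\<forall>p\<in>topspace P. \<forall>a\<in>A. \<forall>u\<in>ubset \<sigma>' A'. us (upar u) (h p (upair a u)) = f p (upair a (uline u)) - f p (upair a (upnt u)))"
proof -
  have 0: "Usm P (uprod \<sigma>' \<sigma>) (ubox \<sigma>' A' \<sigma> A) (uprod \<sigma> \<sigma>') (\<lambda>_ z. upair (usnd z) (ufst z))"
    by (intro Usm.pair Usm_proj sp openin_ubox A)
  have "Usm P (uprod \<sigma>' \<sigma>) (ubox \<sigma>' A' \<sigma> A) \<tau> (\<lambda>p z. f p (upair (usnd z) (ufst z)))"
    by (rule Usm.comp[OF f 0]) (auto simp: upair_in_ubox elim!: ubox_cases)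
  from Usm_partial_fst[OF sp(2,1) A(2,1) this Pne] obtain h where
    h: "Usm P (uprod (ubr \<sigma>') \<sigma>) (ubox (ubr \<sigma>') (ubset \<sigma>' A') \<sigma> A) \<tau> h"
    "\<And>p u a. \<lbrakk>p \<in> topspace P; u \<in> ubset \<sigma>' A'; a \<in> A\<rbrakk> \<Longrightarrow>
        us (upar u) (h p (upair u a)) = f p (upair a (uline u)) - f p (upair a (upnt u))" by auto
  have 1: "Usm P (uprod \<sigma> (ubr \<sigma>')) (ubox \<sigma> A (ubr \<sigma>') (ubset \<sigma>' A')) (uprod (ubr \<sigma>') \<sigma>) (\<lambda>_ z. upair (usnd z) (ufst z))"
    by (intro Usm.pair Usm_proj usp_ubr sp openin_ubox openin_ubset A)
  have "Usm P (uprod \<sigma> (ubr \<sigma>')) (ubox \<sigma> A (ubr \<sigma>') (ubset \<sigma>' A')) \<tau> (\<lambda>p z. h p (upair (usnd z) (ufst z)))"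
    by (rule Usm.comp[OF h(1) 1]) (auto simp: upair_in_ubox elim!: ubox_cases)
  with h(2) show ?thesis by (intro exI[of _ "\<lambda>p z. h p (upair (usnd z) (ufst z))"]) simp
qed

text \<open>The family is defined by iterating first in the left and then in the right variable; the relation for the
  left variable extends to higher orders in the right one by uniqueness of difference quotients.\<close>

lemma Usm_imp_Ufam:
  assumes sp: "usp \<sigma>" "usp \<sigma>'" "usp \<tau>" and A: "openin \<sigma> A" "openin \<sigma>' A'"
    and f: "Usm P (uprod \<sigma> \<sigma>') (ubox \<sigma> A \<sigma>' A') \<tau> f"
  shows "\<exists>H. Ufam P \<sigma> A \<sigma>' A' \<tau> H \<and> (\<forall>p. \<forall>a\<in>A. \<forall>b\<in>A'. H 0 0 p a b = f p (upair a b))"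
proof (cases "topspace P = {}")
  case True
  have "Ufam P \<sigma> A \<sigma>' A' \<tau> (\<lambda>_ _ p a b. f p (upair a b))"
    using True unfolding Ufam_def dquot_def by (auto intro: kcont_empty)
  then show ?thesis by (rule_tac exI) auto
next
  case False
  let ?\<sigma> = "\<lambda>j. ubrs j \<sigma>" and ?\<sigma>' = "\<lambda>l. ubrs l \<sigma>'" and ?A = "\<lambda>j. ubsets \<sigma> A j" and ?A' = "\<lambda>l. ubsets \<sigma>' A' l"
  let ?S = "\<lambda>j l. Usm P (uprod (?\<sigma> j) (?\<sigma>' l)) (ubox (?\<sigma> j) (?A j) (?\<sigma>' l) (?A' l)) \<tau>"
  note sps = usp_ubrs[OF sp(1)] usp_ubrs[OF sp(2)] and ops = openin_ubsets[OF sp(1) A(1)] openin_ubsets[OF sp(2) A(2)]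
  define R1 where "R1 j g h \<longleftrightarrow> (\<forall>p\<in>topspace P. \<forall>u\<in>?A (Suc j). \<forall>b\<in>A'.
      us (upar u) (h p (upair u b)) = g p (upair (uline u) b) - g p (upair (upnt u) b))" for j and g h :: "'a \<Rightarrow> ('b, 'k) un \<Rightarrow> ('b, 'k) un"
  define R2 where "R2 j l g h \<longleftrightarrow> (\<forall>p\<in>topspace P. \<forall>a\<in>?A j. \<forall>u\<in>?A' (Suc l).
      us (upar u) (h p (upair a u)) = g p (upair a (uline u)) - g p (upair a (upnt u)))" for j l and g h :: "'a \<Rightarrow> ('b, 'k) un \<Rightarrow> ('b, 'k) un"
  \<comment> \<open>\<open>G j\<close> is the quotient of orders \<open>(j, 0)\<close>; the sequence
    \<open>K j\<close> below starts from it, and \<open>K j l\<close> has orders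
    \<open>(j, l)\<close>.\<close>
  have "\<exists>G. \<forall>j. (?S j 0 (G j) \<and> (j = 0 \<longrightarrow> G j = f)) \<and> R1 j (G j) (G (Suc j))"
  proof (rule dependent_nat_choice)
    show "\<exists>g. ?S 0 0 g \<and> (0 = (0::nat) \<longrightarrow> g = f)" using f by auto
    fix g j assume g: "?S j 0 g \<and> (j = 0 \<longrightarrow> g = f)"
    from Usm_partial_fst[OF sps(1) sp(2) ops(1) A(2) conjunct1[OF g, simplified] False]
    show "\<exists>h. (?S (Suc j) 0 h \<and> (Suc j = 0 \<longrightarrow> h = f)) \<and> R1 j g h"
      unfolding R1_def by simp
  qed
  then obtain G where G: "\<And>j. (?S j 0 (G j) \<and> (j = 0 \<longrightarrow> G j = f)) \<and> R1 j (G j) (G (Suc j))" by blast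
  define Q where "Q j K \<longleftrightarrow> (\<forall>l. (?S j l (K l) \<and> (l = 0 \<longrightarrow> K l = G j)) \<and> R2 j l (K l) (K (Suc l)))"
    for j and K :: "nat \<Rightarrow> 'a \<Rightarrow> ('b, 'k) un \<Rightarrow> ('b, 'k) un"
  have "\<exists>K. \<forall>l. (?S j l (K l) \<and> (l = 0 \<longrightarrow> K l = G j)) \<and> R2 j l (K l) (K (Suc l))" for j
  proof (rule dependent_nat_choice)
    show "\<exists>g. ?S j 0 g \<and> (0 = (0::nat) \<longrightarrow> g = G j)" using G by auto
    fix g l assume g: "?S j l g \<and> (l = 0 \<longrightarrow> g = G j)"
    from Usm_partial_snd[OF sps ops conjunct1[OF g] False]
    show "\<exists>h. (?S j (Suc l) h \<and> (Suc l = 0 \<longrightarrow> h = G j)) \<and> R2 j l g h"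
      unfolding R2_def by simp
  qed
  then have "Ex (Q j)" for j unfolding Q_def .
  then have "\<forall>j. \<exists>K. Q j K" by (rule allI)
  from choice[OF this] obtain K where KQ: "\<forall>j. Q j (K j)" ..
  have KK: "(?S j l (K j l) \<and> (l = 0 \<longrightarrow> K j l = G j)) \<and> R2 j l (K j l) (K j (Suc l))" for j l
    using KQ[rule_format, of j, unfolded Q_def, rule_format, of l] .
  have K: "?S j l (K j l)" "K j 0 = G j" for j l using KK by blast+
  have K3: "us (upar u) (K j (Suc l) p (upair a u)) = K j l p (upair a (uline u)) - K j l p (upair a (upnt u))"
    if "p \<in> topspace P" "a \<in> ?A j" "u \<in> ?A' (Suc l)" for j l p a u
    using KK[of j l, THEN conjunct2, unfolded R2_def] that by blast
  have G3: "us (upar u) (G (Suc j) p (upair u b)) = G j p (upair (uline u) b) - G j p (upair (upnt u) b)"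
    if "p \<in> topspace P" "u \<in> ?A (Suc j)" "b \<in> A'" for j p u b
    using G[of j, THEN conjunct2, unfolded R1_def] that by blast
  have G0: "G 0 = f" using G by blast
  have k: "kcont P (prod_topology (subtopology (?\<sigma> j) (?A j)) (subtopology (?\<sigma>' l) (?A' l))) \<tau> (\<lambda>p (a, b). K j l p (upair a b))" for j l
  proof -
    have 1: "kcont P (subtopology (uprod (?\<sigma> j) (?\<sigma>' l)) (ubox (?\<sigma> j) (?A j) (?\<sigma>' l) (?A' l))) \<tau> (K j l)"
      using Usm_basics[OF K(1) False] by blast
    have "continuous_map (prod_topology (subtopology (?\<sigma> j) (?A j)) (subtopology (?\<sigma>' l) (?A' l)))
        (uprod (?\<sigma> j) (?\<sigma>' l)) (\<lambda>z. upair (fst z) (snd z))"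
      by (intro continuous_map_upair continuous_map_into_fulltopology[OF continuous_map_fst]
          continuous_map_into_fulltopology[OF continuous_map_snd])
    then have "continuous_map (prod_topology (subtopology (?\<sigma> j) (?A j)) (subtopology (?\<sigma>' l) (?A' l)))
        (subtopology (uprod (?\<sigma> j) (?\<sigma>' l)) (ubox (?\<sigma> j) (?A j) (?\<sigma>' l) (?A' l))) (\<lambda>z. upair (fst z) (snd z))"
      by (rule continuous_map_into_subtopology) auto
    from kcont_precompose[OF 1 this] show ?thesis by (simp add: case_prod_unfold)
  qed
  have slice: "continuous_map (subtopology (?\<sigma>' l) (?A' l)) \<tau> (\<lambda>b. K j l p (upair a b))"
    if "p \<in> topspace P" "a \<in> ?A j" for j l p a
  proof -
    have "a \<in> topspace (?\<sigma> j)" using ops(1)[of j] that(2) openin_subset by blast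
    then have "continuous_map (subtopology (?\<sigma>' l) (?A' l)) (prod_topology (subtopology (?\<sigma> j) (?A j)) (subtopology (?\<sigma>' l) (?A' l))) (\<lambda>b. (a, b))"
      using that(2) by (simp add: continuous_map_pairwise o_def)
    from continuous_map_compose'[OF this kcont_slice[OF k that(1)]] show ?thesis by simp
  qed
  \<comment> \<open>For \<open>l = 0\<close> this is the defining property of \<open>G\<close>. For
    higher \<open>l\<close> both sides are continuous in \<open>b\<close>, so by uniqueness it is
    enough to compare them where the parameter of \<open>b\<close> is nonzero.\<close>
  have d1: "us (upar u) (K (Suc j) l p (upair u b)) = K j l p (upair (uline u) b) - K j l p (upair (upnt u) b)"
    if p: "p \<in> topspace P" and u: "u \<in> ?A (Suc j)" and b: "b \<in> ?A' l" for j l p u b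
    using b
  proof (induction l arbitrary: b)
    case 0
    then have "b \<in> A'" by (simp only: ubsets.simps)
    from G3[OF p u this] show ?case by (simp only: K(2))
  next
    case (Suc l)
    have uu: "upnt u \<in> ?A j" "uline u \<in> ?A j" using u ubset_dest(1,2) by auto
    show ?case
    proof (rule dquot_unique[OF sps(2) sp(3) ops(2), where h = "\<lambda>b. us (upar u) (K (Suc j) (Suc l) p (upair u b))"
          and h' = "\<lambda>b. K j (Suc l) p (upair (uline u) b) - K j (Suc l) p (upair (upnt u) b)"])
      show "b \<in> ubset (?\<sigma>' l) (?A' l)" using Suc.prems by simp
      show "continuous_map (subtopology (ubr (?\<sigma>' l)) (ubset (?\<sigma>' l) (?A' l))) \<tau> (\<lambda>b. us (upar u) (K (Suc j) (Suc l) p (upair u b)))"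
        using continuous_map_usp(1)[OF sp(3) slice[OF p u, of "Suc l"], of "\<lambda>_. upar u"] by simp
      show "continuous_map (subtopology (ubr (?\<sigma>' l)) (ubset (?\<sigma>' l) (?A' l))) \<tau>
          (\<lambda>b. K j (Suc l) p (upair (uline u) b) - K j (Suc l) p (upair (upnt u) b))"
        using continuous_map_usp(3)[OF sp(3) slice[OF p uu(1), of "Suc l"] slice[OF p uu(2), of "Suc l"]] by simp
      fix v assume v: "v \<in> ubset (?\<sigma>' l) (?A' l)" "upar v \<noteq> 0"
      then have v': "v \<in> ?A' (Suc l)" by simp
      have vv: "upnt v \<in> ?A' l" "uline v \<in> ?A' l" using v ubset_dest(1,2) by auto
      \<comment> \<open>After multiplication by \<open>upar v\<close> both sides consist of the same
        four values of \<open>K j l\<close>, a mixed second difference.\<close>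
      have "us (upar v) (us (upar u) (K (Suc j) (Suc l) p (upair u v))) = us (upar u) (us (upar v) (K (Suc j) (Suc l) p (upair u v)))"
        by (rule us.scale_left_commute)
      then have "us (upar v) (us (upar u) (K (Suc j) (Suc l) p (upair u v))) =
          us (upar v) (K j (Suc l) p (upair (uline u) v) - K j (Suc l) p (upair (upnt u) v))"
        by (simp only: K3[OF p u v'] K3[OF p uu(1) v'] K3[OF p uu(2) v'] us.scale_right_diff_distrib Suc.IH[OF vv(1)] Suc.IH[OF vv(2)])
          (simp only: algebra_simps)
      then show "us (upar u) (K (Suc j) (Suc l) p (upair u v)) = K j (Suc l) p (upair (uline u) v) - K j (Suc l) p (upair (upnt u) v)"
        using v(2) us.scale_left_imp_eq by blast
    qed
  qed
  have "Ufam P \<sigma> A \<sigma>' A' \<tau> (\<lambda>j l p a b. K j l p (upair a b))"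
    unfolding Ufam_def dquot_def using k d1 K3 by simp
  moreover have "K 0 0 p (upair a b) = f p (upair a b)" for p a b by (simp only: K(2) G0)
  ultimately show ?thesis by blast
qed

section \<open>Products of general topological vector spaces\<close>

context
  fixes X :: "('k, 'v::ab_group_add) tvs" and eX rX and Y :: "('k, 'w::ab_group_add) tvs" and eY rY
    and E :: "('k, 'e::ab_group_add) tvs" and eE rE
  assumes X: "uembed X eX rX" and Y: "uembed Y eY rY" and E: "uembed E eE rE"
begin

definition "epair z = upair (eX (fst z)) (eY (snd z))"
definition "rpair u = (rX (ufst u), rY (usnd u))"

lemma uembed_prod: "uembed (prod_tvs X Y) epair rpair"
proof -
  have x: "is_tvs X" "\<And>a. rX (eX a) = a" "\<And>a b. eX (a + b) = eX a + eX b" "\<And>c a. eX (scl X c a) = us c (eX a)"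
    using X by (simp_all add: uembed_def)
  have y: "is_tvs Y" "\<And>a. rY (eY a) = a" "\<And>a b. eY (a + b) = eY a + eY b" "\<And>c a. eY (scl Y c a) = us c (eY a)"
    using Y by (simp_all add: uembed_def)
  have "scl (prod_tvs X Y) c z = (scl X c (fst z), scl Y c (snd z))" for c z
    by (simp add: prod_tvs_def case_prod_unfold)
  then show ?thesis
    unfolding uembed_def epair_def rpair_def
    by (simp only: is_tvs_prod[OF x(1) y(1)] un_inverse x y prod.collapse fst_conv snd_conv fst_add snd_add upair_add us_constr simp_thms)
qed

text \<open>Both topologies make \<open>epair\<close> a homeomorphism from the product, hence they
  have the same open sets. Equality is what allows \<open>psmooth_iff_Usm\<close> for the product to
  be rewritten as a statement on \<open>uprod\<close>.\<close>

lemma utop_prod: "utop (prod_tvs X Y) epair rpair = uprod (utop X eX rX) (utop Y eY rY)"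
proof (rule topology_eq[THEN iffD2], intro allI)
  let ?T = "prod_topology (topo X) (topo Y)" and ?\<tau> = "utop (prod_tvs X Y) epair rpair" and ?\<sigma> = "uprod (utop X eX rX) (utop Y eY rY)"
  have T: "topo (prod_tvs X Y) = ?T" by (simp add: prod_tvs_def)
  have inv: "rpair (epair z) = z" for z using uembed_prod unfolding uembed_def by blast
  have 1: "homeomorphic_maps ?T ?\<tau> epair rpair"
    using pushforward(4)[of rpair epair "topo (prod_tvs X Y)", OF inv] by (simp only: T)
  have "continuous_map ?T ?\<sigma> epair"
    unfolding epair_def
    by (intro continuous_map_upair continuous_map_compose'[OF continuous_map_fst continuous_map_embed(1)[OF X]]
        continuous_map_compose'[OF continuous_map_snd continuous_map_embed(1)[OF Y]])
  moreover have "continuous_map ?\<sigma> ?T rpair"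
    unfolding rpair_def continuous_map_pairwise o_def fst_conv snd_conv
    by (intro conjI continuous_map_compose'[OF continuous_map_ufst continuous_map_embed(2)[OF X]]
        continuous_map_compose'[OF continuous_map_usnd continuous_map_embed(2)[OF Y]])
  moreover have "epair (rpair u) = u" if "u \<in> topspace ?\<sigma>" for u
    using that X Y by (auto simp: topspace_uprod topspace_utop[OF X] topspace_utop[OF Y] epair_def rpair_def uembed_def)
  ultimately have 2: "homeomorphic_maps ?T ?\<sigma> epair rpair"
    using inv by (simp add: homeomorphic_maps_def)
  have "homeomorphic_map ?T ?\<tau> epair" "homeomorphic_map ?T ?\<sigma> epair"
    using 1 2 homeomorphic_map_maps by blast+
  then have "\<And>S. openin ?\<tau> S \<Longrightarrow> openin ?\<sigma> S" "\<And>S. openin ?\<sigma> S \<Longrightarrow> openin ?\<tau> S"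
  proof -
    note h = \<open>homeomorphic_map ?T ?\<tau> epair\<close> \<open>homeomorphic_map ?T ?\<sigma> epair\<close>
    have *: "openin \<tau>2 S" if "homeomorphic_map ?T \<tau>1 epair" "homeomorphic_map ?T \<tau>2 epair" "openin \<tau>1 S" for \<tau>1 \<tau>2 S
    proof -
      have "S \<subseteq> epair ` topspace ?T" using openin_subset[OF that(3)] homeomorphic_imp_surjective_map[OF that(1)] by simp
      then obtain R where R: "R \<subseteq> topspace ?T" "S = epair ` R" by (auto simp: subset_image_iff)
      then show ?thesis
        using that(3) homeomorphic_map_openness[OF that(1) R(1)] homeomorphic_map_openness[OF that(2) R(1)] by simp
    qed
    show "\<And>S. openin ?\<tau> S \<Longrightarrow> openin ?\<sigma> S" using *[OF h] .
    show "\<And>S. openin ?\<sigma> S \<Longrightarrow> openin ?\<tau> S" using *[OF h(2,1)] .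
  qed
  then show "\<And>S. openin ?\<tau> S = openin ?\<sigma> S" by blast
qed

lemma epair_image:
  assumes "U \<subseteq> topspace (topo X)" "V \<subseteq> topspace (topo Y)"
  shows "epair ` (U \<times> V) = ubox (utop X eX rX) (eX ` U) (utop Y eY rY) (eY ` V)"
proof (intro equalityI subsetI)
  fix u assume "u \<in> epair ` (U \<times> V)"
  then obtain x y where "u = upair (eX x) (eY y)" "x \<in> U" "y \<in> V" by (auto simp: epair_def)
  then show "u \<in> ubox (utop X eX rX) (eX ` U) (utop Y eY rY) (eY ` V)"
    using assms by (auto simp: topspace_utop[OF X] topspace_utop[OF Y])
next
  fix u assume "u \<in> ubox (utop X eX rX) (eX ` U) (utop Y eY rY) (eY ` V)"
  then obtain a b where u: "u = upair a b" "a \<in> eX ` U" "b \<in> eY ` V" by (rule ubox_cases)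
  then obtain x y where "u = epair (x, y)" "x \<in> U" "y \<in> V" by (auto simp: epair_def)
  then show "u \<in> epair ` (U \<times> V)" by blast
qed

lemma Ufam_of_partial:
  assumes U: "U \<subseteq> topspace (topo X)" and V: "V \<subseteq> topspace (topo Y)" and H: "partial_diff_quots P X U Y V E H"
  shows "Ufam P (utop X eX rX) (eX ` U) (utop Y eY rY) (eY ` V) (utop E eE rE)
     (\<lambda>j l p u v. eE (H j l p (tower_dec rX j u) (tower_dec rY l v)))"
  unfolding Ufam_def
proof (intro conjI allI ballI)
  fix j l
  have k: "kcont P (prod_topology (bracket_topology X U j) (bracket_topology Y V l)) (topo E) (\<lambda>p (a, b). H j l p a b)"
    using H by (simp add: partial_diff_quots_def)
  have "continuous_map (prod_topology (subtopology (ubrs j (utop X eX rX)) (ubsets (utop X eX rX) (eX ` U) j))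
      (subtopology (ubrs l (utop Y eY rY)) (ubsets (utop Y eY rY) (eY ` V) l)))
      (prod_topology (bracket_topology X U j) (bracket_topology Y V l)) (\<lambda>(u, v). (tower_dec rX j u, tower_dec rY l v))"
    using continuous_map_dec_bracket[OF X U] continuous_map_dec_bracket[OF Y V] by (simp add: continuous_map_prod_top)
  from kcont_postcompose[OF kcont_precompose[OF k this] continuous_map_embed(1)[OF E]]
  show "kcont P (prod_topology (subtopology (ubrs j (utop X eX rX)) (ubsets (utop X eX rX) (eX ` U) j))
      (subtopology (ubrs l (utop Y eY rY)) (ubsets (utop Y eY rY) (eY ` V) l))) (utop E eE rE)
      (\<lambda>p (a, b). eE (H j l p (tower_dec rX j a) (tower_dec rY l b)))"
    by (simp add: case_prod_unfold)
next
  fix j l b assume "b \<in> ubsets (utop Y eY rY) (eY ` V) l"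
  then have "tower_dec rY l b \<in> bracket_set Y V l" by (rule dec_bracket[OF Y V])
  then show "dquot P (ubrs j (utop X eX rX)) (ubsets (utop X eX rX) (eX ` U) j)
      (\<lambda>p a. eE (H j l p (tower_dec rX j a) (tower_dec rY l b))) (\<lambda>p a. eE (H (Suc j) l p (tower_dec rX (Suc j) a) (tower_dec rY l b)))"
    using H dquot_of_tower[OF X U E, of P j "\<lambda>p a. H j l p a (tower_dec rY l b)" "\<lambda>p a. H (Suc j) l p a (tower_dec rY l b)"]
    unfolding partial_diff_quots_def by blast
next
  fix j l a assume "a \<in> ubsets (utop X eX rX) (eX ` U) j"
  then have "tower_dec rX j a \<in> bracket_set X U j" by (rule dec_bracket[OF X U])
  then show "dquot P (ubrs l (utop Y eY rY)) (ubsets (utop Y eY rY) (eY ` V) l)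
      (\<lambda>p v. eE (H j l p (tower_dec rX j a) (tower_dec rY l v))) (\<lambda>p v. eE (H j (Suc l) p (tower_dec rX j a) (tower_dec rY (Suc l) v)))"
    using H dquot_of_tower[OF Y V E, of P l "\<lambda>p. H j l p (tower_dec rX j a)" "\<lambda>p. H j (Suc l) p (tower_dec rX j a)"]
    unfolding partial_diff_quots_def by blast
qed

lemma partial_of_Ufam:
  assumes U: "U \<subseteq> topspace (topo X)" and V: "V \<subseteq> topspace (topo Y)"
    and H: "Ufam P (utop X eX rX) (eX ` U) (utop Y eY rY) (eY ` V) (utop E eE rE) H"
  shows "partial_diff_quots P X U Y V E (\<lambda>j l p a b. rE (H j l p (tower_enc eX a) (tower_enc eY b)))"
  unfolding partial_diff_quots_def
proof (intro conjI allI ballI)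
  let ?S = "\<lambda>j. subtopology (ubrs j (utop X eX rX)) (ubsets (utop X eX rX) (eX ` U) j)"
  let ?S' = "\<lambda>l. subtopology (ubrs l (utop Y eY rY)) (ubsets (utop Y eY rY) (eY ` V) l)"
  have k: "kcont P (prod_topology (?S j) (?S' l)) (utop E eE rE) (\<lambda>p (a, b). H j l p a b)" for j l
    using H by (simp add: Ufam_def)
  have top: "H j l p a b \<in> topspace (utop E eE rE)"
    if "p \<in> topspace P" "a \<in> ubsets (utop X eX rX) (eX ` U) j" "b \<in> ubsets (utop Y eY rY) (eY ` V) l" for j l p a b
    using kcont_maps[OF k that(1), of "(a, b)"] that(2,3) ubsets_subset[OF X U, of j] ubsets_subset[OF Y V, of l] by auto
  fix j l
  have "continuous_map (prod_topology (bracket_topology X U j) (bracket_topology Y V l)) (prod_topology (?S j) (?S' l))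
      (\<lambda>(a, b). (tower_enc eX a, tower_enc eY b))"
    using continuous_map_enc_bracket[OF X U] continuous_map_enc_bracket[OF Y V] by (simp add: continuous_map_prod_top)
  from kcont_postcompose[OF kcont_precompose[OF k this] continuous_map_embed(2)[OF E]]
  show "kcont P (prod_topology (bracket_topology X U j) (bracket_topology Y V l)) (topo E)
      (\<lambda>p (a, b). rE (H j l p (tower_enc eX a) (tower_enc eY b)))"
    by (simp add: case_prod_unfold)
  {
    fix p b assume p: "p \<in> topspace P" and "b \<in> bracket_set Y V l"
    then have b: "tower_enc eY b \<in> ubsets (utop Y eY rY) (eY ` V) l"
      using enc_bracket[OF Y V] bracket_set_subset[OF V] by blast
    have "dquot P (ubrs j (utop X eX rX)) (ubsets (utop X eX rX) (eX ` U) j)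
        (\<lambda>p a. H j l p a (tower_enc eY b)) (\<lambda>p a. H (Suc j) l p a (tower_enc eY b))"
      using H b unfolding Ufam_def by blast
    from tower_of_dquot[OF X U E this p top[OF p _ b] top[OF p _ b]]
    show "tower_dquot X U E j (\<lambda>a. rE (H j l p (tower_enc eX a) (tower_enc eY b)))
        (\<lambda>a. rE (H (Suc j) l p (tower_enc eX a) (tower_enc eY b)))" by blast
  next
    fix p a assume p: "p \<in> topspace P" and "a \<in> bracket_set X U j"
    then have a: "tower_enc eX a \<in> ubsets (utop X eX rX) (eX ` U) j"
      using enc_bracket[OF X U] bracket_set_subset[OF U] by blast
    have "dquot P (ubrs l (utop Y eY rY)) (ubsets (utop Y eY rY) (eY ` V) l)
        (\<lambda>p. H j l p (tower_enc eX a)) (\<lambda>p. H j (Suc l) p (tower_enc eX a))"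
      using H a unfolding Ufam_def by blast
    from tower_of_dquot[OF Y V E this p top[OF p a] top[OF p a]]
    show "tower_dquot Y V E l (\<lambda>b. rE (H j l p (tower_enc eX a) (tower_enc eY b)))
        (\<lambda>b. rE (H j (Suc l) p (tower_enc eX a) (tower_enc eY b)))" by blast
  }
qed

text \<open>From left to right this is \<open>Usm_imp_Ufam\<close>, from right to left the rule
  \<open>fam\<close>; the rest is transport along the embeddings.\<close>

lemma psmooth_prod_iff_embed:
  assumes U: "openin (topo X) U" and V: "openin (topo Y) V"
  shows "psmooth P (prod_tvs X Y) (U \<times> V) E f \<longleftrightarrow>
    (\<exists>H. partial_diff_quots P X U Y V E H \<and> (\<forall>p\<in>topspace P. \<forall>x\<in>U. \<forall>y\<in>V. H 0 0 p (Base x) (Base y) = f p (x, y)))"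
proof -
  have UV: "openin (topo (prod_tvs X Y)) (U \<times> V)"
    using U V by (simp add: prod_tvs_def openin_prod_Times_iff)
  have US: "U \<subseteq> topspace (topo X)" and VS: "V \<subseteq> topspace (topo Y)" using U V openin_subset by auto
  note sp = usp_utop[OF X] usp_utop[OF Y] usp_utop[OF E] openin_embed[OF X U] openin_embed[OF Y V]
  have iff: "psmooth P (prod_tvs X Y) (U \<times> V) E f \<longleftrightarrow>
    Usm P (uprod (utop X eX rX) (utop Y eY rY)) (ubox (utop X eX rX) (eX ` U) (utop Y eY rY) (eY ` V)) (utop E eE rE)
      (\<lambda>p u. eE (f p (rpair u)))"
    unfolding psmooth_iff_Usm[OF uembed_prod UV E] utop_prod epair_image[OF US VS] by (rule refl)
  have inv: "rX (eX x) = x" "rY (eY y) = y" "rE (eE z) = z" for x y z using X Y E by (auto simp: uembed_def)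
  show ?thesis
    unfolding iff
  proof
    assume "Usm P (uprod (utop X eX rX) (utop Y eY rY)) (ubox (utop X eX rX) (eX ` U) (utop Y eY rY) (eY ` V)) (utop E eE rE)
      (\<lambda>p u. eE (f p (rpair u)))"
    from Usm_imp_Ufam[OF sp this] obtain H where H: "Ufam P (utop X eX rX) (eX ` U) (utop Y eY rY) (eY ` V) (utop E eE rE) H"
      "\<And>p a b. \<lbrakk>a \<in> eX ` U; b \<in> eY ` V\<rbrakk> \<Longrightarrow> H 0 0 p a b = eE (f p (rpair (upair a b)))" by blast
    from partial_of_Ufam[OF US VS H(1)] show "\<exists>H. partial_diff_quots P X U Y V E H \<and>
        (\<forall>p\<in>topspace P. \<forall>x\<in>U. \<forall>y\<in>V. H 0 0 p (Base x) (Base y) = f p (x, y))"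
      by (rule_tac exI, rule_tac conjI) (assumption, simp add: H(2) inv rpair_def)
  next
    assume "\<exists>H. partial_diff_quots P X U Y V E H \<and>
        (\<forall>p\<in>topspace P. \<forall>x\<in>U. \<forall>y\<in>V. H 0 0 p (Base x) (Base y) = f p (x, y))"
    then obtain H where H: "partial_diff_quots P X U Y V E H"
       "\<And>p x y. \<lbrakk>p \<in> topspace P; x \<in> U; y \<in> V\<rbrakk> \<Longrightarrow> H 0 0 p (Base x) (Base y) = f p (x, y)" by blast
    from Usm.fam[OF sp Ufam_of_partial[OF US VS H(1)]]
    show "Usm P (uprod (utop X eX rX) (utop Y eY rY)) (ubox (utop X eX rX) (eX ` U) (utop Y eY rY) (eY ` V)) (utop E eE rE)
      (\<lambda>p u. eE (f p (rpair u)))"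
      by (rule Usm.congr) (auto simp: H(2) inv rpair_def)
  qed
qed

lemma psmooth_map_prod_embed:
  assumes U: "openin (topo X) U" and V: "openin (topo Y) V"
    and \<phi>: "psmooth P X U X (\<lambda>_. \<phi>)" and \<psi>: "psmooth P Y V Y (\<lambda>_. \<psi>)"
  shows "psmooth P (prod_tvs X Y) (U \<times> V) (prod_tvs X Y) (\<lambda>_ (x, y). (\<phi> x, \<psi> y))"
proof -
  have UV: "openin (topo (prod_tvs X Y)) (U \<times> V)"
    using U V by (simp add: prod_tvs_def openin_prod_Times_iff)
  have US: "U \<subseteq> topspace (topo X)" and VS: "V \<subseteq> topspace (topo Y)" using U V openin_subset by auto
  let ?\<sigma> = "utop X eX rX" and ?\<sigma>' = "utop Y eY rY"
  note B = openin_ubox[OF openin_embed[OF X U] openin_embed[OF Y V]]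
  have 1: "Usm P (uprod ?\<sigma> ?\<sigma>') (ubox ?\<sigma> (eX ` U) ?\<sigma>' (eY ` V)) ?\<sigma> (\<lambda>_ u. eX (\<phi> (rX (ufst u))))"
    by (rule Usm.comp[OF iffD1[OF psmooth_iff_Usm[OF X U X] \<phi>] Usm_proj(1)[OF usp_utop[OF X] usp_utop[OF Y] B]]) auto
  have 2: "Usm P (uprod ?\<sigma> ?\<sigma>') (ubox ?\<sigma> (eX ` U) ?\<sigma>' (eY ` V)) ?\<sigma>' (\<lambda>_ u. eY (\<psi> (rY (usnd u))))"
    by (rule Usm.comp[OF iffD1[OF psmooth_iff_Usm[OF Y V Y] \<psi>] Usm_proj(2)[OF usp_utop[OF X] usp_utop[OF Y] B]]) auto
  show ?thesis
    unfolding psmooth_iff_Usm[OF uembed_prod UV uembed_prod] utop_prod epair_image[OF US VS]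
    by (rule Usm.congr[OF Usm.pair[OF 1 2]]) (simp add: epair_def rpair_def)
qed

lemma psmooth_comp_embed:
  assumes U: "openin (topo X) U" and V: "openin (topo Y) V"
    and f: "psmooth P Y V E f" and \<phi>: "psmooth P X U Y (\<lambda>_. \<phi>)" and im: "\<phi> ` U \<subseteq> V"
  shows "psmooth P X U E (\<lambda>p x. f p (\<phi> x))"
proof -
  have inv: "rX (eX x) = x" "rY (eY y) = y" for x y using X Y by (auto simp: uembed_def)
  have "Usm P (utop X eX rX) (eX ` U) (utop E eE rE) (\<lambda>p x. eE (f p (rY (eY (\<phi> (rX x))))))"
    by (rule Usm.comp[OF iffD1[OF psmooth_iff_Usm[OF Y V E] f] iffD1[OF psmooth_iff_Usm[OF X U Y] \<phi>]])
      (use im in \<open>auto simp: inv\<close>)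
  then show ?thesis unfolding psmooth_iff_Usm[OF X U E] inv .
qed

lemma psmooth_Union_embed:
  assumes U: "\<And>U. U \<in> \<U> \<Longrightarrow> openin (topo X) U" and f: "\<And>U. U \<in> \<U> \<Longrightarrow> psmooth P X U E f"
  shows "psmooth P X (\<Union>\<U>) E f"
proof -
  have 1: "openin (topo X) (\<Union>\<U>)" using U by blast
  have "Usm P (utop X eX rX) (\<Union>((`) eX ` \<U>)) (utop E eE rE) (\<lambda>p u. eE (f p (rX u)))"
    by (rule Usm.cover[OF usp_utop[OF X] usp_utop[OF E]])
      (use U f psmooth_iff_Usm[OF X _ E] openin_embed[OF X] in blast)
  then show ?thesis unfolding psmooth_iff_Usm[OF X 1 E] by (simp add: image_Union)
qed

lemma psmooth_add_embed:
  assumes U: "openin (topo X) U" and f: "psmooth P X U E f" and g: "psmooth P X U E g"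
  shows "psmooth P X U E (\<lambda>p x. f p x + g p x)"
proof -
  have e: "eE (a + b) = eE a + eE b" for a b using E by (simp add: uembed_def)
  show ?thesis
    unfolding psmooth_iff_Usm[OF X U E] e
    by (rule Usm_add[OF iffD1[OF psmooth_iff_Usm[OF X U E] f] iffD1[OF psmooth_iff_Usm[OF X U E] g] usp_utop[OF E]])
qed

lemma psmooth_scale_embed:
  assumes U: "openin (topo X) U" and f: "psmooth P X U E f" and c: "continuous_map P euclidean c"
  shows "psmooth P X U E (\<lambda>p x. scl E (c p) (f p x))"
proof -
  have e: "eE (scl E t a) = us t (eE a)" for t a using E by (simp add: uembed_def)
  have "continuous_map P uscalars (\<lambda>p. uscal (c p) :: ('b, 'k) un)"
    by (rule continuous_map_compose'[OF c continuous_map_uscal])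
  from Usm.smul[OF Usm.param[OF usp_utop[OF X] usp_uscalars openin_embed[OF X U] this] iffD1[OF psmooth_iff_Usm[OF X U E] f]]
  show ?thesis unfolding psmooth_iff_Usm[OF X U E] e un_inverse .
qed

end

end

text \<open>The results on \<open>Usm\<close> involve at most three spaces at a time. Their product
  serves as the vector space of labels in the universal space, into which each of them is embedded
  as a coordinate subspace.\<close>

locale tvs_triple =
  fixes X :: "('k::topological_field, 'v::ab_group_add) tvs" and Y :: "('k, 'w::ab_group_add) tvs"
    and E :: "('k, 'e::ab_group_add) tvs"
  assumes X: "is_tvs X" and Y: "is_tvs Y" and E: "is_tvs E"
begin

sublocale universe "scl (prod_tvs X (prod_tvs Y E))"
  unfolding universe_def by (intro is_tvsD(1) is_tvs_prod X Y E)

lemma embeddings: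
  "uembed X (\<lambda>x. ubase (x, 0, 0)) (\<lambda>u. fst (ubase_of u))"
  "uembed Y (\<lambda>y. ubase (0, y, 0)) (\<lambda>u. fst (snd (ubase_of u)))"
  "uembed E (\<lambda>z. ubase (0, 0, z)) (\<lambda>u. snd (snd (ubase_of u)))"
proof -
  interpret X: vector_space "scl X" using is_tvsD(1)[OF X] .
  interpret Y: vector_space "scl Y" using is_tvsD(1)[OF Y] .
  interpret E: vector_space "scl E" using is_tvsD(1)[OF E] .
  show "uembed X (\<lambda>x. ubase (x, 0, 0)) (\<lambda>u. fst (ubase_of u))"
    "uembed Y (\<lambda>y. ubase (0, y, 0)) (\<lambda>u. fst (snd (ubase_of u)))"
    "uembed E (\<lambda>z. ubase (0, 0, z)) (\<lambda>u. snd (snd (ubase_of u)))"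
    using X Y E unfolding uembed_def us_constr by (simp_all add: prod_tvs_def flip: ubase_add)
qed

lemmas psmooth_prod_iff = psmooth_prod_iff_embed[OF embeddings]
  and psmooth_map_prod = psmooth_map_prod_embed[OF embeddings]
  and psmooth_comp = psmooth_comp_embed[OF embeddings]
  and psmooth_Union = psmooth_Union_embed[OF embeddings]
  and psmooth_add = psmooth_add_embed[OF embeddings]
  and psmooth_scale = psmooth_scale_embed[OF embeddings]

end

section \<open>Smoothness in terms of the bracket maps\<close>

lemma line_0:
  assumes "is_tvs E"
  shows "\<lbrakk>x \<in> topspace (tower_topology E j); y \<in> topspace (tower_topology E j)\<rbrakk> \<Longrightarrow> line E x y 0 = x"
proof (induction j arbitrary: x y)
  case 0
  interpret vector_space "scl E" using is_tvsD(1)[OF assms] .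
  show ?case using 0 by (auto simp: topspace_tower_0 simp del: tower_topology.simps)
next
  case (Suc j)
  then show ?case by (auto simp: topspace_tower_Suc simp del: tower_topology.simps)
qed

context universe
begin

context
  fixes Z :: "('k, 'z::ab_group_add) tvs" and e r
  assumes emb: "uembed Z e r"
begin

lemma Hausdorff_tower_embed: "Hausdorff_space (tower_topology Z j)"
proof (rule Hausdorff_space_injective_preimage[OF _ continuous_map_enc[OF emb]])
  show "Hausdorff_space (ubrs j (utop Z e r))" by (intro uspD(1) usp_ubrs usp_utop[OF emb])
  show "inj_on (tower_enc e) (topspace (tower_topology Z j))"
    by (rule inj_on_inverseI[of _ "tower_dec r j"]) (rule dec_enc[OF emb])
qed

lemma tower_unique_embed:
  assumes U: "openin (topo Z) U" and F: "uembed F eF rF"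
    and h: "continuous_map (bracket_topology Z U (Suc j)) (topo F) h"
    and h': "continuous_map (bracket_topology Z U (Suc j)) (topo F) h'"
    and eq: "\<And>x y t. \<lbrakk>Step x y t \<in> bracket_set Z U (Suc j); t \<noteq> 0\<rbrakk> \<Longrightarrow> h (Step x y t) = h' (Step x y t)"
    and w: "w \<in> bracket_set Z U (Suc j)"
  shows "h w = h' w"
proof -
  have US: "U \<subseteq> topspace (topo Z)" by (rule openin_subset[OF U])
  let ?S = "subtopology (ubr (ubrs j (utop Z e r))) (ubset (ubrs j (utop Z e r)) (ubsets (utop Z e r) (e ` U) j))"
  have dec: "continuous_map ?S (bracket_topology Z U (Suc j)) (tower_dec r (Suc j))"
    using continuous_map_dec_bracket[OF emb US, of "Suc j"] by (simp only: ubrs.simps ubsets.simps)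
  have u: "tower_enc e w \<in> ubset (ubrs j (utop Z e r)) (ubsets (utop Z e r) (e ` U) j)"
    using enc_bracket[OF emb US, of w "Suc j"] w bracket_set_subset[OF US, of "Suc j"] by auto
  have "eF (h (tower_dec r (Suc j) (tower_enc e w))) = eF (h' (tower_dec r (Suc j) (tower_enc e w)))"
  proof (rule dquot_unique[where h = "\<lambda>u. eF (h (tower_dec r (Suc j) u))" and h' = "\<lambda>u. eF (h' (tower_dec r (Suc j) u))",
        OF usp_ubrs[OF usp_utop[OF emb]] usp_utop[OF F] openin_ubsets[OF usp_utop[OF emb] openin_embed[OF emb U]] _ _ _ u])
    show "continuous_map ?S (utop F eF rF) (\<lambda>u. eF (h (tower_dec r (Suc j) u)))"
      "continuous_map ?S (utop F eF rF) (\<lambda>u. eF (h' (tower_dec r (Suc j) u)))"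
      by (rule continuous_map_compose'[OF continuous_map_compose'[OF dec] continuous_map_embed(1)[OF F]], fact)+
    fix v assume v: "v \<in> ubset (ubrs j (utop Z e r)) (ubsets (utop Z e r) (e ` U) j)" "upar v \<noteq> 0"
    then have "tower_dec r (Suc j) v \<in> bracket_set Z U (Suc j)"
      by (intro dec_bracket[OF emb US]) simp
    from eq[OF this[unfolded tower_dec.simps] v(2)]
    show "eF (h (tower_dec r (Suc j) v)) = eF (h' (tower_dec r (Suc j) v))"
      by (simp only: tower_dec.simps)
  qed
  moreover have "tower_dec r (Suc j) (tower_enc e w) = w"
    using w bracket_set_subset[OF US] by (intro dec_enc[OF emb]) blast
  moreover have "rF (eF z) = z" for z using F by (simp add: uembed_def)
  ultimately show ?thesis by metis
qed

end

end

lemma Hausdorff_bracket: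
  assumes "is_tvs X"
  shows "Hausdorff_space (bracket_topology X U j)"
proof -
  interpret tvs_triple X X X using assms by unfold_locales
  show ?thesis unfolding bracket_topology_def
    by (intro Hausdorff_space_subtopology Hausdorff_tower_embed[OF embeddings(1)])
qed

lemma tower_unique:
  fixes X :: "('k::topological_field, 'v::ab_group_add) tvs" and F :: "('k, 'w::ab_group_add) tvs"
  assumes X: "is_tvs X" and F: "is_tvs F" and U: "openin (topo X) U"
    and h: "continuous_map (bracket_topology X U (Suc j)) (topo F) h"
    and h': "continuous_map (bracket_topology X U (Suc j)) (topo F) h'"
    and eq: "\<And>x y t. \<lbrakk>Step x y t \<in> bracket_set X U (Suc j); t \<noteq> 0\<rbrakk> \<Longrightarrow> h (Step x y t) = h' (Step x y t)"
    and w: "w \<in> bracket_set X U (Suc j)"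
  shows "h w = h' w"
proof -
  interpret tvs_triple X X F using X F by unfold_locales
  show ?thesis using tower_unique_embed[OF embeddings(1) U embeddings(3) h h' eq w] .
qed

text \<open>Induction on the order: if the choice made in \<open>bracket_map\<close> agrees with
  \<open>h j p\<close>, then \<open>h (Suc j) p\<close> witnesses that a continuous extension
  exists, so the chosen map is one as well, and by uniqueness the two coincide on the bracket
  set.\<close>

lemma bracket_map_eq:
  assumes X: "is_tvs X" and F: "is_tvs F" and U: "openin (topo X) U"
    and h: "diff_quots P X U F h" and p: "p \<in> topspace P" and h0: "\<And>x. x \<in> U \<Longrightarrow> h 0 p (Base x) = f x"
  shows "w \<in> bracket_set X U j \<Longrightarrow> bracket_map X U F f j w = h j p w"
    and "extends_diff_quot X U F j (bracket_map X U F f j) (h (Suc j) p)"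
proof -
  interpret F: vector_space "scl F" using is_tvsD(1)[OF F] .
  have US: "U \<subseteq> topspace (topo X)" by (rule openin_subset[OF U])
  have cont: "continuous_map (bracket_topology X U j) (topo F) (h j p)" for j
    using h p by (intro kcont_slice[of P]) (auto simp: diff_quots_def)
  have dq: "tower_dquot X U F j (h j p) (h (Suc j) p)" for j
    using h p unfolding diff_quots_def by blast
  have ext: "extends_diff_quot X U F j (bracket_map X U F f j) (h (Suc j) p)"
    if agree: "\<And>w. w \<in> bracket_set X U j \<Longrightarrow> bracket_map X U F f j w = h j p w" for j
    unfolding extends_diff_quot_def
  proof (intro conjI allI impI cont)
    fix x y t assume *: "Step x y t \<in> bracket_set X U (Suc j) \<and> t \<noteq> 0"
    then have m: "x \<in> bracket_set X U j" "line X x y t \<in> bracket_set X U j" by auto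
    have "scl F t (h (Suc j) p (Step x y t)) = h j p (line X x y t) - h j p x"
      using dq[of j] * unfolding tower_dquot_def by blast
    then have "scl F (inverse t) (scl F t (h (Suc j) p (Step x y t))) = scl F (inverse t) (h j p (line X x y t) - h j p x)"
      by simp
    then show "h (Suc j) p (Step x y t) = scl F (inverse t) (bracket_map X U F f j (line X x y t) - bracket_map X U F f j x)"
      using * by (simp add: agree[OF m(1)] agree[OF m(2)])
  qed
  have agree: "\<forall>w\<in>bracket_set X U j. bracket_map X U F f j w = h j p w" for j
  proof (induction j)
    case 0
    show ?case using h0 by auto
  next
    case (Suc j)
    then have e: "extends_diff_quot X U F j (bracket_map X U F f j) (h (Suc j) p)" using ext by blast
    then have e': "extends_diff_quot X U F j (bracket_map X U F f j) (bracket_map X U F f (Suc j))"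
      unfolding bracket_map.simps by (rule someI[of "\<lambda>h. extends_diff_quot X U F j (bracket_map X U F f j) h"])
    show ?case
    proof
      fix w assume w: "w \<in> bracket_set X U (Suc j)"
      show "bracket_map X U F f (Suc j) w = h (Suc j) p w"
        by (rule tower_unique[OF X F U _ _ _ w]) (use e e' in \<open>auto simp: extends_diff_quot_def\<close>)
    qed
  qed
  then show "w \<in> bracket_set X U j \<Longrightarrow> bracket_map X U F f j w = h j p w" by blast
  show "extends_diff_quot X U F j (bracket_map X U F f j) (h (Suc j) p)" using ext agree by blast
qed

lemma smooth_on_of_diff_quots:
  assumes X: "is_tvs X" and F: "is_tvs F" and U: "openin (topo X) U"
    and h: "diff_quots P X U F h" and p: "p \<in> topspace P" and h0: "\<And>x. x \<in> U \<Longrightarrow> h 0 p (Base x) = f x"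
  shows "smooth_on X U F f"
proof -
  have US: "U \<subseteq> topspace (topo X)" by (rule openin_subset[OF U])
  have cont: "continuous_map (bracket_topology X U j) (topo F) (h j p)" for j
    using h p by (intro kcont_slice[of P]) (auto simp: diff_quots_def)
  have "Ck_on k X U F f" for k
  proof (induction k)
    case 0
    have "continuous_map (subtopology (topo X) U) (bracket_topology X U 0) Base"
      unfolding bracket_topology_def
      by (intro continuous_map_into_subtopology continuous_map_Base continuous_map_from_subtopology) auto
    from continuous_map_compose'[OF this cont] have "continuous_map (subtopology (topo X) U) (topo F) (\<lambda>x. h 0 p (Base x))" .
    then have "continuous_map (subtopology (topo X) U) (topo F) f" by (rule continuous_map_eq) (use h0 in auto)
    then show ?case by simp
  next
    case (Suc k)
    have "continuous_map (bracket_topology X U k) (topo F) (bracket_map X U F f k)"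
      by (rule continuous_map_eq[OF cont]) (use bracket_map_eq(1)[OF X F U h p h0] topspace_bracket[OF US, of k] in simp)
    then show ?case using Suc bracket_map_eq(2)[OF X F U h p h0] by auto
  qed
  then show ?thesis by (simp add: smooth_on_def)
qed

text \<open>Smoothness guarantees that the choice in \<open>bracket_map\<close> succeeds at every
  order. The multiplicative equation at \<open>t = 0\<close> comes from
  \<open>line_0\<close>.\<close>

lemma smooth_on_bracket:
  assumes X: "is_tvs X" and F: "is_tvs F" and U: "U \<subseteq> topspace (topo X)" and f: "smooth_on X U F f"
  shows "continuous_map (bracket_topology X U j) (topo F) (bracket_map X U F f j)"
    and "tower_dquot X U F j (bracket_map X U F f j) (bracket_map X U F f (Suc j))"
proof -
  interpret F: vector_space "scl F" using is_tvsD(1)[OF F] .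
  have "Ck_on (Suc j) X U F f" using f by (simp only: smooth_on_def)
  then show "continuous_map (bracket_topology X U j) (topo F) (bracket_map X U F f j)"
    and "tower_dquot X U F j (bracket_map X U F f j) (bracket_map X U F f (Suc j))"
  proof -
    assume C: "Ck_on (Suc j) X U F f"
    then show "continuous_map (bracket_topology X U j) (topo F) (bracket_map X U F f j)" by simp
    have "\<exists>h. extends_diff_quot X U F j (bracket_map X U F f j) h" using C by simp
    then have e: "extends_diff_quot X U F j (bracket_map X U F f j) (bracket_map X U F f (Suc j))"
      unfolding bracket_map.simps by (rule someI_ex[of "\<lambda>h. extends_diff_quot X U F j (bracket_map X U F f j) h"])
    show "tower_dquot X U F j (bracket_map X U F f j) (bracket_map X U F f (Suc j))"
      unfolding tower_dquot_def
    proof (intro allI impI)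
      fix x y t assume s: "Step x y t \<in> bracket_set X U (Suc j)"
      then have "x \<in> topspace (tower_topology X j)" "y \<in> topspace (tower_topology X j)"
        using bracket_set_subset[OF U] by auto
      then have l: "line X x y 0 = x" by (rule line_0[OF X])
      show "scl F t (bracket_map X U F f (Suc j) (Step x y t)) = bracket_map X U F f j (line X x y t) - bracket_map X U F f j x"
      proof (cases "t = 0")
        case True then show ?thesis by (simp only: l F.scale_zero_left diff_self)
      next
        case False
        then have "bracket_map X U F f (Suc j) (Step x y t) = scl F (inverse t) (bracket_map X U F f j (line X x y t) - bracket_map X U F f j x)"
          using e s unfolding extends_diff_quot_def by blast
        then have "scl F t (bracket_map X U F f (Suc j) (Step x y t)) =
            scl F (t * inverse t) (bracket_map X U F f j (line X x y t) - bracket_map X U F f j x)"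
          by (simp only: F.scale_scale)
        moreover have "t * inverse t = 1" using False by simp
        ultimately show ?thesis by (simp only: F.scale_one)
      qed
    qed
  qed
qed

text \<open>Since quotients are unique, an arbitrary sequence can be exchanged for the bracket maps,
  which are the ones that define the topology on smooth maps.\<close>

lemma psmooth_iff_bracket_map:
  assumes X: "is_tvs X" and F: "is_tvs F" and U: "openin (topo X) U"
  shows "psmooth P X U F f \<longleftrightarrow> (\<forall>p\<in>topspace P. smooth_on X U F (f p)) \<and>
     (\<forall>j. kcont P (bracket_topology X U j) (topo F) (\<lambda>p. bracket_map X U F (f p) j))"
proof
  have US: "U \<subseteq> topspace (topo X)" by (rule openin_subset[OF U])
  {
    assume "psmooth P X U F f"
    then obtain h where h: "diff_quots P X U F h" "\<And>p x. \<lbrakk>p \<in> topspace P; x \<in> U\<rbrakk> \<Longrightarrow> h 0 p (Base x) = f p x"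
      unfolding psmooth_def by blast
    have "kcont P (bracket_topology X U j) (topo F) (\<lambda>p. bracket_map X U F (f p) j)" for j
    proof (rule kcont_cong)
      show "kcont P (bracket_topology X U j) (topo F) (h j)" using h(1) by (simp add: diff_quots_def)
      fix p w assume p: "p \<in> topspace P" and "w \<in> topspace (bracket_topology X U j)"
      then have "w \<in> bracket_set X U j" using topspace_bracket[OF US] by metis
      from bracket_map_eq(1)[OF X F U h(1) p h(2)[OF p] this] show "h j p w = bracket_map X U F (f p) j w" by simp
    qed
    then show "(\<forall>p\<in>topspace P. smooth_on X U F (f p)) \<and>
        (\<forall>j. kcont P (bracket_topology X U j) (topo F) (\<lambda>p. bracket_map X U F (f p) j))"
      using smooth_on_of_diff_quots[OF X F U h(1)] h(2) by metis
  next
    assume *: "(\<forall>p\<in>topspace P. smooth_on X U F (f p)) \<and>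
        (\<forall>j. kcont P (bracket_topology X U j) (topo F) (\<lambda>p. bracket_map X U F (f p) j))"
    then have "diff_quots P X U F (\<lambda>j p. bracket_map X U F (f p) j)"
      unfolding diff_quots_def using smooth_on_bracket(2)[OF X F US] by blast
    moreover have "bracket_map X U F (f p) 0 (Base x) = f p x" for p x by simp
    ultimately show "psmooth P X U F f" unfolding psmooth_def by blast
  }
qed

lemma psmooth_cong:
  assumes "psmooth P X U F f" "\<And>p x. \<lbrakk>p \<in> topspace P; x \<in> U\<rbrakk> \<Longrightarrow> f p x = g p x"
  shows "psmooth P X U F g"
proof -
  obtain h where "diff_quots P X U F h" "\<forall>p\<in>topspace P. \<forall>x\<in>U. h 0 p (Base x) = f p x"
    using assms(1) unfolding psmooth_def by blast
  then show ?thesis unfolding psmooth_def using assms(2) by (intro exI[of _ h]) simp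
qed

lemma psmooth_point:
  assumes X: "is_tvs X" and F: "is_tvs F" and U: "openin (topo X) U" and f: "smooth_on X U F f"
  shows "psmooth P X U F (\<lambda>_. f)"
  unfolding psmooth_iff_bracket_map[OF X F U]
  by (intro conjI ballI allI f kcont_point smooth_on_bracket(1)[OF X F openin_subset[OF U] f])

lemma smooth_on_iff_psmooth:
  assumes X: "is_tvs X" and F: "is_tvs F" and U: "openin (topo X) U"
  shows "smooth_on X U F f \<longleftrightarrow> psmooth (discrete_topology {()}) X U F (\<lambda>_. f)"
  using psmooth_point[OF X F U] psmooth_iff_bracket_map[OF X F U, of "discrete_topology {()}" "\<lambda>_. f"] by auto

lemma psmooth_slice:
  assumes "is_tvs X" "is_tvs F" "openin (topo X) U" "psmooth P X U F f" "p \<in> topspace P"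
  shows "smooth_on X U F (f p)"
  using assms(4,5) unfolding psmooth_iff_bracket_map[OF assms(1-3)] by blast

lemma psmooth_reparam:
  assumes f: "psmooth P X U F f" and c: "continuous_map P' P c"
  shows "psmooth P' X U F (\<lambda>p. f (c p))"
proof -
  obtain h where h: "diff_quots P X U F h" "\<forall>p\<in>topspace P. \<forall>x\<in>U. h 0 p (Base x) = f p x"
    using f unfolding psmooth_def by blast
  have im: "c p \<in> topspace P" if "p \<in> topspace P'" for p using c that continuous_map_funspace by blast
  have "diff_quots P' X U F (\<lambda>j p. h j (c p))"
    using h(1) kcont_reparam[OF _ c] im unfolding diff_quots_def by blast
  then show ?thesis using h(2) im unfolding psmooth_def by blast
qed

lemma psmooth_zero:
  assumes F: "is_tvs F"
  shows "psmooth P X U F (\<lambda>_ _. 0)"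
proof -
  interpret F: vector_space "scl F" using is_tvsD(1)[OF F] .
  have "diff_quots P X U F (\<lambda>_ _ _. 0)"
    unfolding diff_quots_def tower_dquot_def
    by (auto intro!: kcont_point simp: is_tvsD(3)[OF F])
  then show ?thesis unfolding psmooth_def by (intro exI[of _ "\<lambda>_ _ _. 0"]) simp
qed

text \<open>A single point is a compact set, and over it \<open>kcont\<close> is joint continuity
  with all of \<open>P\<close>.\<close>

lemma psmooth_eval:
  assumes X: "is_tvs X" and U: "U \<subseteq> topspace (topo X)" and f: "psmooth P X U F f" and x: "x \<in> U"
  shows "continuous_map P (topo F) (\<lambda>p. f p x)"
proof -
  obtain h where h: "diff_quots P X U F h" "\<And>p x. \<lbrakk>p \<in> topspace P; x \<in> U\<rbrakk> \<Longrightarrow> h 0 p (Base x) = f p x"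
    using f unfolding psmooth_def by blast
  have k: "kcont P (bracket_topology X U 0) (topo F) (h 0)" using h(1) unfolding diff_quots_def by blast
  have b: "Base x \<in> topspace (bracket_topology X U 0)" using topspace_bracket[OF U, of 0] x by auto
  then have "compactin (bracket_topology X U 0) {Base x}" by simp
  from kcont_compact[OF k this]
  have 1: "continuous_map (prod_topology P (subtopology (bracket_topology X U 0) {Base x})) (topo F) (\<lambda>(p, w). h 0 p w)" .
  have "continuous_map P (prod_topology P (subtopology (bracket_topology X U 0) {Base x})) (\<lambda>p. (p, Base x))"
    using b by (simp add: continuous_map_pairwise o_def)
  from continuous_map_compose'[OF this 1] have "continuous_map P (topo F) (\<lambda>p. h 0 p (Base x))" by simp
  then show ?thesis by (rule continuous_map_eq) (simp add: h(2) x)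
qed

text \<open>The hypothesis has the form of a difference quotient in a space of functions. Scaling
  the bracket maps of \<open>k\<close> and subtracting those of \<open>g\<close> from those of
  \<open>f\<close> give two sequences of quotients of \<open>f - g\<close>, which coincide by
  uniqueness.\<close>

lemma bracket_map_linear:
  assumes X: "is_tvs X" and F: "is_tvs F" and U: "openin (topo X) U"
    and f: "smooth_on X U F f" and g: "smooth_on X U F g" and k: "smooth_on X U F k"
    and eq: "\<And>x. x \<in> U \<Longrightarrow> scl F t (k x) = f x - g x" and w: "w \<in> bracket_set X U j"
  shows "scl F t (bracket_map X U F k j w) = bracket_map X U F f j w - bracket_map X U F g j w"
proof -
  interpret F: vector_space "scl F" using is_tvsD(1)[OF F] .
  have US: "U \<subseteq> topspace (topo X)" by (rule openin_subset[OF U])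
  let ?P = "discrete_topology {()}"
  note c = smooth_on_bracket(1)[OF X F US] and d = smooth_on_bracket(2)[OF X F US]
  have 1: "diff_quots ?P X U F (\<lambda>j _ w. scl F t (bracket_map X U F k j w))"
    unfolding diff_quots_def tower_dquot_def
  proof (intro allI conjI ballI impI)
    show "kcont ?P (bracket_topology X U j) (topo F) (\<lambda>_ w. scl F t (bracket_map X U F k j w))" for j
      by (intro kcont_point continuous_map_tvs_scl[OF F] c k) simp
    fix j x y s assume "Step x y s \<in> bracket_set X U (Suc j)"
    then have "scl F s (bracket_map X U F k (Suc j) (Step x y s)) = bracket_map X U F k j (line X x y s) - bracket_map X U F k j x"
      using d[OF k, of j] unfolding tower_dquot_def by blast
    then show "scl F s (scl F t (bracket_map X U F k (Suc j) (Step x y s))) =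
        scl F t (bracket_map X U F k j (line X x y s)) - scl F t (bracket_map X U F k j x)"
      by (metis F.scale_left_commute F.scale_right_diff_distrib)
  qed
  have 2: "diff_quots ?P X U F (\<lambda>j _ w. bracket_map X U F f j w - bracket_map X U F g j w)"
    unfolding diff_quots_def tower_dquot_def
  proof (intro allI conjI ballI impI)
    show "kcont ?P (bracket_topology X U j) (topo F) (\<lambda>_ w. bracket_map X U F f j w - bracket_map X U F g j w)" for j
      by (intro kcont_point continuous_map_tvs_diff[OF F] c f g)
    fix j x y s assume s: "Step x y s \<in> bracket_set X U (Suc j)"
    have "scl F s (bracket_map X U F f (Suc j) (Step x y s)) = bracket_map X U F f j (line X x y s) - bracket_map X U F f j x"
      "scl F s (bracket_map X U F g (Suc j) (Step x y s)) = bracket_map X U F g j (line X x y s) - bracket_map X U F g j x"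
      using d[OF f, of j] d[OF g, of j] s unfolding tower_dquot_def by blast+
    then show "scl F s (bracket_map X U F f (Suc j) (Step x y s) - bracket_map X U F g (Suc j) (Step x y s)) =
        bracket_map X U F f j (line X x y s) - bracket_map X U F g j (line X x y s) -
        (bracket_map X U F f j x - bracket_map X U F g j x)"
      by (simp only: F.scale_right_diff_distrib) (simp only: algebra_simps)
  qed
  have e1: "bracket_map X U F (\<lambda>x. f x - g x) j w = scl F t (bracket_map X U F k j w)"
    by (rule bracket_map_eq(1)[OF X F U 1 _ _ w]) (simp_all add: eq)
  have e2: "bracket_map X U F (\<lambda>x. f x - g x) j w = bracket_map X U F f j w - bracket_map X U F g j w"
    by (rule bracket_map_eq(1)[OF X F U 2 _ _ w]) simp_all
  show ?thesis using e1 e2 by metis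
qed

text \<open>The meeting point of smooth families and function spaces: \<open>kcont\<close> of all
  bracket maps is continuity into the compact-open topologies, because bracket sets are Hausdorff,
  and hence into the initial topology. The extension by \<open>0\<close> occurs because members of
  the function space are normalised.\<close>

lemma continuous_map_smooth_topology_on:
  assumes X: "is_tvs X" and F: "is_tvs F" and U: "openin (topo X) U"
  shows "continuous_map P (smooth_topology_on X U F) (\<lambda>p. zero_outside U (f p)) \<longleftrightarrow> psmooth P X U F f"
proof -
  let ?z = "\<lambda>p. zero_outside U (f p)"
  have US: "U \<subseteq> topspace (topo X)" by (rule openin_subset[OF U])
  have zz: "zero_outside U (?z p) = ?z p" for p by (simp add: zero_outside_def fun_eq_iff)
  have "psmooth P X U F f \<longleftrightarrow> psmooth P X U F ?z"
    using psmooth_cong[of P X U F f ?z] psmooth_cong[of P X U F ?z f] by (auto simp: zero_outside_def)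
  also have "\<dots> \<longleftrightarrow> (\<forall>p\<in>topspace P. smooth_on X U F (?z p)) \<and>
     (\<forall>j. kcont P (bracket_topology X U j) (topo F) (\<lambda>p. bracket_map X U F (?z p) j))"
    by (rule psmooth_iff_bracket_map[OF X F U])
  also have "\<dots> \<longleftrightarrow> (\<forall>p\<in>topspace P. smooth_on X U F (?z p)) \<and>
     (\<forall>j. continuous_map P (compact_open_topology (bracket_topology X U j) (topo F)) (\<lambda>p. bracket_map X U F (?z p) j))"
    using kcont_compact_open[OF Hausdorff_bracket[OF X]] continuous_map_compact_open by blast
  also have "\<dots> \<longleftrightarrow> (\<forall>p\<in>topspace P. smooth_on X U F (?z p)) \<and>
     (\<forall>j. \<forall>W. openin (compact_open_topology (bracket_topology X U j) (topo F)) W \<longrightarrow>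
        openin P {p \<in> topspace P. bracket_map X U F (?z p) j \<in> W})"
    using smooth_on_bracket(1)[OF X F US]
    unfolding continuous_map_def[of P] topspace_compact_open_topology Pi_iff mem_Collect_eq by blast
  also have "\<dots> \<longleftrightarrow> continuous_map P (smooth_topology_on X U F) ?z"
    unfolding smooth_topology_on_def continuous_map_initial_topology using zz by auto
  finally show ?thesis by blast
qed

section \<open>Manifolds and spaces of smooth maps\<close>

definition psmooth_map ::
  "'p topology \<Rightarrow> ('k::topological_field, 'v::ab_group_add, 'm) mfd \<Rightarrow> ('k, 'e::ab_group_add) tvs \<Rightarrow>
     ('p \<Rightarrow> 'm \<Rightarrow> 'e) \<Rightarrow> bool" where
  "psmooth_map P M E f \<longleftrightarrow>
     (\<forall>(U, \<kappa>) \<in> charts M. psmooth P (model M) (\<kappa> ` U) E (\<lambda>p. f p \<circ> inv_into U \<kappa>))"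

lemma is_chartD:
  assumes "is_chart M (U, \<kappa>)"
  shows "openin (space_of M) U" "openin (topo (model M)) (\<kappa> ` U)" "inj_on \<kappa> U"
    "\<And>W. openin (space_of M) W \<Longrightarrow> openin (topo (model M)) (\<kappa> ` (U \<inter> W))"
proof -
  have U: "openin (space_of M) U" and \<kappa>U: "openin (topo (model M)) (\<kappa> ` U)"
    and h: "homeomorphic_map (subtopology (space_of M) U) (subtopology (topo (model M)) (\<kappa> ` U)) \<kappa>"
    using assms by (auto simp: is_chart_def)
  show "openin (space_of M) U" "openin (topo (model M)) (\<kappa> ` U)" by fact+
  have US: "U \<subseteq> topspace (space_of M)" by (rule openin_subset[OF U])
  then show "inj_on \<kappa> U" using homeomorphic_imp_injective_map[OF h] by (simp add: Int_absorb1)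
  fix W assume W: "openin (space_of M) W"
  then have "openin (subtopology (space_of M) U) (U \<inter> W)" by (rule openin_subtopology_Int2)
  then have "openin (subtopology (topo (model M)) (\<kappa> ` U)) (\<kappa> ` (U \<inter> W))"
    using homeomorphic_map_openness[OF h, of "U \<inter> W"] US by auto
  then show "openin (topo (model M)) (\<kappa> ` (U \<inter> W))" using \<kappa>U openin_trans_full by blast
qed

lemma chartsD: "(U, \<kappa>) \<in> charts M \<Longrightarrow> is_chart M (U, \<kappa>)"
  by (simp add: charts_def)

lemma is_mfdD:
  assumes "is_mfd M"
  shows "is_tvs (model M)" "atlas M \<subseteq> charts M" "(\<Union>c \<in> atlas M. fst c) = topspace (space_of M)"
    "Hausdorff_space (space_of M)" "\<And>c. c \<in> atlas M \<Longrightarrow> is_chart M c"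
    "\<And>c d. \<lbrakk>c \<in> atlas M; d \<in> atlas M\<rbrakk> \<Longrightarrow> smooth_transition M c d"
  using assms by (auto simp: is_mfd_def charts_def)

text \<open>A chart \<open>\<kappa>\<close> of the maximal atlas is cut along the charts
  \<open>\<mu>\<close> of the given one. On each piece the local representative is the one in
  \<open>\<mu>\<close>, composed with the transition map from \<open>\<kappa>\<close> to
  \<open>\<mu>\<close>, and the pieces are glued by \<open>psmooth_Union\<close>.\<close>

lemma psmooth_map_atlas:
  fixes M :: "('k::topological_field, 'v::ab_group_add, 'm) mfd" and E :: "('k, 'e::ab_group_add) tvs"
  assumes M: "is_mfd M" and E: "is_tvs E"
    and f: "\<And>U \<mu>. (U, \<mu>) \<in> atlas M \<Longrightarrow> psmooth P (model M) (\<mu> ` U) E (\<lambda>p. f p \<circ> inv_into U \<mu>)"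
  shows "psmooth_map P M E f"
  unfolding psmooth_map_def
proof safe
  fix W \<kappa> assume c: "(W, \<kappa>) \<in> charts M"
  note X = is_mfdD(1)[OF M] and W = is_chartD[OF chartsD[OF c]]
  interpret tvs_triple "model M" "model M" E using X E by unfold_locales
  let ?\<U> = "(\<lambda>c. \<kappa> ` (W \<inter> fst c)) ` atlas M"
  have "W \<subseteq> (\<Union>c \<in> atlas M. fst c)" using openin_subset[OF W(1)] is_mfdD(3)[OF M] by simp
  then have cov: "\<Union>?\<U> = \<kappa> ` W" by blast
  have "psmooth P (model M) (\<Union>?\<U>) E (\<lambda>p. f p \<circ> inv_into W \<kappa>)"
  proof (rule psmooth_Union; clarsimp)
    fix U \<mu> assume a: "(U, \<mu>) \<in> atlas M"
    note U = is_chartD[OF is_mfdD(5)[OF M a]]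
    show o: "openin (topo (model M)) (\<kappa> ` (W \<inter> U))" by (rule W(4)[OF U(1)])
    have "smooth_transition M (W, \<kappa>) (U, \<mu>)" using c a by (auto simp: charts_def)
    then have "smooth_on (model M) (\<kappa> ` (W \<inter> U)) (model M) (\<mu> \<circ> inv_into W \<kappa>)" by (simp add: smooth_transition_def)
    from psmooth_comp[OF o U(2) f[OF a] psmooth_point[OF X X o this]]
    show "psmooth P (model M) (\<kappa> ` (W \<inter> U)) E (\<lambda>p. f p \<circ> inv_into W \<kappa>)"
      by (rule psmooth_cong) (use W(3) U(3) in auto)
  qed
  then show "psmooth P (model M) (\<kappa> ` W) E (\<lambda>p. f p \<circ> inv_into W \<kappa>)" by (simp only: cov)
qed

lemma psmooth_map_chart:
  assumes "is_mfd M" "psmooth_map P M E f" "(U, \<kappa>) \<in> atlas M"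
  shows "psmooth P (model M) (\<kappa> ` U) E (\<lambda>p. f p \<circ> inv_into U \<kappa>)"
  using assms is_mfdD(2) unfolding psmooth_map_def by blast

lemma psmooth_map_slice:
  assumes M: "is_mfd M" and E: "is_tvs E" and f: "psmooth_map P M E f" and p: "p \<in> topspace P"
  shows "smooth_map M E (f p)"
  unfolding smooth_map_def
proof safe
  fix U \<kappa> assume c: "(U, \<kappa>) \<in> charts M"
  then have "psmooth P (model M) (\<kappa> ` U) E (\<lambda>p. f p \<circ> inv_into U \<kappa>)" using f unfolding psmooth_map_def by blast
  from psmooth_slice[OF is_mfdD(1)[OF M] E is_chartD(2)[OF chartsD[OF c]] this p]
  show "smooth_on (model M) (\<kappa> ` U) E (f p \<circ> inv_into U \<kappa>)" .
qed

lemma smooth_map_iff_psmooth_map: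
  assumes M: "is_mfd M" and E: "is_tvs E"
  shows "smooth_map M E f \<longleftrightarrow> psmooth_map (discrete_topology {()}) M E (\<lambda>_. f)"
proof
  assume f: "smooth_map M E f"
  show "psmooth_map (discrete_topology {()}) M E (\<lambda>_. f)"
    unfolding psmooth_map_def
  proof safe
    fix U \<kappa> assume c: "(U, \<kappa>) \<in> charts M"
    then have "smooth_on (model M) (\<kappa> ` U) E (f \<circ> inv_into U \<kappa>)" using f by (auto simp: smooth_map_def)
    then show "psmooth (discrete_topology {()}) (model M) (\<kappa> ` U) E (\<lambda>_. f \<circ> inv_into U \<kappa>)"
      by (rule psmooth_point[OF is_mfdD(1)[OF M] E is_chartD(2)[OF chartsD[OF c]]])
  qed
next
  assume "psmooth_map (discrete_topology {()}) M E (\<lambda>_. f)"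
  from psmooth_map_slice[OF M E this] show "smooth_map M E f" by simp
qed

lemma psmooth_map_reparam:
  assumes "psmooth_map P M E f" "continuous_map P' P c"
  shows "psmooth_map P' M E (\<lambda>p. f (c p))"
  using assms psmooth_reparam unfolding psmooth_map_def by fast

section \<open>Continuity into spaces of smooth maps\<close>

lemma topspace_smooth_space:
  "topspace (topo (smooth_space N E)) = {f. smooth_map N E f \<and> zero_outside (topspace (space_of N)) f = f}"
  by (simp add: smooth_space_def)

text \<open>Universal property of the space of smooth maps, obtained chart by chart from
  \<open>continuous_map_smooth_topology_on\<close>. All continuity statements on function spaces
  below are proved through it.\<close>

lemma continuous_map_smooth_space:
  assumes N: "is_mfd N" and E: "is_tvs E"
    and z: "\<And>p. p \<in> topspace P \<Longrightarrow> zero_outside (topspace (space_of N)) (f p) = f p"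
  shows "continuous_map P (topo (smooth_space N E)) f \<longleftrightarrow> psmooth_map P N E f"
proof -
  let ?z = "\<lambda>U \<kappa> p. zero_outside (\<kappa> ` U) (f p \<circ> inv_into U \<kappa>)"
  have ct: "continuous_map P (smooth_topology_on (model N) (\<kappa> ` U) E) (?z U \<kappa>) \<longleftrightarrow>
      psmooth P (model N) (\<kappa> ` U) E (\<lambda>p. f p \<circ> inv_into U \<kappa>)" if "(U, \<kappa>) \<in> charts N" for U \<kappa>
    by (rule continuous_map_smooth_topology_on[OF is_mfdD(1)[OF N] E is_chartD(2)[OF chartsD[OF that]]])
  have mem: "?z U \<kappa> p \<in> topspace (smooth_topology_on (model N) (\<kappa> ` U) E)"
    if "smooth_map N E (f p)" "(U, \<kappa>) \<in> charts N" for U \<kappa> p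
  proof -
    have "smooth_on (model N) (\<kappa> ` U) E (f p \<circ> inv_into U \<kappa>)" using that by (auto simp: smooth_map_def)
    from psmooth_point[OF is_mfdD(1)[OF N] E is_chartD(2)[OF chartsD[OF that(2)]] this, of "discrete_topology {()}"]
    have "psmooth (discrete_topology {()}) (model N) (\<kappa> ` U) E (\<lambda>_. zero_outside (\<kappa> ` U) (f p \<circ> inv_into U \<kappa>))"
      by (rule psmooth_cong) (simp add: zero_outside_def)
    then have "smooth_on (model N) (\<kappa> ` U) E (?z U \<kappa> p)"
      using smooth_on_iff_psmooth[OF is_mfdD(1)[OF N] E is_chartD(2)[OF chartsD[OF that(2)]]] by blast
    then show ?thesis by (simp add: smooth_topology_on_def zero_outside_def fun_eq_iff)
  qed
  have "continuous_map P (topo (smooth_space N E)) f \<longleftrightarrow>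
     (\<forall>p\<in>topspace P. smooth_map N E (f p)) \<and>
     (\<forall>(U, \<kappa>)\<in>charts N. \<forall>W. openin (smooth_topology_on (model N) (\<kappa> ` U) E) W \<longrightarrow>
        openin P {p \<in> topspace P. ?z U \<kappa> p \<in> W})"
    unfolding smooth_space_def tvs.simps continuous_map_initial_topology using z
    by (auto simp: Pi_iff case_prod_unfold)
  also have "\<dots> \<longleftrightarrow> (\<forall>p\<in>topspace P. smooth_map N E (f p)) \<and>
     (\<forall>(U, \<kappa>)\<in>charts N. continuous_map P (smooth_topology_on (model N) (\<kappa> ` U) E) (?z U \<kappa>))"
    using mem unfolding continuous_map_def Pi_iff by blast
  also have "\<dots> \<longleftrightarrow> (\<forall>p\<in>topspace P. smooth_map N E (f p)) \<and> psmooth_map P N E f"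
    unfolding psmooth_map_def using ct by blast
  also have "\<dots> \<longleftrightarrow> psmooth_map P N E f" using psmooth_map_slice[OF N E, of P f] by blast
  finally show ?thesis .
qed

text \<open>The identity of the function space, read as a family with the function itself as
  parameter. Evaluations, the vector operations and the maps of the final isomorphism all come from
  this tautological family.\<close>

lemma psmooth_map_ident:
  assumes N: "is_mfd N" and E: "is_tvs E"
  shows "psmooth_map (topo (smooth_space N E)) N E (\<lambda>g. g)"
  using continuous_map_smooth_space[OF N E, of "topo (smooth_space N E)" "\<lambda>g. g"]
  by (simp add: topspace_smooth_space)

lemma psmooth_map_eval:
  assumes N: "is_mfd N" and f: "psmooth_map P N E f" and y: "y \<in> topspace (space_of N)"
  shows "continuous_map P (topo E) (\<lambda>p. f p y)"
proof -
  obtain U \<kappa> where a: "(U, \<kappa>) \<in> atlas N" "y \<in> U" using is_mfdD(3)[OF N] y by fastforce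
  note c = is_chartD[OF is_mfdD(5)[OF N a(1)]]
  from psmooth_eval[OF is_mfdD(1)[OF N] openin_subset[OF c(2)] psmooth_map_chart[OF N f a(1)] imageI[OF a(2)]]
  show ?thesis by (simp add: inv_into_f_f[OF c(3) a(2)])
qed

text \<open>By the universal property, continuity of the operations means that sums and multiples,
  parametrised by the operands, are smooth families; this follows from the tautological family.
  Functions are separated by evaluations, which are continuous, so the space is Hausdorff.\<close>

lemma is_tvs_smooth_space:
  fixes N :: "('k::topological_field, 'w::ab_group_add, 'n) mfd" and E :: "('k, 'e::ab_group_add) tvs"
  assumes N: "is_mfd N" and E: "is_tvs E"
  shows "is_tvs (smooth_space N E)"
proof (rule is_tvsI)
  interpret E: vector_space "scl E" using is_tvsD(1)[OF E] .
  interpret tvs_triple "model N" "model N" E using is_mfdD(1)[OF N] E by unfold_locales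
  let ?G = "topo (smooth_space N E)" and ?Z = "zero_outside (topspace (space_of N)) :: ('n \<Rightarrow> 'e) \<Rightarrow> _"
  have scl: "scl (smooth_space N E) c f = (\<lambda>x. scl E c (f x))" for c f by (simp add: smooth_space_def)
  have z: "?Z f = f" if "f \<in> topspace ?G" for f using that by (simp add: topspace_smooth_space)
  have z0: "f x = 0" if "f \<in> topspace ?G" "x \<notin> topspace (space_of N)" for f x
    using z[OF that(1)] that(2) unfolding zero_outside_def fun_eq_iff by metis
  have zI: "?Z f = f" if "\<And>x. x \<notin> topspace (space_of N) \<Longrightarrow> f x = 0" for f :: "'n \<Rightarrow> 'e"
    using that by (auto simp: zero_outside_def fun_eq_iff)
  show "vector_space (scl (smooth_space N E))"
    unfolding scl by unfold_locales (auto simp: fun_eq_iff E.scale_right_distrib E.scale_left_distrib)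
  note id = psmooth_map_ident[OF N E]
  show "Hausdorff_space ?G"
    unfolding Hausdorff_space_def
  proof (intro allI impI, elim conjE)
    fix f g assume fg: "f \<in> topspace ?G" "g \<in> topspace ?G" "f \<noteq> g"
    then obtain y where y: "f y \<noteq> g y" by blast
    then have yN: "y \<in> topspace (space_of N)" using z0[OF fg(1)] z0[OF fg(2)] by metis
    note ev = psmooth_map_eval[OF N id yN]
    have "f y \<in> topspace (topo E)" "g y \<in> topspace (topo E)" using fg continuous_map_funspace[OF ev] by auto
    then obtain A B where AB: "openin (topo E) A" "openin (topo E) B" "f y \<in> A" "g y \<in> B" "disjnt A B"
      using is_tvsD(2)[OF E] y unfolding Hausdorff_space_def by metis
    show "\<exists>U V. openin ?G U \<and> openin ?G V \<and> f \<in> U \<and> g \<in> V \<and> disjnt U V"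
    proof (intro exI conjI)
      show "openin ?G {h \<in> topspace ?G. h y \<in> A}" "openin ?G {h \<in> topspace ?G. h y \<in> B}"
        using openin_continuous_map_preimage[OF ev] AB by auto
    qed (use AB fg in \<open>auto simp: disjnt_iff\<close>)
  qed
  have 0: "psmooth_map (discrete_topology {()}) N E (\<lambda>_ _. 0)"
    unfolding psmooth_map_def o_def using psmooth_zero[OF E] by blast
  have "?Z (\<lambda>_. 0) = (\<lambda>_. 0)" by (rule zI) simp
  moreover have "smooth_map N E (\<lambda>_. 0)" using psmooth_map_slice[OF N E 0] by simp
  ultimately show "0 \<in> topspace ?G" by (simp add: topspace_smooth_space zero_fun_def)
  have fst: "psmooth_map (prod_topology ?G ?G) N E (\<lambda>q. fst q)" and snd: "psmooth_map (prod_topology ?G ?G) N E (\<lambda>q. snd q)"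
    using psmooth_map_reparam[OF id continuous_map_fst] psmooth_map_reparam[OF id continuous_map_snd] .
  have "psmooth_map (prod_topology ?G ?G) N E (\<lambda>(f, g). f + g)"
    unfolding psmooth_map_def
  proof safe
    fix U \<kappa> assume c: "(U, \<kappa>) \<in> charts N"
    have "psmooth (prod_topology ?G ?G) (model N) (\<kappa> ` U) E (\<lambda>q. fst q \<circ> inv_into U \<kappa>)"
      "psmooth (prod_topology ?G ?G) (model N) (\<kappa> ` U) E (\<lambda>q. snd q \<circ> inv_into U \<kappa>)"
      using fst snd c unfolding psmooth_map_def by auto
    from psmooth_add[OF is_chartD(2)[OF chartsD[OF c]] this]
    show "psmooth (prod_topology ?G ?G) (model N) (\<kappa> ` U) E (\<lambda>p. (case p of (f, g) \<Rightarrow> f + g) \<circ> inv_into U \<kappa>)"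
      by (rule psmooth_cong) auto
  qed
  moreover have "?Z (f + g) = f + g" if "f \<in> topspace ?G" "g \<in> topspace ?G" for f g
    by (rule zI) (simp add: z0[OF that(1)] z0[OF that(2)])
  ultimately show "continuous_map (prod_topology ?G ?G) ?G (\<lambda>(f, g). f + g)"
    by (subst continuous_map_smooth_space[OF N E]) auto
  have snd': "psmooth_map (prod_topology euclidean ?G) N E (\<lambda>q. snd q)"
    using psmooth_map_reparam[OF id continuous_map_snd] .
  have "psmooth_map (prod_topology euclidean ?G) N E (\<lambda>(c, f). scl (smooth_space N E) c f)"
    unfolding psmooth_map_def
  proof safe
    fix U \<kappa> assume c: "(U, \<kappa>) \<in> charts N"
    have "psmooth (prod_topology euclidean ?G) (model N) (\<kappa> ` U) E (\<lambda>q. snd q \<circ> inv_into U \<kappa>)"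
      using snd' c unfolding psmooth_map_def by auto
    from psmooth_scale[OF is_chartD(2)[OF chartsD[OF c]] this continuous_map_fst]
    show "psmooth (prod_topology euclidean ?G) (model N) (\<kappa> ` U) E (\<lambda>p. (case p of (c, f) \<Rightarrow> scl (smooth_space N E) c f) \<circ> inv_into U \<kappa>)"
      by (rule psmooth_cong) (auto simp: scl)
  qed
  moreover have "?Z (scl (smooth_space N E) c f) = scl (smooth_space N E) c f" if "f \<in> topspace ?G" for c f
    by (rule zI) (simp add: z0[OF that] scl)
  ultimately show "continuous_map (prod_topology euclidean ?G) ?G (\<lambda>(c, f). scl (smooth_space N E) c f)"
    by (subst continuous_map_smooth_space[OF N E]) auto
qed

section \<open>Products of manifolds\<close>

lemma homeomorphic_map_map_prod:
  assumes "homeomorphic_map X X' f" "homeomorphic_map Y Y' g"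
  shows "homeomorphic_map (prod_topology X Y) (prod_topology X' Y') (map_prod f g)"
proof -
  obtain f' where "homeomorphic_maps X X' f f'" using assms(1) by (auto simp: homeomorphic_map_maps)
  moreover obtain g' where "homeomorphic_maps Y Y' g g'" using assms(2) by (auto simp: homeomorphic_map_maps)
  ultimately have "homeomorphic_maps (prod_topology X Y) (prod_topology X' Y') (\<lambda>(x, y). (f x, g y)) (\<lambda>(x, y). (f' x, g' y))"
    by (simp add: homeomorphic_maps_prod)
  moreover have "map_prod f g = (\<lambda>(x, y). (f x, g y))" by (auto simp: fun_eq_iff)
  ultimately show ?thesis by (auto simp: homeomorphic_map_maps)
qed

lemma inv_into_map_prod:
  assumes "inj_on \<kappa> U" "inj_on \<mu> V" "x \<in> \<kappa> ` U" "y \<in> \<mu> ` V"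
  shows "inv_into (U \<times> V) (map_prod \<kappa> \<mu>) (x, y) = (inv_into U \<kappa> x, inv_into V \<mu> y)"
proof (rule inv_into_f_eq)
  show "inj_on (map_prod \<kappa> \<mu>) (U \<times> V)" using assms(1,2) by (rule map_prod_inj_on)
qed (use assms in \<open>auto simp: inv_into_into f_inv_into_f\<close>)

text \<open>Transitions between product charts are products of transitions, defined on products of
  open sets, and are smooth by \<open>psmooth_map_prod\<close>.\<close>

lemma is_mfd_prod:
  fixes M :: "('k::topological_field, 'v::ab_group_add, 'm) mfd" and N :: "('k, 'w::ab_group_add, 'n) mfd"
  assumes M: "is_mfd M" and N: "is_mfd N"
  shows "is_mfd (prod_mfd M N)"
  unfolding is_mfd_def
proof (intro conjI ballI)
  let ?Z = "prod_tvs (model M) (model N)"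
  have Z: "is_tvs ?Z" by (intro is_tvs_prod is_mfdD(1) M N)
  then show "is_tvs (model (prod_mfd M N))" by (simp add: prod_mfd_def)
  show "Hausdorff_space (space_of (prod_mfd M N))"
    using is_mfdD(4)[OF M] is_mfdD(4)[OF N] by (simp add: prod_mfd_def Hausdorff_space_prod_topology)
  show "(\<Union>c\<in>atlas (prod_mfd M N). fst c) = topspace (space_of (prod_mfd M N))"
  proof -
    have at: "atlas (prod_mfd M N) = (\<lambda>(c, d). (fst c \<times> fst d, map_prod (snd c) (snd d))) ` (atlas M \<times> atlas N)"
      by (force simp: prod_mfd_def)
    have "(\<Union>c\<in>atlas (prod_mfd M N). fst c) = (\<Union>c\<in>atlas M. fst c) \<times> (\<Union>d\<in>atlas N. fst d)"
      unfolding at by fastforce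
    then show ?thesis using is_mfdD(3)[OF M] is_mfdD(3)[OF N] by (simp add: prod_mfd_def)
  qed
  have img: "map_prod \<kappa> \<mu> ` (U \<times> V) = \<kappa> ` U \<times> \<mu> ` V" for \<kappa> :: "'m \<Rightarrow> 'v" and \<mu> :: "'n \<Rightarrow> 'w" and U V by auto
  {
    fix c assume "c \<in> atlas (prod_mfd M N)"
    then obtain U \<kappa> V \<mu> where c: "c = (U \<times> V, map_prod \<kappa> \<mu>)" "(U, \<kappa>) \<in> atlas M" "(V, \<mu>) \<in> atlas N"
      by (auto simp: prod_mfd_def)
    have "is_chart M (U, \<kappa>)" "is_chart N (V, \<mu>)" using c M N is_mfdD(5) by blast+
    then show "is_chart (prod_mfd M N) c"
      unfolding is_chart_def c(1) prod.case img
      by (auto simp: prod_mfd_def prod_tvs_def openin_prod_Times_iff img homeomorphic_map_map_prod subtopology_Times)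
    fix d assume "d \<in> atlas (prod_mfd M N)"
    then obtain U' \<kappa>' V' \<mu>' where d: "d = (U' \<times> V', map_prod \<kappa>' \<mu>')" "(U', \<kappa>') \<in> atlas M" "(V', \<mu>') \<in> atlas N"
      by (auto simp: prod_mfd_def)
    interpret tvs_triple "model M" "model N" "model M" using is_mfdD(1)[OF M] is_mfdD(1)[OF N] by unfold_locales
    note ch = is_chartD[OF is_mfdD(5)[OF M c(2)]] is_chartD[OF is_mfdD(5)[OF N c(3)]]
    have o: "openin (topo (model M)) (\<kappa> ` (U \<inter> U'))" "openin (topo (model N)) (\<mu> ` (V \<inter> V'))"
      by (rule ch(4)[OF is_chartD(1)[OF is_mfdD(5)[OF M d(2)]]], rule ch(8)[OF is_chartD(1)[OF is_mfdD(5)[OF N d(3)]]])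
    have "smooth_transition M (U, \<kappa>) (U', \<kappa>')" "smooth_transition N (V, \<mu>) (V', \<mu>')"
      using is_mfdD(6)[OF M c(2) d(2)] is_mfdD(6)[OF N c(3) d(3)] by blast+
    then have "smooth_on (model M) (\<kappa> ` (U \<inter> U')) (model M) (\<kappa>' \<circ> inv_into U \<kappa>)"
      "smooth_on (model N) (\<mu> ` (V \<inter> V')) (model N) (\<mu>' \<circ> inv_into V \<mu>)"
      by (simp_all add: smooth_transition_def)
    then have s: "psmooth (discrete_topology {()}) (model M) (\<kappa> ` (U \<inter> U')) (model M) (\<lambda>_. \<kappa>' \<circ> inv_into U \<kappa>)"
      "psmooth (discrete_topology {()}) (model N) (\<mu> ` (V \<inter> V')) (model N) (\<lambda>_. \<mu>' \<circ> inv_into V \<mu>)"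
      using psmooth_point[OF is_mfdD(1)[OF M] is_mfdD(1)[OF M] o(1)] psmooth_point[OF is_mfdD(1)[OF N] is_mfdD(1)[OF N] o(2)] by blast+
    have "psmooth (discrete_topology {()}) ?Z (\<kappa> ` (U \<inter> U') \<times> \<mu> ` (V \<inter> V')) ?Z (\<lambda>_. map_prod \<kappa>' \<mu>' \<circ> inv_into (U \<times> V) (map_prod \<kappa> \<mu>))"
    proof (rule psmooth_cong[OF psmooth_map_prod[OF o s]], clarify)
      fix x y assume "x \<in> U" "x \<in> U'" "y \<in> V" "y \<in> V'"
      then show "((\<kappa>' \<circ> inv_into U \<kappa>) (\<kappa> x), (\<mu>' \<circ> inv_into V \<mu>) (\<mu> y)) = (map_prod \<kappa>' \<mu>' \<circ> inv_into (U \<times> V) (map_prod \<kappa> \<mu>)) (\<kappa> x, \<mu> y)"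
        by (simp add: inv_into_map_prod[OF ch(3,7)])
    qed
    moreover have "openin (topo ?Z) (\<kappa> ` (U \<inter> U') \<times> \<mu> ` (V \<inter> V'))"
      using o by (simp add: prod_tvs_def openin_prod_Times_iff)
    ultimately have "smooth_on ?Z (\<kappa> ` (U \<inter> U') \<times> \<mu> ` (V \<inter> V')) ?Z (map_prod \<kappa>' \<mu>' \<circ> inv_into (U \<times> V) (map_prod \<kappa> \<mu>))"
      using smooth_on_iff_psmooth[OF Z Z] by blast
    moreover have "map_prod \<kappa> \<mu> ` ((U \<times> V) \<inter> (U' \<times> V')) = \<kappa> ` (U \<inter> U') \<times> \<mu> ` (V \<inter> V')"
      by (simp only: Times_Int_Times img)
    ultimately show "smooth_transition (prod_mfd M N) c d"
      unfolding smooth_transition_def c(1) d(1) by (simp add: prod_mfd_def)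
  }
qed

text \<open>Charts of the maximal atlas of the product need not be products, so the test is made on
  the product atlas, where \<open>psmooth_prod_iff\<close> applies.\<close>

lemma psmooth_map_prod_mfd_iff:
  fixes M :: "('k::topological_field, 'v::ab_group_add, 'm) mfd" and N :: "('k, 'w::ab_group_add, 'n) mfd"
    and E :: "('k, 'e::ab_group_add) tvs"
  assumes M: "is_mfd M" and N: "is_mfd N" and E: "is_tvs E"
  shows "psmooth_map P (prod_mfd M N) E f \<longleftrightarrow>
    (\<forall>(U, \<kappa>)\<in>atlas M. \<forall>(V, \<mu>)\<in>atlas N. \<exists>H. partial_diff_quots P (model M) (\<kappa> ` U) (model N) (\<mu> ` V) E H \<and>
      (\<forall>p\<in>topspace P. \<forall>x\<in>\<kappa> ` U. \<forall>y\<in>\<mu> ` V. H 0 0 p (Base x) (Base y) = f p (inv_into U \<kappa> x, inv_into V \<mu> y)))"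
    (is "_ \<longleftrightarrow> ?R")
proof -
  interpret tvs_triple "model M" "model N" E using is_mfdD(1)[OF M] is_mfdD(1)[OF N] E by unfold_locales
  have loc: "psmooth P (prod_tvs (model M) (model N)) (map_prod \<kappa> \<mu> ` (U \<times> V)) E (\<lambda>p. f p \<circ> inv_into (U \<times> V) (map_prod \<kappa> \<mu>)) \<longleftrightarrow>
     (\<exists>H. partial_diff_quots P (model M) (\<kappa> ` U) (model N) (\<mu> ` V) E H \<and>
      (\<forall>p\<in>topspace P. \<forall>x\<in>\<kappa> ` U. \<forall>y\<in>\<mu> ` V. H 0 0 p (Base x) (Base y) = f p (inv_into U \<kappa> x, inv_into V \<mu> y)))"
    if a: "(U, \<kappa>) \<in> atlas M" "(V, \<mu>) \<in> atlas N" for U \<kappa> V \<mu>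
  proof -
    note ch = is_chartD[OF is_mfdD(5)[OF M a(1)]] is_chartD[OF is_mfdD(5)[OF N a(2)]]
    have img: "map_prod \<kappa> \<mu> ` (U \<times> V) = \<kappa> ` U \<times> \<mu> ` V" by auto
    show ?thesis
      unfolding img psmooth_prod_iff[OF ch(2,6)] by (simp add: inv_into_map_prod[OF ch(3,7)])
  qed
  have MN: "is_mfd (prod_mfd M N)" by (rule is_mfd_prod[OF M N])
  have mod: "model (prod_mfd M N) = prod_tvs (model M) (model N)" by (simp add: prod_mfd_def)
  show ?thesis
  proof
    assume f: "psmooth_map P (prod_mfd M N) E f"
    show ?R
    proof safe
      fix U \<kappa> V \<mu> assume a: "(U, \<kappa>) \<in> atlas M" "(V, \<mu>) \<in> atlas N"
      then have "(U \<times> V, map_prod \<kappa> \<mu>) \<in> atlas (prod_mfd M N)" by (auto simp: prod_mfd_def)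
      from psmooth_map_chart[OF MN f this]
      show "\<exists>H. partial_diff_quots P (model M) (\<kappa> ` U) (model N) (\<mu> ` V) E H \<and>
        (\<forall>p\<in>topspace P. \<forall>x\<in>\<kappa> ` U. \<forall>y\<in>\<mu> ` V. H 0 0 p (Base x) (Base y) = f p (inv_into U \<kappa> x, inv_into V \<mu> y))"
        unfolding mod loc[OF a] .
    qed
  next
    assume R: ?R
    show "psmooth_map P (prod_mfd M N) E f"
    proof (rule psmooth_map_atlas[OF MN E])
      fix W \<nu> assume "(W, \<nu>) \<in> atlas (prod_mfd M N)"
      then obtain U \<kappa> V \<mu> where a: "W = U \<times> V" "\<nu> = map_prod \<kappa> \<mu>" "(U, \<kappa>) \<in> atlas M" "(V, \<mu>) \<in> atlas N"
        by (auto simp: prod_mfd_def)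
      show "psmooth P (model (prod_mfd M N)) (\<nu> ` W) E (\<lambda>p. f p \<circ> inv_into W \<nu>)"
        unfolding mod a(1,2) loc[OF a(3,4)] using R a(3,4) by blast
    qed
  qed
qed

section \<open>Finite-dimensional spaces over locally compact fields\<close>

lemma tendsto_mult_nhds:
  fixes a b :: "'k::topological_field"
  assumes "open W" "a * b \<in> W"
  obtains A B where "open A" "open B" "a \<in> A" "b \<in> B" "\<And>x y. \<lbrakk>x \<in> A; y \<in> B\<rbrakk> \<Longrightarrow> x * y \<in> W"
proof -
  have "continuous_on UNIV (\<lambda>z::'k \<times> 'k. fst z * snd z)"
    unfolding continuous_on_def
    by (intro ballI tendsto_mult tendsto_fst tendsto_snd tendsto_ident_at)
  then have "open ((\<lambda>z::'k \<times> 'k. fst z * snd z) -` W)" using assms(1) by (simp add: continuous_on_open_vimage)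
  moreover have "(a, b) \<in> (\<lambda>z::'k \<times> 'k. fst z * snd z) -` W" using assms(2) by simp
  ultimately obtain A B where "open A" "open B" "(a, b) \<in> A \<times> B" "A \<times> B \<subseteq> (\<lambda>z::'k \<times> 'k. fst z * snd z) -` W"
    by (rule open_prod_elim)
  then have "open A" "open B" "a \<in> A" "b \<in> B" "\<And>x y. \<lbrakk>x \<in> A; y \<in> B\<rbrakk> \<Longrightarrow> x * y \<in> W" by auto
  then show ?thesis by (rule that)
qed

lemma open_vimage_mult: "open W \<Longrightarrow> open ((\<lambda>x. c * x) -` W)" for c :: "'k::topological_field"
proof -
  have "continuous_on UNIV (\<lambda>x. c * x)"
    unfolding continuous_on_def by (intro ballI tendsto_mult tendsto_const tendsto_ident_at)
  then show "open W \<Longrightarrow> open ((\<lambda>x. c * x) -` W)" by (simp add: continuous_on_open_vimage)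
qed

lemma inverse_nhds:
  fixes a :: "'k::topological_field"
  assumes "a \<noteq> 0" "open W" "inverse a \<in> W"
  obtains A where "open A" "a \<in> A" "\<And>x. x \<in> A \<Longrightarrow> inverse x \<in> W"
proof -
  have "eventually (\<lambda>x. inverse x \<in> W) (nhds a)"
    using tendsto_inverse_nhds[OF assms(1)] assms(2,3) by (rule topological_tendstoD)
  then show ?thesis using that unfolding eventually_nhds by blast
qed

text \<open>Otherwise each point of \<open>D\<close> has a neighbourhood visited finitely often, and
  finitely many of these cover \<open>D\<close>.\<close>

lemma finite_subset_compact_cluster:
  fixes a :: "nat \<Rightarrow> 'a::topological_space"
  assumes "compact D" "infinite {n. a n \<in> D}"
  obtains x where "x \<in> D" "\<And>A. \<lbrakk>open A; x \<in> A\<rbrakk> \<Longrightarrow> infinite {n. a n \<in> A}"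
proof (rule ccontr)
  assume "\<not> thesis"
  then have "\<forall>x\<in>D. \<exists>A. open A \<and> x \<in> A \<and> finite {n. a n \<in> A}" using that by blast
  then obtain A where A: "\<And>x. x \<in> D \<Longrightarrow> open (A x) \<and> x \<in> A x \<and> finite {n. a n \<in> A x}" by metis
  obtain T where T: "T \<subseteq> D" "finite T" "D \<subseteq> (\<Union>x\<in>T. A x)"
    by (rule compactE_image[OF assms(1), of D A]) (use A in auto)
  have "{n. a n \<in> D} \<subseteq> (\<Union>x\<in>T. {n. a n \<in> A x})" using T(3) by blast
  moreover have "finite (\<Union>x\<in>T. {n. a n \<in> A x})" using T A by blast
  ultimately show False using assms(2) finite_subset by blast
qed

text \<open>The powers of \<open>t\<close> tend to zero as soon as \<open>t V\<close> is contained in \<open>V - {v}\<close> for a compact neighbourhood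
  \<open>V\<close> of zero and some \<open>v \<in> V\<close>: otherwise \<open>1\<close> would be a cluster point of the powers, and \<open>v\<close> would be
  in the closed set \<open>t V\<close>.\<close>

lemma topologically_nilpotent:
  fixes V :: "'k::topological_field set"
  assumes V: "compact V" and U: "open U" "0 \<in> U" "U \<subseteq> V"
  obtains t :: 'k where "t \<noteq> 0" "\<And>O'. \<lbrakk>open O'; 0 \<in> O'\<rbrakk> \<Longrightarrow> finite {n. t ^ n \<notin> O'}"
proof -
  have exn: "\<exists>v\<in>A. v \<noteq> 0" if "open A" "0 \<in> A" for A :: "'k set"
  proof (rule ccontr)
    assume "\<not> (\<exists>v\<in>A. v \<noteq> 0)"
    then have "A = {0}" using that(2) by blast
    then show False using that(1) not_open_zero[where 'k='k] by simp
  qed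
  obtain v where v: "v \<in> U" "v \<noteq> 0" using exn[OF U(1,2)] by blast
  have oU: "open (U - {v})" using U(1) by (intro open_Diff) auto
  have "continuous_on UNIV (\<lambda>z::'k \<times> 'k. fst z * snd z)"
    unfolding continuous_on_def
    by (intro ballI tendsto_mult tendsto_fst tendsto_snd tendsto_ident_at)
  then have o: "open ((\<lambda>z::'k \<times> 'k. fst z * snd z) -` (U - {v}))" using oU by (simp add: continuous_on_open_vimage)
  \<comment> \<open>Multiplication sends \<open>{0} \<times> V\<close> to \<open>0\<close>, which
    lies in the open set \<open>U - {v}\<close>; the tube lemma gives a neighbourhood
    \<open>A\<close> of \<open>0\<close> with all products of \<open>A\<close> and \<open>V\<close>
    in \<open>U - {v}\<close>.\<close>
  have "{0} \<times> V \<subseteq> (\<lambda>z::'k \<times> 'k. fst z * snd z) -` (U - {v})" using U(2) v by auto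
  with o obtain A B where AB: "openin euclidean A" "openin euclidean B" "{0} \<subseteq> A" "V \<subseteq> B" "A \<times> B \<subseteq> (\<lambda>z::'k \<times> 'k. fst z * snd z) -` (U - {v})"
    using Wallace_theorem_prod_topology[of euclidean "{0}" euclidean V "(\<lambda>z::'k \<times> 'k. fst z * snd z) -` (U - {v})"] V by auto
  obtain t where t: "t \<in> A" "t \<noteq> 0" using exn[of A] AB by auto
  have tV: "t * x \<in> U - {v}" if "x \<in> V" for x
  proof -
    have "(t, x) \<in> A \<times> B" using AB(4) t(1) that by blast
    then have "(t, x) \<in> (\<lambda>z. fst z * snd z) -` (U - {v})" using AB(5) by (rule set_mp[rotated])
    then show ?thesis by simp
  qed
  have tn: "t ^ n * v \<in> V" for n
  proof (induction n)
    case 0 then show ?case using v U by auto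
  next
    case (Suc n)
    then show ?case using tV[OF Suc] U by (auto simp: mult.assoc)
  qed
  have "compact ((\<lambda>x. t * x) ` V)"
    by (rule compact_continuous_image[OF _ V])
      (auto simp: continuous_on_def intro!: tendsto_mult tendsto_const tendsto_ident_at)
  then have ctV: "open (- ((\<lambda>x. t * x) ` V))" using compact_imp_closed by blast
  have vtV: "v \<notin> (\<lambda>x. t * x) ` V" using tV by auto
  have fin: "finite {n. t ^ n \<notin> O'}" if O': "open O'" "0 \<in> O'" for O'
  proof (rule ccontr)
    assume inf: "infinite {n. t ^ n \<notin> O'}"
    \<comment> \<open>The factor \<open>v\<close> moves the powers into the compact set
      \<open>V\<close>; lying outside \<open>O'\<close> turns into lying outside
      \<open>O2\<close>.\<close>
    define O2 where "O2 = (\<lambda>x. inverse v * x) -` O'"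
    have O2: "open O2" "0 \<in> O2" using open_vimage_mult[OF O'(1)] O'(2) by (auto simp: O2_def)
    have "t ^ n * v \<in> V - O2" if "t ^ n \<notin> O'" for n
    proof -
      have "inverse v * (t ^ n * v) = t ^ n" using v(2) by (simp add: field_simps)
      then have "inverse v * (t ^ n * v) \<notin> O'" using that by (simp only:) simp
      then show ?thesis using tn[of n] unfolding O2_def vimage_def by blast
    qed
    then have "{n. t ^ n \<notin> O'} \<subseteq> {n. t ^ n * v \<in> V - O2}" by blast
    then have "infinite {n. t ^ n * v \<in> V - O2}" using inf finite_subset by blast
    moreover have "compact (V - O2)" using V O2(1) by (rule compact_diff)
    ultimately obtain a where a: "a \<in> V - O2" "\<And>A. \<lbrakk>open A; a \<in> A\<rbrakk> \<Longrightarrow> infinite {n. t ^ n * v \<in> A}"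
      using finite_subset_compact_cluster[of "V - O2" "\<lambda>n. t ^ n * v"] by blast
    have a0: "a \<noteq> 0" using a(1) O2(2) by auto
    \<comment> \<open>At the cluster point \<open>a\<close>, which is nonzero, the quotient
      \<open>v a / a\<close> is \<open>v\<close> and lies outside the closed set \<open>t V\<close>.
      By continuity \<open>v b / c\<close> avoids \<open>t V\<close> for all \<open>b\<close> and
      \<open>c\<close> near \<open>a\<close>.\<close>
    have "(v * a) * inverse a \<in> - ((\<lambda>x. t * x) ` V)" using vtV a0 by (simp add: mult.assoc)
    from tendsto_mult_nhds[OF ctV this] obtain A1 B1 where A1: "open A1" "open B1" "v * a \<in> A1" "inverse a \<in> B1"
      "\<And>x y. \<lbrakk>x \<in> A1; y \<in> B1\<rbrakk> \<Longrightarrow> x * y \<in> - ((\<lambda>x. t * x) ` V)" by metis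
    obtain B2 where B2: "open B2" "a \<in> B2" "\<And>x. x \<in> B2 \<Longrightarrow> inverse x \<in> B1"
      using inverse_nhds[OF a0 A1(2,4)] by metis
    let ?A = "(\<lambda>x. v * x) -` A1 \<inter> B2"
    have "open ?A" using open_vimage_mult[OF A1(1)] B2(1) by blast
    moreover have "a \<in> ?A" using A1(3) B2(2) by simp
    ultimately have inf: "infinite {n. t ^ n * v \<in> ?A}" by (rule a(2))
    then obtain n where n: "t ^ n * v \<in> ?A" using not_finite_existsD by blast
    obtain m where m: "m > n" "t ^ m * v \<in> ?A" using inf unfolding infinite_nat_iff_unbounded by auto
    have "(v * (t ^ m * v)) * inverse (t ^ n * v) \<in> - ((\<lambda>x. t * x) ` V)"
      using A1(5) B2(3) n m by blast
    \<comment> \<open>For \<open>m > n\<close> the quotient is \<open>t\<close> times a power of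
      \<open>t\<close> times \<open>v\<close>, the latter with exponent \<open>m - n - 1\<close>; by
      \<open>tn\<close> it lies in \<open>t V\<close>.\<close>
    moreover have "(v * (t ^ m * v)) * inverse (t ^ n * v) = t * (t ^ (m - Suc n) * v)"
    proof -
      have "t ^ m = t ^ n * (t * t ^ (m - Suc n))" using m(1)
        by (metis Suc_diff_Suc power_Suc power_add le_add_diff_inverse less_imp_le)
      then show ?thesis using v(2) t(2) by (simp add: field_simps)
    qed
    ultimately have "t * (t ^ (m - Suc n) * v) \<in> - ((\<lambda>x. t * x) ` V)" by (simp only:)
    then show False using tn[of "m - Suc n"] by blast
  qed
  show ?thesis by (rule that[OF t(2) fin])
qed

section \<open>Local compactness in finite dimension\<close>

lemma continuous_map_tvs_sum:
  assumes E: "is_tvs E" and "finite I" "\<And>i. i \<in> I \<Longrightarrow> continuous_map X (topo E) (f i)"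
  shows "continuous_map X (topo E) (\<lambda>x. \<Sum>i\<in>I. f i x)"
  using assms(2,3)
proof (induction I rule: finite_induct)
  case empty
  then show ?case using is_tvsD(3)[OF E] by simp
next
  case (insert i I)
  then show ?case by (simp add: continuous_map_tvs_add[OF E])
qed

text \<open>It is enough that the image under the coordinate map \<open>\<phi>\<close> of a compact
  neighbourhood \<open>C\<close> of the origin is a neighbourhood of \<open>0\<close>. The usual
  argument with the unit sphere and a norm is carried out with a compact shell and the powers of a
  scalar \<open>t\<close> tending to zero.\<close>

theorem locally_compact_finite_dimensional:
  fixes Y :: "('k::topological_field, 'w::ab_group_add) tvs"
  assumes K: "locally_compact_space (euclidean :: 'k topology)" and Y: "is_tvs Y" and fd: "finite_dimensional Y"
  shows "locally_compact_space (topo Y)"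
proof -
  interpret Y: vector_space "scl Y" using is_tvsD(1)[OF Y] .
  obtain B0 where B0: "finite B0" "Y.span B0 = topspace (topo Y)" using fd unfolding finite_dimensional_def by blast
  obtain B where B: "B \<subseteq> B0" "Y.independent B" "B0 \<subseteq> Y.span B" using Y.maximal_independent_subset by blast
  have finB: "finite B" using B(1) B0(1) finite_subset by blast
  have "Y.span B0 \<subseteq> Y.span B" using B(3) Y.span_minimal Y.subspace_span by blast
  then have spanB: "Y.span B = topspace (topo Y)" using B(1) B0(2) Y.span_mono by blast
  obtain U V where UV: "open U" "compact V" "0 \<in> U" "U \<subseteq> (V :: 'k set)"
    using K[unfolded locally_compact_space_def, rule_format, of 0] by auto
  obtain t :: 'k where t: "t \<noteq> 0" "\<And>O'. \<lbrakk>open O'; 0 \<in> O'\<rbrakk> \<Longrightarrow> finite {n. t ^ n \<notin> O'}"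
    using topologically_nilpotent[OF UV(2,1,3,4)] by metis
  let ?P = "product_topology (\<lambda>_. euclidean :: 'k topology) B"
  define \<phi> where "\<phi> x = (\<Sum>b\<in>B. scl Y (x b) b)" for x
  have Btop: "b \<in> topspace (topo Y)" if "b \<in> B" for b using that spanB Y.span_base by blast
  have \<phi>: "continuous_map ?P (topo Y) \<phi>"
    unfolding \<phi>_def
  proof (rule continuous_map_tvs_sum[OF Y finB])
    fix b assume b: "b \<in> B"
    show "continuous_map ?P (topo Y) (\<lambda>x. scl Y (x b) b)"
      using b Btop[OF b] by (intro continuous_map_tvs_scl[OF Y] continuous_map_product_projection) auto
  qed
  define C where "C = (\<Pi>\<^sub>E b\<in>B. V)"
  \<comment> \<open>Coordinates in \<open>t U\<close>. The shell \<open>C - O1\<close> is compact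
    and avoids the origin, so by independence its image avoids \<open>0\<close>; it replaces the
    unit sphere.\<close>
  define O1 where "O1 = (\<Pi>\<^sub>E b\<in>B. (\<lambda>x. inverse t * x) -` U)"
  have C: "compactin ?P C" unfolding C_def using UV(2) by (simp add: compactin_PiE)
  have O1: "openin ?P O1" unfolding O1_def using open_vimage_mult[OF UV(1)] finB by (simp add: openin_PiE_gen)
  have S: "compactin ?P (C - O1)"
  proof -
    have "closedin ?P (topspace ?P - O1)" using O1 by blast
    from closed_Int_compactin[OF this C] have "compactin ?P ((topspace ?P - O1) \<inter> C)" .
    moreover have "(topspace ?P - O1) \<inter> C = C - O1" using compactin_subset_topspace[OF C] by blast
    ultimately show ?thesis by simp
  qed
  have "compactin (topo Y) (\<phi> ` (C - O1))" by (rule image_compactin[OF S \<phi>])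
  then have cl: "closedin (topo Y) (\<phi> ` (C - O1))" using is_tvsD(2)[OF Y] compactin_imp_closedin by blast
  have zero: "0 \<notin> \<phi> ` (C - O1)"
  proof
    assume "0 \<in> \<phi> ` (C - O1)"
    then obtain x where x: "x \<in> C" "x \<notin> O1" "(\<Sum>b\<in>B. scl Y (x b) b) = 0" unfolding \<phi>_def by auto
    have "x b = 0" if "b \<in> B" for b
      using Y.independentD[OF B(2) finB subset_refl x(3) that] .
    then have "x \<in> O1" using x(1) UV(3) by (auto simp: O1_def C_def PiE_iff)
    then show False using x(2) by simp
  qed
  define A where "A = topspace (topo Y) - \<phi> ` (C - O1)"
  have A: "openin (topo Y) A" "0 \<in> A" using cl zero is_tvsD(3)[OF Y] by (auto simp: A_def)
  have scont: "continuous_map (topo Y) (topo Y) (\<lambda>w. scl Y c w)" for c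
    by (rule continuous_map_tvs_scl[OF Y]) auto
  \<comment> \<open>Scalars and vectors near zero multiply into \<open>A\<close>. All but finitely
    many powers of \<open>t\<close> are such scalars, and the remaining ones are treated by a finite
    intersection.\<close>
  obtain W where W: "openin (topo Y) W" "0 \<in> W" "\<And>w n. w \<in> W \<Longrightarrow> scl Y (t ^ n) w \<in> A"
  proof -
    define D where "D = {z \<in> topspace (prod_topology (euclidean :: 'k topology) (topo Y)). (\<lambda>(c, x). scl Y c x) z \<in> A}"
    have o: "openin (prod_topology euclidean (topo Y)) D"
      unfolding D_def by (rule openin_continuous_map_preimage[OF is_tvsD(7)[OF Y] A(1)])
    have mem: "(0, 0) \<in> D" using A(2) is_tvsD(3)[OF Y] by (simp add: D_def)
    obtain N0 W0 where NW: "openin euclidean N0" "openin (topo Y) W0" "0 \<in> N0" "0 \<in> W0" "N0 \<times> W0 \<subseteq> D"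
      using iffD1[OF openin_prod_topology_alt o, THEN spec, THEN spec, THEN mp, OF mem] by (elim exE conjE)
    let ?F = "{n. t ^ n \<notin> N0}"
    have F: "finite ?F" using t(2) NW by auto
    define W where "W = W0 \<inter> (\<Inter>n\<in>?F. {w \<in> topspace (topo Y). scl Y (t ^ n) w \<in> A})"
    have "openin (topo Y) W"
    proof (cases "?F = {}")
      case True then show ?thesis using NW(2) by (simp add: W_def)
    next
      case False
      have "openin (topo Y) (\<Inter>n\<in>?F. {w \<in> topspace (topo Y). scl Y (t ^ n) w \<in> A})"
        using F False openin_continuous_map_preimage[OF scont A(1)] by (intro openin_Inter) auto
      then show ?thesis using NW(2) by (auto simp: W_def)
    qed
    moreover have "0 \<in> W" using NW(4) A(2) is_tvsD(3)[OF Y] by (simp add: W_def)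
    moreover have "scl Y (t ^ n) w \<in> A" if "w \<in> W" for w n
    proof (cases "n \<in> ?F")
      case True then show ?thesis using that by (simp add: W_def)
    next
      case False
      then have "(t ^ n, w) \<in> N0 \<times> W0" using that by (simp add: W_def)
      then show ?thesis using NW(5) unfolding D_def by auto
    qed
    ultimately show ?thesis by (rule that)
  qed
  have WC: "W \<subseteq> \<phi> ` C"
  proof
    fix w assume w: "w \<in> W"
    then have "w \<in> Y.span B" using openin_subset[OF W(1)] spanB by blast
    then obtain u where u: "w = (\<Sum>b\<in>B. scl Y (u b) b)" using Y.span_finite[OF finB] by auto
    have ev: "\<exists>k. \<forall>b\<in>B. t ^ k * u b \<in> V"
    proof -
      have "finite {n. t ^ n * u b \<notin> U}" for b
        using t(2)[OF open_vimage_mult[OF UV(1), of "u b"]] UV(3) by (simp add: mult.commute)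
      then have "finite (\<Union>b\<in>B. {n. t ^ n * u b \<notin> U})" using finB by blast
      then obtain k where "k \<notin> (\<Union>b\<in>B. {n. t ^ n * u b \<notin> U})" using ex_new_if_finite infinite_UNIV_nat by blast
      then show ?thesis using UV(4) by blast
    qed
    \<comment> \<open>The first power of \<open>t\<close> that brings all coordinates of
      \<open>w\<close> into \<open>V\<close>; the aim is that it is the zeroth.\<close>
    define k where "k = (LEAST k. \<forall>b\<in>B. t ^ k * u b \<in> V)"
    have k: "\<forall>b\<in>B. t ^ k * u b \<in> V" unfolding k_def using ev by (rule LeastI_ex)
    define x where "x = restrict (\<lambda>b. t ^ k * u b) B"
    have x: "x \<in> C" using k by (auto simp: x_def C_def)
    have \<phi>x: "\<phi> x = scl Y (t ^ k) w"
      unfolding \<phi>_def u x_def by (simp add: Y.scale_sum_right)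
    show "w \<in> \<phi> ` C"
    proof (cases k)
      case 0
      then show ?thesis using \<phi>x x by (metis Y.scale_one image_eqI power_0)
    next
      case (Suc k')
      \<comment> \<open>One step earlier some coordinate is outside \<open>V\<close>, hence outside
        \<open>U\<close>, so \<open>x\<close> lies in the shell. But \<open>\<phi> x\<close> is a
        power of \<open>t\<close> times \<open>w\<close> and therefore in \<open>A\<close>, which
        misses the image of the shell.\<close>
      have "\<not> (\<forall>b\<in>B. t ^ k' * u b \<in> V)" using not_less_Least[of k' "\<lambda>k. \<forall>b\<in>B. t ^ k * u b \<in> V"] Suc by (simp add: k_def)
      then obtain b where b: "b \<in> B" "t ^ k' * u b \<notin> V" by blast
      have "inverse t * x b = t ^ k' * u b" using t(1) b(1) Suc by (simp add: x_def)
      then have "x \<notin> O1" using b UV(4) by (auto simp: O1_def PiE_iff)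
      then have "scl Y (t ^ k) w \<in> \<phi> ` (C - O1)" using x \<phi>x by (metis DiffI image_eqI)
      moreover have "scl Y (t ^ k) w \<in> A" by (rule W(3)[OF w])
      ultimately show ?thesis by (simp add: A_def)
    qed
  qed
  have cC: "compactin (topo Y) (\<phi> ` C)" by (rule image_compactin[OF C \<phi>])
  show ?thesis
    unfolding locally_compact_space_def
  proof (intro ballI)
    fix y assume y: "y \<in> topspace (topo Y)"
    have 1: "continuous_map (topo Y) (topo Y) (\<lambda>z. z - y)" and 2: "continuous_map (topo Y) (topo Y) (\<lambda>z. z + y)"
      using y by (auto intro!: continuous_map_tvs_diff[OF Y] continuous_map_tvs_add[OF Y])
    show "\<exists>U K. openin (topo Y) U \<and> compactin (topo Y) K \<and> y \<in> U \<and> U \<subseteq> K"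
    proof (intro exI conjI)
      show "openin (topo Y) {z \<in> topspace (topo Y). z - y \<in> W}" by (rule openin_continuous_map_preimage[OF 1 W(1)])
      show "compactin (topo Y) ((\<lambda>z. z + y) ` \<phi> ` C)" by (rule image_compactin[OF cC 2])
      show "y \<in> {z \<in> topspace (topo Y). z - y \<in> W}" using y W(2) by simp
      show "{z \<in> topspace (topo Y). z - y \<in> W} \<subseteq> (\<lambda>z. z + y) ` \<phi> ` C"
      proof
        fix z assume "z \<in> {z \<in> topspace (topo Y). z - y \<in> W}"
        then have "z - y \<in> \<phi> ` C" using WC by blast
        moreover have "z = (z - y) + y" by simp
        ultimately show "z \<in> (\<lambda>z. z + y) ` \<phi> ` C" by blast
      qed
    qed
  qed
qed

section \<open>The exponential law\<close>

text \<open>The first variable joins the parameters. A single new parameter \<open>(p, a)\<close> is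
  tested with \<open>{p}\<close> and \<open>{a}\<close>; otherwise \<open>C'\<close> is compact, and
  either \<open>Q\<close> is a single parameter or the product of \<open>C\<close> and
  \<open>C'\<close> is a compact test set.\<close>

lemma kcont_curry:
  assumes f: "kcont P (prod_topology S S') T (\<lambda>p (a, b). f p a b)"
    and QC: "Q \<subseteq> topspace P" "C \<subseteq> topspace S" "(\<exists>p. Q = {p}) \<or> compactin S C"
  shows "kcont (prod_topology (subtopology P Q) (subtopology S C)) S' T (\<lambda>(p, a) b. f p a b)"
proof (rule kcontI)
  fix Q' C' assume QC': "Q' \<subseteq> topspace (prod_topology (subtopology P Q) (subtopology S C))" "C' \<subseteq> topspace S'"
    "(\<exists>q. Q' = {q}) \<or> compactin S' C'"
  obtain Q0 C0 where Q0: "Q0 \<subseteq> topspace P" "C0 \<subseteq> topspace S" "Q' \<subseteq> Q0 \<times> C0"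
    "(\<exists>p. Q0 = {p}) \<or> compactin (prod_topology S S') (C0 \<times> C')"
  proof (cases "\<exists>q. Q' = {q}")
    case True
    then obtain p a where "Q' = {(p, a)}" by force
    then show ?thesis using that[of "{p}" "{a}"] QC'(1) by auto
  next
    case False
    then have "compactin S' C'" using QC'(3) by simp
    then have "(\<exists>p. Q = {p}) \<or> compactin (prod_topology S S') (C \<times> C')"
      using QC(3) by (auto simp: compactin_Times)
    then show ?thesis using that[of Q C] QC QC'(1) by auto
  qed
  have 1: "continuous_map (prod_topology (subtopology P Q0) (subtopology (prod_topology S S') (C0 \<times> C'))) T (\<lambda>(p, z). (\<lambda>(a, b). f p a b) z)"
    using Q0 QC' by (intro kcontD[OF f]) auto
  let ?D = "prod_topology (subtopology (prod_topology (subtopology P Q) (subtopology S C)) Q') (subtopology S' C')"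
  have pa: "continuous_map ?D (prod_topology (subtopology P Q) (subtopology S C)) fst"
    by (rule continuous_map_into_fulltopology[OF continuous_map_fst])
  have "continuous_map ?D P (\<lambda>w. fst (fst w))" "continuous_map ?D S (\<lambda>w. snd (fst w))" "continuous_map ?D S' snd"
    using continuous_map_compose'[OF pa continuous_map_into_fulltopology[OF continuous_map_fst]]
      continuous_map_compose'[OF pa continuous_map_into_fulltopology[OF continuous_map_snd]]
      continuous_map_into_fulltopology[OF continuous_map_snd] by blast+
  then have "continuous_map ?D (prod_topology (subtopology P Q0) (subtopology (prod_topology S S') (C0 \<times> C'))) (\<lambda>w. (fst (fst w), (snd (fst w), snd w)))"
    using Q0(3) by (auto simp: continuous_map_pairwise o_def continuous_map_in_subtopology)
  from continuous_map_compose'[OF this 1]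
  show "continuous_map ?D T (\<lambda>(q, b). (case q of (p, a) \<Rightarrow> \<lambda>b. f p a b) b)"
    by (simp add: case_prod_unfold)
qed

lemma locally_compact_pushforward:
  assumes "locally_compact_space T" "\<And>x. r (e x) = x"
  shows "locally_compact_space (pushforward e r T)"
proof -
  have "homeomorphic_maps T (pushforward e r T) e r" by (rule pushforward(4)) (rule assms(2))
  then have "T homeomorphic_space pushforward e r T" by (auto simp: homeomorphic_space_def)
  then show ?thesis using assms(1) homeomorphic_locally_compact_space by blast
qed

section \<open>Local compactness of bracket sets\<close>

context universe
begin

lemma locally_compact_uprod:
  assumes "locally_compact_space \<sigma>" "locally_compact_space \<tau>"
  shows "locally_compact_space (uprod \<sigma> \<tau>)"
  unfolding uprod_def
  by (rule locally_compact_pushforward) (use assms in \<open>auto simp: locally_compact_space_prod_topology\<close>)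

text \<open>Up to homeomorphism, a bracket set is open in a finite product of copies of the model
  space and of the field.\<close>

lemma locally_compact_tower_embed:
  assumes K: "locally_compact_space (euclidean :: 'k topology)" and lc: "locally_compact_space (topo Z)"
    and emb: "uembed Z e r" and V: "openin (topo Z) V"
  shows "locally_compact_space (bracket_topology Z V l)"
proof -
  have VS: "V \<subseteq> topspace (topo Z)" by (rule openin_subset[OF V])
  have 1: "locally_compact_space (utop Z e r)"
    by (rule locally_compact_pushforward[OF lc]) (use emb in \<open>simp add: uembed_def\<close>)
  have 2: "locally_compact_space (uscalars :: ('b, 'k) un topology)"
    unfolding uscalars_def by (rule locally_compact_pushforward[OF K]) simp
  have 3: "locally_compact_space (ubrs l (utop Z e r))"
    by (induction l) (simp_all add: 1 2 locally_compact_uprod)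
  let ?S = "subtopology (ubrs l (utop Z e r)) (ubsets (utop Z e r) (e ` V) l)"
  have lcS: "locally_compact_space ?S"
  proof (rule locally_compact_space_open_subset[OF _ 3])
    show "Hausdorff_space (ubrs l (utop Z e r)) \<or> regular_space (ubrs l (utop Z e r))"
      using uspD(1)[OF usp_ubrs[OF usp_utop[OF emb]]] by blast
    show "openin (ubrs l (utop Z e r)) (ubsets (utop Z e r) (e ` V) l)"
      by (intro openin_ubsets usp_utop[OF emb] openin_embed[OF emb V])
  qed
  have "homeomorphic_maps (bracket_topology Z V l) ?S (tower_enc e) (tower_dec r l)"
    unfolding homeomorphic_maps_def
  proof (intro conjI ballI continuous_map_enc_bracket[OF emb VS] continuous_map_dec_bracket[OF emb VS])
    fix w assume "w \<in> topspace (bracket_topology Z V l)"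
    then show "tower_dec r l (tower_enc e w) = w" by (intro dec_enc[OF emb]) (simp add: bracket_topology_def)
  next
    fix u assume "u \<in> topspace ?S"
    then show "tower_enc e (tower_dec r l u) = u" by (intro enc_dec[OF emb]) simp
  qed
  then have "bracket_topology Z V l homeomorphic_space ?S" by (auto simp: homeomorphic_space_def)
  then show ?thesis using lcS homeomorphic_locally_compact_space by blast
qed

end

lemma locally_compact_tower:
  fixes Y :: "('k::topological_field, 'w::ab_group_add) tvs"
  assumes "locally_compact_space (euclidean :: 'k topology)" "locally_compact_space (topo Y)"
    and Y: "is_tvs Y" and "openin (topo Y) V"
  shows "locally_compact_space (bracket_topology Y V l)"
proof -
  interpret tvs_triple Y Y Y using Y by unfold_locales
  show ?thesis by (rule locally_compact_tower_embed[OF assms(1,2) embeddings(1) assms(4)])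
qed

section \<open>Smooth families of maps into a space of smooth maps\<close>

context
  fixes N :: "('k::topological_field, 'w::ab_group_add, 'n) mfd" and E :: "('k, 'e::ab_group_add) tvs"
    and X :: "('k, 'v::ab_group_add) tvs"
  assumes N: "is_mfd N" and E: "is_tvs E" and X: "is_tvs X"
begin

text \<open>Each value \<open>h j p a\<close> of a quotient with respect to the first variable is
  itself a smooth map on \<open>N\<close>. Its bracket maps in the chart \<open>\<mu>\<close> supply
  the quotients with respect to the second variable.\<close>

lemma partial_of_psmooth_into_smooth_space:
  assumes K: "locally_compact_space (euclidean :: 'k topology)" and lc: "locally_compact_space (topo (model N))"
    and U: "openin (topo X) U" and F: "psmooth P X U (smooth_space N E) F" and a: "(V, \<mu>) \<in> atlas N"
  shows "\<exists>H. partial_diff_quots P X U (model N) (\<mu> ` V) E H \<and>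
     (\<forall>p\<in>topspace P. \<forall>x\<in>U. \<forall>y\<in>\<mu> ` V. H 0 0 p (Base x) (Base y) = F p x (inv_into V \<mu> y))"
proof -
  let ?G = "smooth_space N E" and ?Y = "model N" and ?V = "\<mu> ` V"
  note Y = is_mfdD(1)[OF N]
  have US: "U \<subseteq> topspace (topo X)" by (rule openin_subset[OF U])
  have V: "openin (topo ?Y) ?V" by (rule is_chartD(2)[OF is_mfdD(5)[OF N a]])
  have VS: "?V \<subseteq> topspace (topo ?Y)" by (rule openin_subset[OF V])
  obtain h where h: "diff_quots P X U ?G h" "\<And>p x. \<lbrakk>p \<in> topspace P; x \<in> U\<rbrakk> \<Longrightarrow> h 0 p (Base x) = F p x"
    using F unfolding psmooth_def by blast
  have kh: "kcont P (bracket_topology X U j) (topo ?G) (h j)" for j using h(1) by (simp add: diff_quots_def)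
  define H where "H j l p a b = bracket_map ?Y ?V E (h j p a \<circ> inv_into V \<mu>) l b" for j l p a b
  have sm: "smooth_on ?Y ?V E (h j p a \<circ> inv_into V \<mu>)" if "p \<in> topspace P" "a \<in> bracket_set X U j" for j p a
  proof -
    have "h j p a \<in> topspace (topo ?G)" using kcont_maps[OF kh that(1)] that(2) topspace_bracket[OF US] by metis
    then have "smooth_map N E (h j p a)" by (simp add: topspace_smooth_space)
    then show ?thesis using a is_mfdD(2)[OF N] unfolding smooth_map_def by blast
  qed
  \<comment> \<open>The tautological family gives joint continuity over compact sets of
    \<open>b\<close>; local compactness removes the restriction. After that, \<open>H j l\<close> is
    \<open>h j\<close> followed by a continuous map.\<close>
  have ev: "continuous_map (prod_topology (topo ?G) (bracket_topology ?Y ?V l)) (topo E)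
      (\<lambda>(g, b). bracket_map ?Y ?V E (g \<circ> inv_into V \<mu>) l b)" for l
  proof (rule kcont_locally_compact)
    have "psmooth (topo ?G) ?Y ?V E (\<lambda>g. g \<circ> inv_into V \<mu>)"
      by (rule psmooth_map_chart[OF N psmooth_map_ident[OF N E] a])
    then show "kcont (topo ?G) (bracket_topology ?Y ?V l) (topo E) (\<lambda>g. bracket_map ?Y ?V E (g \<circ> inv_into V \<mu>) l)"
      unfolding psmooth_iff_bracket_map[OF Y E V] by blast
    show "locally_compact_space (bracket_topology ?Y ?V l)" by (rule locally_compact_tower[OF K lc Y V])
  qed
  have "partial_diff_quots P X U ?Y ?V E H"
    unfolding partial_diff_quots_def
  proof (intro conjI allI ballI)
    fix j l
    have "kcont P (prod_topology (bracket_topology X U j) (bracket_topology ?Y ?V l))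
        (prod_topology (topo ?G) (bracket_topology ?Y ?V l)) (\<lambda>p z. (h j p (fst z), snd z))"
      by (intro kcont_Pair kcont_precompose[OF kh continuous_map_fst] kcont_point continuous_map_snd)
    from kcont_postcompose[OF this ev]
    show "kcont P (prod_topology (bracket_topology X U j) (bracket_topology ?Y ?V l)) (topo E) (\<lambda>p (a, b). H j l p a b)"
      by (simp add: H_def case_prod_unfold)
    fix p assume p: "p \<in> topspace P"
    {
      fix b assume b: "b \<in> bracket_set ?Y ?V l"
      show "tower_dquot X U E j (\<lambda>a. H j l p a b) (\<lambda>a. H (Suc j) l p a b)"
        unfolding tower_dquot_def H_def
      proof (intro allI impI)
        fix x y t assume s: "Step x y t \<in> bracket_set X U (Suc j)"
        then have m: "x \<in> bracket_set X U j" "line X x y t \<in> bracket_set X U j" by auto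
        have "scl ?G t (h (Suc j) p (Step x y t)) = h j p (line X x y t) - h j p x"
          using h(1) p s unfolding diff_quots_def tower_dquot_def by blast
        \<comment> \<open>An equation between functions on \<open>N\<close> holds pointwise, and
          \<open>bracket_map_linear\<close> carries it to the bracket maps of order
          \<open>l\<close>.\<close>
        then have "scl E t (h (Suc j) p (Step x y t) z) = h j p (line X x y t) z - h j p x z" for z
          unfolding smooth_space_def by (simp add: fun_eq_iff)
        then show "scl E t (bracket_map ?Y ?V E (h (Suc j) p (Step x y t) \<circ> inv_into V \<mu>) l b) =
            bracket_map ?Y ?V E (h j p (line X x y t) \<circ> inv_into V \<mu>) l b - bracket_map ?Y ?V E (h j p x \<circ> inv_into V \<mu>) l b"
          by (intro bracket_map_linear[OF Y E V sm[OF p m(2)] sm[OF p m(1)] sm[OF p s] _ b]) simp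
      qed
    next
      fix a assume "a \<in> bracket_set X U j"
      from smooth_on_bracket(2)[OF Y E VS sm[OF p this]]
      show "tower_dquot ?Y ?V E l (H j l p a) (H j (Suc l) p a)" by (simp only: H_def[abs_def])
    }
  qed
  moreover have "H 0 0 p (Base x) (Base y) = F p x (inv_into V \<mu> y)" if "p \<in> topspace P" "x \<in> U" for p x y
    by (simp add: H_def h(2) that)
  ultimately show ?thesis by blast
qed

text \<open>The partial quotients are given separately in each chart of \<open>N\<close>, whereas
  the quotient with values in the function space must be one map on all of \<open>N\<close>. It is
  formed for each point \<open>y\<close> from \<open>\<lambda>x. F p x y\<close>, and uniqueness
  identifies it with \<open>H j 0\<close> in every chart.\<close>

lemma psmooth_into_smooth_space:
  assumes U: "openin (topo X) U"
    and z: "\<And>p x. \<lbrakk>p \<in> topspace P; x \<in> U\<rbrakk> \<Longrightarrow> zero_outside (topspace (space_of N)) (F p x) = F p x"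
    and H: "\<And>V \<mu>. (V, \<mu>) \<in> atlas N \<Longrightarrow> \<exists>H. partial_diff_quots P X U (model N) (\<mu> ` V) E H \<and>
       (\<forall>p\<in>topspace P. \<forall>x\<in>U. \<forall>y\<in>\<mu> ` V. H 0 0 p (Base x) (Base y) = F p x (inv_into V \<mu> y))"
  shows "psmooth P X U (smooth_space N E) F"
proof -
  interpret E: vector_space "scl E" using is_tvsD(1)[OF E] .
  let ?G = "smooth_space N E" and ?Y = "model N" and ?N = "topspace (space_of N)"
  note Y = is_mfdD(1)[OF N]
  have US: "U \<subseteq> topspace (topo X)" by (rule openin_subset[OF U])
  \<comment> \<open>Neither a chart nor a choice of \<open>H\<close> enters here, so the values over
    different charts fit together.\<close>
  define h where "h j p a = zero_outside ?N (\<lambda>y. bracket_map X U E (\<lambda>x. F p x y) j a)" for j p a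
  have sc: "scl ?G c f = (\<lambda>x. scl E c (f x))" for c f by (simp add: smooth_space_def)
  have chart: "\<exists>H. partial_diff_quots P X U ?Y (\<mu> ` V) E H \<and>
      (\<forall>j. \<forall>p\<in>topspace P. \<forall>a\<in>bracket_set X U j. \<forall>y\<in>V. h j p a y = H j 0 p a (Base (\<mu> y)))"
    if a: "(V, \<mu>) \<in> atlas N" for V \<mu>
  proof -
    note c = is_chartD[OF is_mfdD(5)[OF N a]]
    have VS: "\<mu> ` V \<subseteq> topspace (topo ?Y)" by (rule openin_subset[OF c(2)])
    obtain H where H: "partial_diff_quots P X U ?Y (\<mu> ` V) E H"
      "\<And>p x y. \<lbrakk>p \<in> topspace P; x \<in> U; y \<in> \<mu> ` V\<rbrakk> \<Longrightarrow> H 0 0 p (Base x) (Base y) = F p x (inv_into V \<mu> y)"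
      using H[OF a] by blast
    have "h j p a y = H j 0 p a (Base (\<mu> y))" if p: "p \<in> topspace P" and aj: "a \<in> bracket_set X U j" and y: "y \<in> V" for j p a y
    proof -
      have yN: "y \<in> ?N" using c(1) y openin_subset by blast
      have b: "Base (\<mu> y) \<in> bracket_set ?Y (\<mu> ` V) 0" using y by simp
      have "diff_quots P X U E (\<lambda>j p a. H j 0 p a (Base (\<mu> y)))"
        unfolding diff_quots_def
      proof (intro allI conjI ballI)
        fix j
        have "kcont P (prod_topology (bracket_topology X U j) (bracket_topology ?Y (\<mu> ` V) 0)) (topo E) (\<lambda>p (a, b). H j 0 p a b)"
          using H(1) unfolding partial_diff_quots_def by blast
        moreover have "continuous_map (bracket_topology X U j) (prod_topology (bracket_topology X U j) (bracket_topology ?Y (\<mu> ` V) 0))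
            (\<lambda>a. (a, Base (\<mu> y)))"
          using b topspace_bracket[OF VS, of 0] by (simp add: continuous_map_pairwise o_def)
        ultimately show "kcont P (bracket_topology X U j) (topo E) (\<lambda>p a. H j 0 p a (Base (\<mu> y)))"
          using kcont_precompose by fastforce
        fix p assume "p \<in> topspace P"
        then show "tower_dquot X U E j (\<lambda>a. H j 0 p a (Base (\<mu> y))) (\<lambda>a. H (Suc j) 0 p a (Base (\<mu> y)))"
          using H(1) b unfolding partial_diff_quots_def by blast
      qed
      from bracket_map_eq(1)[OF X E U this p _ aj, of "\<lambda>x. F p x y"]
      have "bracket_map X U E (\<lambda>x. F p x y) j a = H j 0 p a (Base (\<mu> y))"
        using H(2)[OF p _ imageI[OF y]] inv_into_f_f[OF c(3) y] by simp
      then show ?thesis using yN by (simp add: h_def zero_outside_def)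
    qed
    then show ?thesis using H(1) by blast
  qed
  have "diff_quots P X U ?G h"
    unfolding diff_quots_def
  proof (intro allI conjI ballI)
    fix j
    show "kcont P (bracket_topology X U j) (topo ?G) (h j)"
    proof (rule kcontI)
      fix Q C assume QC: "Q \<subseteq> topspace P" "C \<subseteq> topspace (bracket_topology X U j)" "(\<exists>p. Q = {p}) \<or> compactin (bracket_topology X U j) C"
      \<comment> \<open>The pairs \<open>(p, a)\<close> become the parameters: continuity into the
        function space is smoothness of the family \<open>h j p a\<close> over them, with quotients
        \<open>H j l p a\<close>.\<close>
      let ?P = "prod_topology (subtopology P Q) (subtopology (bracket_topology X U j) C)"
      have sm: "psmooth_map ?P N E (\<lambda>(p, a). h j p a)"
      proof (rule psmooth_map_atlas[OF N E])
        fix V \<mu> assume a: "(V, \<mu>) \<in> atlas N"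
        note c = is_chartD[OF is_mfdD(5)[OF N a]]
        obtain H where H: "partial_diff_quots P X U ?Y (\<mu> ` V) E H"
          "\<And>j p a y. \<lbrakk>p \<in> topspace P; a \<in> bracket_set X U j; y \<in> V\<rbrakk> \<Longrightarrow> h j p a y = H j 0 p a (Base (\<mu> y))"
          using chart[OF a] by blast
        have top: "p \<in> topspace P" "a \<in> bracket_set X U j" if "(p, a) \<in> topspace ?P" for p a
          using that QC topspace_bracket[OF US, of j] by auto
        have "diff_quots ?P ?Y (\<mu> ` V) E (\<lambda>l (p, a). H j l p a)"
          unfolding diff_quots_def
        proof (intro allI conjI ballI)
          fix l
          have "kcont P (prod_topology (bracket_topology X U j) (bracket_topology ?Y (\<mu> ` V) l)) (topo E) (\<lambda>p (a, b). H j l p a b)"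
            using H(1) unfolding partial_diff_quots_def by blast
          from kcont_curry[OF this QC]
          show "kcont ?P (bracket_topology ?Y (\<mu> ` V) l) (topo E) (\<lambda>(p, a). H j l p a)" by (simp add: case_prod_unfold)
          fix q assume q: "q \<in> topspace ?P"
          obtain p a where pa: "q = (p, a)" by (cases q)
          then have "p \<in> topspace P" "a \<in> bracket_set X U j" using top[of p a] q by blast+
          then have "tower_dquot ?Y (\<mu> ` V) E l (H j l p a) (H j (Suc l) p a)"
            using H(1) unfolding partial_diff_quots_def by blast
          then show "tower_dquot ?Y (\<mu> ` V) E l ((\<lambda>(p, a). H j l p a) q) ((\<lambda>(p, a). H j (Suc l) p a) q)"
            by (simp only: pa prod.case)
        qed
        moreover have "(\<lambda>(p, a). H j 0 p a) q (Base x) = ((\<lambda>(p, a). h j p a) q \<circ> inv_into V \<mu>) x"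
          if q: "q \<in> topspace ?P" and x: "x \<in> \<mu> ` V" for q x
        proof -
          obtain p a where pa: "q = (p, a)" by (cases q)
          have "inv_into V \<mu> x \<in> V" "\<mu> (inv_into V \<mu> x) = x" using x by (simp_all add: inv_into_into f_inv_into_f)
          then show ?thesis using H(2)[OF top[of p a], of "inv_into V \<mu> x"] q pa by simp
        qed
        ultimately show "psmooth ?P ?Y (\<mu> ` V) E (\<lambda>q. (\<lambda>(p, a). h j p a) q \<circ> inv_into V \<mu>)"
          unfolding psmooth_def by blast
      qed
      have zz: "zero_outside ?N ((\<lambda>(p, a). h j p a) q) = (\<lambda>(p, a). h j p a) q" if "q \<in> topspace ?P" for q
        by (simp add: h_def zero_outside_def fun_eq_iff case_prod_unfold)
      show "continuous_map ?P (topo ?G) (\<lambda>(p, a). h j p a)"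
        by (rule iffD2[OF continuous_map_smooth_space[OF N E zz] sm])
    qed
    fix p assume p: "p \<in> topspace P"
    show "tower_dquot X U ?G j (h j p) (h (Suc j) p)"
      unfolding tower_dquot_def
    proof (intro allI impI)
      fix x y t assume s: "Step x y t \<in> bracket_set X U (Suc j)"
      then have m: "x \<in> bracket_set X U j" "line X x y t \<in> bracket_set X U j" by auto
      show "scl ?G t (h (Suc j) p (Step x y t)) = h j p (line X x y t) - h j p x"
        unfolding sc
      proof
        fix w
        show "scl E t (h (Suc j) p (Step x y t) w) = (h j p (line X x y t) - h j p x) w"
        proof (cases "w \<in> ?N")
          case False
          then show ?thesis by (simp add: h_def zero_outside_def)
        next
          case True
          then obtain V \<mu> where a: "(V, \<mu>) \<in> atlas N" "w \<in> V" using is_mfdD(3)[OF N] by fastforce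
          obtain H where H: "partial_diff_quots P X U ?Y (\<mu> ` V) E H"
            "\<And>j p a y. \<lbrakk>p \<in> topspace P; a \<in> bracket_set X U j; y \<in> V\<rbrakk> \<Longrightarrow> h j p a y = H j 0 p a (Base (\<mu> y))"
            using chart[OF a(1)] by blast
          have "Base (\<mu> w) \<in> bracket_set ?Y (\<mu> ` V) 0" using a(2) by simp
          then have "tower_dquot X U E j (\<lambda>a. H j 0 p a (Base (\<mu> w))) (\<lambda>a. H (Suc j) 0 p a (Base (\<mu> w)))"
            using H(1) p unfolding partial_diff_quots_def by blast
          then have "scl E t (H (Suc j) 0 p (Step x y t) (Base (\<mu> w))) = H j 0 p (line X x y t) (Base (\<mu> w)) - H j 0 p x (Base (\<mu> w))"
            using s unfolding tower_dquot_def by blast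
          then show ?thesis using H(2)[OF p s a(2)] H(2)[OF p m(1) a(2)] H(2)[OF p m(2) a(2)] by simp
        qed
      qed
    qed
  qed
  moreover have "h 0 p (Base x) = F p x" if "p \<in> topspace P" "x \<in> U" for p x
    using z[OF that] by (simp add: h_def)
  ultimately show ?thesis unfolding psmooth_def by blast
qed

end

text \<open>Both sides are tested on atlases, so the two preceding lemmas apply to each pair of
  charts. The normalisation assumed of \<open>f p x\<close> puts it into the function space and has
  no influence on smoothness over the product.\<close>

theorem psmooth_map_exponential:
  fixes M :: "('k::topological_field, 'v::ab_group_add, 'm) mfd" and N :: "('k, 'w::ab_group_add, 'n) mfd"
    and E :: "('k, 'e::ab_group_add) tvs"
  assumes K: "locally_compact_space (euclidean :: 'k topology)" and lc: "locally_compact_space (topo (model N))"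
    and E: "is_tvs E" and M: "is_mfd M" and N: "is_mfd N"
    and z: "\<And>p x. \<lbrakk>p \<in> topspace P; x \<in> topspace (space_of M)\<rbrakk> \<Longrightarrow> zero_outside (topspace (space_of N)) (f p x) = f p x"
  shows "psmooth_map P (prod_mfd M N) E (\<lambda>p (x, y). f p x y) \<longleftrightarrow> psmooth_map P M (smooth_space N E) f"
proof
  note X = is_mfdD(1)[OF M] and G = is_tvs_smooth_space[OF N E]
  assume f: "psmooth_map P (prod_mfd M N) E (\<lambda>p (x, y). f p x y)"
  show "psmooth_map P M (smooth_space N E) f"
  proof (rule psmooth_map_atlas[OF M G], rule psmooth_into_smooth_space[OF N E X])
    fix U \<kappa> assume a: "(U, \<kappa>) \<in> atlas M"
    note c = is_chartD[OF is_mfdD(5)[OF M a]]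
    show "openin (topo (model M)) (\<kappa> ` U)" by (rule c(2))
    show "zero_outside (topspace (space_of N)) ((f p \<circ> inv_into U \<kappa>) x) = (f p \<circ> inv_into U \<kappa>) x"
      if "p \<in> topspace P" "x \<in> \<kappa> ` U" for p x
      using z[OF that(1), of "inv_into U \<kappa> x"] inv_into_into[OF that(2)] openin_subset[OF c(1)] by auto
    fix V \<mu> assume "(V, \<mu>) \<in> atlas N"
    with a f show "\<exists>H. partial_diff_quots P (model M) (\<kappa> ` U) (model N) (\<mu> ` V) E H \<and>
        (\<forall>p\<in>topspace P. \<forall>x\<in>\<kappa> ` U. \<forall>y\<in>\<mu> ` V. H 0 0 p (Base x) (Base y) = (f p \<circ> inv_into U \<kappa>) x (inv_into V \<mu> y))"
      unfolding psmooth_map_prod_mfd_iff[OF M N E] by fastforce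
  qed
next
  note X = is_mfdD(1)[OF M]
  assume f: "psmooth_map P M (smooth_space N E) f"
  show "psmooth_map P (prod_mfd M N) E (\<lambda>p (x, y). f p x y)"
    unfolding psmooth_map_prod_mfd_iff[OF M N E]
  proof (clarsimp)
    fix U \<kappa> V \<mu> assume a: "(U, \<kappa>) \<in> atlas M" "(V, \<mu>) \<in> atlas N"
    from partial_of_psmooth_into_smooth_space[OF N E X K lc is_chartD(2)[OF is_mfdD(5)[OF M a(1)]] psmooth_map_chart[OF M f a(1)] a(2)]
    show "\<exists>H. partial_diff_quots P (model M) (\<kappa> ` U) (model N) (\<mu> ` V) E H \<and>
       (\<forall>p\<in>topspace P. \<forall>x\<in>U. \<forall>y\<in>V. H 0 0 p (Base (\<kappa> x)) (Base (\<mu> y)) =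
          f p (inv_into U \<kappa> (\<kappa> x)) (inv_into V \<mu> (\<mu> y)))"
      by simp
  qed
qed

lemma zero_outside_eqI:
  "(\<And>x. x \<notin> S \<Longrightarrow> f x = 0) \<Longrightarrow> zero_outside S f = f"
  by (auto simp: zero_outside_def fun_eq_iff)

lemma zero_outside_eqD:
  assumes "zero_outside S f = f" "x \<notin> S"
  shows "f x = 0"
proof -
  have "f x = zero_outside S f x" by (simp add: assms(1))
  then show ?thesis using assms(2) by (simp add: zero_outside_def)
qed

theorem proposition12p2:
  fixes E :: "('k::topological_field, 'e::ab_group_add) tvs"
    and M :: "('k, 'v::ab_group_add, 'm) mfd"
    and N :: "('k, 'w::ab_group_add, 'n) mfd"
  assumes "locally_compact_space (euclidean :: 'k topology)"
    and "is_tvs E"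
    and "is_mfd M"
    and "is_mfd N" and "finite_dimensional (model N)"
  shows "(\<forall>g \<in> topspace (space_of M) \<rightarrow> topspace (topo (smooth_space N E)).
            smooth_map M (smooth_space N E) g \<longleftrightarrow>
            smooth_map (prod_mfd M N) E (\<lambda>(x, y). g x y))
       \<and> tvs_iso (smooth_space (prod_mfd M N) E) (smooth_space M (smooth_space N E))
            (\<lambda>f x y. f (x, y)) (\<lambda>g (x, y). g x y)"
proof -
  note K = assms(1) and E = assms(2) and M = assms(3) and N = assms(4)
  let ?G = "smooth_space N E" and ?MN = "prod_mfd M N"
  let ?A = "smooth_space ?MN E" and ?B = "smooth_space M ?G"
  note G = is_tvs_smooth_space[OF N E] and MN = is_mfd_prod[OF M N]
  note lc = locally_compact_finite_dimensional[OF K is_mfdD(1)[OF N] assms(5)]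
  note law = psmooth_map_exponential[OF K lc E M N]
  have sp: "topspace (space_of ?MN) = topspace (space_of M) \<times> topspace (space_of N)"
    by (simp add: prod_mfd_def)
  have zG: "zero_outside (topspace (space_of N)) g = g" if "g \<in> topspace (topo ?G)" for g
    using that by (simp add: topspace_smooth_space)
  \<comment> \<open>The law for a one-point parameter space.\<close>
  have a: "smooth_map M ?G g \<longleftrightarrow> smooth_map ?MN E (\<lambda>(x, y). g x y)"
    if g: "g \<in> topspace (space_of M) \<rightarrow> topspace (topo ?G)" for g
    unfolding smooth_map_iff_psmooth_map[OF M G] smooth_map_iff_psmooth_map[OF MN E]
    by (rule law[symmetric]) (use g zG in blast)
  \<comment> \<open>By the universal property, continuity is smoothness of the family
    \<open>f \<mapsto> (\<lambda>x y. f (x, y))\<close> parametrised by the source space; the law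
    turns this into smoothness of the tautological family on the product.\<close>
  have \<Phi>: "continuous_map (topo ?A) (topo ?B) (\<lambda>f x y. f (x, y))"
  proof (rule iffD2[OF continuous_map_smooth_space[OF M G]])
    have z: "f (x, y) = 0" if "f \<in> topspace (topo ?A)" "x \<notin> topspace (space_of M) \<or> y \<notin> topspace (space_of N)" for f x y
      using zero_outside_eqD[of "topspace (space_of ?MN)" f "(x, y)"] that by (auto simp: topspace_smooth_space sp)
    show "zero_outside (topspace (space_of M)) (\<lambda>x y. f (x, y)) = (\<lambda>x y. f (x, y))" if "f \<in> topspace (topo ?A)" for f
      by (rule zero_outside_eqI) (simp add: fun_eq_iff z[OF that])
    have "psmooth_map (topo ?A) ?MN E (\<lambda>f (x, y). f (x, y))"
      using psmooth_map_ident[OF MN E] by simp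
    then show "psmooth_map (topo ?A) M ?G (\<lambda>f x y. f (x, y))"
    proof (rule iffD1[OF law, rotated])
      fix f x assume "f \<in> topspace (topo ?A)"
      then show "zero_outside (topspace (space_of N)) (\<lambda>y. f (x, y)) = (\<lambda>y. f (x, y))"
        by (intro zero_outside_eqI z) auto
    qed
  qed
  \<comment> \<open>The same argument in the other direction, starting from the tautological family
    over the maps from \<open>M\<close> into the function space on \<open>N\<close>.\<close>
  have \<Psi>: "continuous_map (topo ?B) (topo ?A) (\<lambda>g (x, y). g x y)"
  proof (rule iffD2[OF continuous_map_smooth_space[OF MN E]])
    \<comment> \<open>Evaluation at \<open>x\<close> is continuous, and in particular takes values
      in the carrier of the function space on \<open>N\<close>; this supplies the vanishing of
      \<open>g x\<close> outside \<open>N\<close>.\<close>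
    have gx: "g x \<in> topspace (topo ?G)" if "g \<in> topspace (topo ?B)" "x \<in> topspace (space_of M)" for g x
      using continuous_map_funspace[OF psmooth_map_eval[OF M psmooth_map_ident[OF M G] that(2)]] that(1) by blast
    show "zero_outside (topspace (space_of ?MN)) (\<lambda>(x, y). g x y) = (\<lambda>(x, y). g x y)" if g: "g \<in> topspace (topo ?B)" for g
    proof (rule zero_outside_eqI)
      fix z assume z: "z \<notin> topspace (space_of ?MN)"
      obtain x y where xy: "z = (x, y)" by (cases z)
      have "g x y = 0"
      proof (cases "x \<in> topspace (space_of M)")
        case True
        then have "y \<notin> topspace (space_of N)" using z xy sp by simp
        then show ?thesis by (rule zero_outside_eqD[OF zG[OF gx[OF g True]]])
      next
        case False
        have "zero_outside (topspace (space_of M)) g = g" using g by (simp add: topspace_smooth_space)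
        from zero_outside_eqD[OF this False] show ?thesis by simp
      qed
      then show "(case z of (x, y) \<Rightarrow> g x y) = 0" by (simp add: xy)
    qed
    show "psmooth_map (topo ?B) ?MN E (\<lambda>g (x, y). g x y)"
      by (rule iffD2[OF law psmooth_map_ident[OF M G]]) (use gx zG in blast)
  qed
  have "tvs_iso ?A ?B (\<lambda>f x y. f (x, y)) (\<lambda>g (x, y). g x y)"
    unfolding tvs_iso_def homeomorphic_maps_def
    using is_tvs_smooth_space[OF MN E] is_tvs_smooth_space[OF M G] \<Phi> \<Psi>
    by (auto simp: fun_eq_iff smooth_space_def)
  with a show ?thesis by blast
qed

end
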